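(* Let $\mathcal{E}$ be an essentially small finitely-powered regular category, let $\mathfrak{G}$ be the pro-oligomorphic group attached to the principal objects of $\mathcal{E}$, and let $\mathcal{C}$ be the category of finitary smooth $\mathfrak{G}$-sets whose orbits are of the form $\mathfrak{B}(X)$ with $X$ principal. Let $\mu$ be a measure for $\mathcal{C}$ valued in a commutative ring $k$. The following are equivalent: (a) There is a degree function $\nu$ for $\mathcal{E}$ valued in $k$ such that for every surjection $f\colon Y\to X$ of principal objects, $$\mu(f\colon\mathfrak{B}(Y)\to\mathfrak{B}(X))=\sum_{Z\subset Y,\ f(Z)=X}\text{m\"ob}(Z,Y)\cdot\nu(f|_Z),$$ where $\text{m\"ob}$ is the M\"obius function of the lattice $\mathrm{Sub}(Y)$ of subobjects of $Y$. (b) For every surjection $Y\to X$ of principal objects of $\mathcal{E}$, the induced map $\mathfrak{A}_1(Y)\to\mathfrak{A}_1(X)$ is $\mu$-constant.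
   Context: **Regular categories.** A category is regular if it is finitely complete, kernel pairs have coequalizers, and regular epimorphisms are stable under base change. "Injection" = monomorphism, "surjection" = regular epimorphism; morphisms factor uniquely as a surjection followed by an injection (giving images). Finitely-powered: every object has finitely many subobjects. An object $X$ is principal if $X\to\mathbf 1$ is surjective ($\mathbf 1$ the final object). **Degree function** valued in $k$: a rule assigning to each surjection $f\colon Y\to X$ of principal objects an element $\nu(f)\in k$ such that $\nu(f)=1$ for isomorphisms; $\nu(g\circ f)=\nu(g)\nu(f)$ when defined; and $\nu(f')=\nu(f)$ whenever $f'$ is the base change of $f$ along any map $X'\to X$ of principal objects. **The group.** A pro-oligomorphic group is a Hausdorff topological group whose open subgroups form a neighborhood basis of $1$ and with $U\backslash G/V$ finite for all open subgroups $U,V$. A $G$-set is smooth if stabilizers are open, finitary if it has finitely many orbits. Let $\mathcal{E}^s_1$ be the category of principal objects with surjections as morphisms. Fix a pro-object $\Omega=(\Omega_i)$ of $\mathcal{E}^s_1$ (indexed by a directed set) that is universal ($\mathrm{Hom}(\Omega,X)\ne\emptyset$ for all $X$) and homogeneous ($\mathrm{Aut}(\Omega)$ is transitive on $\mathrm{Hom}(\Omega,X)$ for all $X$); such exists. Let $\mathfrak{G}=\mathrm{Aut}(\Omega)$ and, for $X$ principal, $\mathfrak{B}(X)=\varinjlim_i\mathrm{Surj}(\Omega_i,X)$, the set of surjections $\Omega\to X$, with action $g\cdot f=f\circ g^{-1}$. With the topology generated by stabilizers of elements of the $\mathfrak{B}(X)$, $\mathfrak{G}$ is pro-oligomorphic,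 the $\mathfrak{B}(X)$ are transitive and smooth, and $\mathfrak{G}$-maps $\mathfrak{B}(Y)\to\mathfrak{B}(X)$ correspond bijectively to surjections $Y\to X$. For $X$ principal, $\mathfrak{A}_1(X)=\coprod_Y\mathfrak{B}(Y)$ over principal subobjects $Y$ of $X$; equivalently $\mathfrak{A}_1(X)=\mathrm{Hom}_{\mathrm{Pro}(\mathcal{E})}(\Omega,X)$, which is functorial in $X$. **Measures.** Atoms of $\mathcal{C}$ are its transitive $\mathfrak{G}$-sets. A measure for $\mathcal{C}$ valued in $k$ assigns to each morphism $f\colon Y\to X$ of atoms an element $\mu(f)\in k$ with: $\mu(f)=1$ for isomorphisms; $\mu(g\circ f)=\mu(g)\mu(f)$; and, if $X'\to X$ is a morphism of atoms and $Y\times_XX'=\bigsqcup_iY'_i$ with each $Y'_i$ an atom and $f'_i\colon Y_i'\to X'$ the induced map, then $\mu(f)=\sum_i\mu(f_i')$. For $f\colon Y\to X$ with $X$ an atom and $Y=\bigsqcup Y_i$, $Y_i$ atoms, put $\mu(f)=\sum_i\mu(f|_{Y_i})$. A map $f\colon Y\to X$ in $\mathcal{C}$, with $X=\bigsqcup_{i=1}^nX_i$ the decomposition into atoms, is $\mu$-constant if $\mu(f^{-1}(X_i)\to X_i)$ is independent of $i$. *)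

theory Defs
  imports "HOL-Algebra.Group_Action" "HOL-Analysis.Abstract_Topology"
begin

section \<open>Categories and finite limits\<close>

record ('o, 'm) category =
  Obj :: "'o set"
  Arr :: "'m set"
  Dom :: "'m \<Rightarrow> 'o"
  Cod :: "'m \<Rightarrow> 'o"
  Ide :: "'o \<Rightarrow> 'm"
  Cmp :: "'m \<Rightarrow> 'm \<Rightarrow> 'm" (infixl \<open>\<odot>\<index>\<close> 70)

definition homset :: "('o, 'm) category \<Rightarrow> 'o \<Rightarrow> 'o \<Rightarrow> 'm set" where
  "homset C X Y = {f \<in> Arr C. Dom C f = X \<and> Cod C f = Y}"

text \<open>A category whose objects and arrows are elements of types is small, and every
  essentially small category is equivalent to one of this kind.\<close>

locale category =
  fixes C :: "('o, 'm) category" (structure)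
  assumes Dom_in: "f \<in> Arr C \<Longrightarrow> Dom C f \<in> Obj C"
    and Cod_in: "f \<in> Arr C \<Longrightarrow> Cod C f \<in> Obj C"
    and Ide_in: "X \<in> Obj C \<Longrightarrow> Ide C X \<in> homset C X X"
    and Cmp_in: "\<lbrakk>f \<in> homset C X Y; g \<in> homset C Y Z\<rbrakk> \<Longrightarrow> g \<odot> f \<in> homset C X Z"
    and Cmp_Ide: "f \<in> homset C X Y \<Longrightarrow> f \<odot> Ide C X = f"
    and Ide_Cmp: "f \<in> homset C X Y \<Longrightarrow> Ide C Y \<odot> f = f"
    and Cmp_assoc: "\<lbrakk>f \<in> homset C W X; g \<in> homset C X Y; h \<in> homset C Y Z\<rbrakk>
      \<Longrightarrow> (h \<odot> g) \<odot> f = h \<odot> (g \<odot> f)"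

definition diagram ::
  "('j, 'a) category \<Rightarrow> ('o, 'm) category \<Rightarrow> ('j \<Rightarrow> 'o) \<Rightarrow> ('a \<Rightarrow> 'm) \<Rightarrow> bool" where
  "diagram J C Fo Fa \<longleftrightarrow>
     (\<forall>j\<in>Obj J. Fo j \<in> Obj C \<and> Fa (Ide J j) = Ide C (Fo j)) \<and>
     (\<forall>a\<in>Arr J. Fa a \<in> homset C (Fo (Dom J a)) (Fo (Cod J a))) \<and>
     (\<forall>a\<in>Arr J. \<forall>b\<in>Arr J. Cod J a = Dom J b \<longrightarrow> Fa (b \<odot>\<^bsub>J\<^esub> a) = Fa b \<odot>\<^bsub>C\<^esub> Fa a)"

definition is_cone ::
  "('j, 'a) category \<Rightarrow> ('o, 'm) category \<Rightarrow> ('j \<Rightarrow> 'o) \<Rightarrow> ('a \<Rightarrow> 'm) \<Rightarrow> 'o \<Rightarrow> ('j \<Rightarrow> 'm) \<Rightarrow> bool"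
  where
  "is_cone J C Fo Fa L p \<longleftrightarrow> L \<in> Obj C \<and>
     (\<forall>j\<in>Obj J. p j \<in> homset C L (Fo j)) \<and>
     (\<forall>a\<in>Arr J. Fa a \<odot>\<^bsub>C\<^esub> p (Dom J a) = p (Cod J a))"

definition limit_cone ::
  "('j, 'a) category \<Rightarrow> ('o, 'm) category \<Rightarrow> ('j \<Rightarrow> 'o) \<Rightarrow> ('a \<Rightarrow> 'm) \<Rightarrow> 'o \<Rightarrow> ('j \<Rightarrow> 'm) \<Rightarrow> bool"
  where
  "limit_cone J C Fo Fa L p \<longleftrightarrow> is_cone J C Fo Fa L p \<and>
     (\<forall>L' p'. is_cone J C Fo Fa L' p' \<longrightarrow>
        (\<exists>!h. h \<in> homset C L' L \<and> (\<forall>j\<in>Obj J. p j \<odot>\<^bsub>C\<^esub> h = p' j)))"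

text \<open>Every finite category is isomorphic to one whose objects and arrows are natural numbers.\<close>

definition finitely_complete :: "('o, 'm) category \<Rightarrow> bool" where
  "finitely_complete C \<longleftrightarrow>
     (\<forall>(J :: (nat, nat) category) Fo Fa.
        category J \<and> finite (Obj J) \<and> finite (Arr J) \<and> diagram J C Fo Fa
        \<longrightarrow> (\<exists>L p. limit_cone J C Fo Fa L p))"

definition is_terminal :: "('o, 'm) category \<Rightarrow> 'o \<Rightarrow> bool" where
  "is_terminal C T \<longleftrightarrow> T \<in> Obj C \<and> (\<forall>X\<in>Obj C. \<exists>!f. f \<in> homset C X T)"

definition pullback :: "('o, 'm) category \<Rightarrow> 'm \<Rightarrow> 'm \<Rightarrow> 'm \<Rightarrow> 'm \<Rightarrow> bool" where
  "pullback C f g p q \<longleftrightarrow>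
     {f, g, p, q} \<subseteq> Arr C \<and> Cod C f = Cod C g \<and> Dom C p = Dom C q \<and>
     Cod C p = Dom C f \<and> Cod C q = Dom C g \<and> f \<odot>\<^bsub>C\<^esub> p = g \<odot>\<^bsub>C\<^esub> q \<and>
     (\<forall>W a b. a \<in> homset C W (Dom C f) \<and> b \<in> homset C W (Dom C g) \<and> f \<odot>\<^bsub>C\<^esub> a = g \<odot>\<^bsub>C\<^esub> b
        \<longrightarrow> (\<exists>!h. h \<in> homset C W (Dom C p) \<and> p \<odot>\<^bsub>C\<^esub> h = a \<and> q \<odot>\<^bsub>C\<^esub> h = b))"

definition coequalizer :: "('o, 'm) category \<Rightarrow> 'm \<Rightarrow> 'm \<Rightarrow> 'm \<Rightarrow> bool" where
  "coequalizer C a b q \<longleftrightarrow>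
     {a, b, q} \<subseteq> Arr C \<and> Dom C a = Dom C b \<and> Cod C a = Cod C b \<and> Cod C a = Dom C q \<and>
     q \<odot>\<^bsub>C\<^esub> a = q \<odot>\<^bsub>C\<^esub> b \<and>
     (\<forall>W r. r \<in> homset C (Dom C q) W \<and> r \<odot>\<^bsub>C\<^esub> a = r \<odot>\<^bsub>C\<^esub> b
        \<longrightarrow> (\<exists>!h. h \<in> homset C (Cod C q) W \<and> h \<odot>\<^bsub>C\<^esub> q = r))"

definition is_iso :: "('o, 'm) category \<Rightarrow> 'm \<Rightarrow> bool" where
  "is_iso C f \<longleftrightarrow> f \<in> Arr C \<and>
     (\<exists>g \<in> homset C (Cod C f) (Dom C f).
        g \<odot>\<^bsub>C\<^esub> f = Ide C (Dom C f) \<and> f \<odot>\<^bsub>C\<^esub> g = Ide C (Cod C f))"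

definition injection :: "('o, 'm) category \<Rightarrow> 'm \<Rightarrow> bool" where
  "injection C m \<longleftrightarrow> m \<in> Arr C \<and>
     (\<forall>W. \<forall>a\<in>homset C W (Dom C m). \<forall>b\<in>homset C W (Dom C m).
        m \<odot>\<^bsub>C\<^esub> a = m \<odot>\<^bsub>C\<^esub> b \<longrightarrow> a = b)"

definition surjection :: "('o, 'm) category \<Rightarrow> 'm \<Rightarrow> bool" where
  "surjection C q \<longleftrightarrow> (\<exists>a b. coequalizer C a b q)"

definition regular_category :: "('o, 'm) category \<Rightarrow> bool" where
  "regular_category C \<longleftrightarrow> category C \<and> finitely_complete C \<and>
     (\<forall>f p q. pullback C f f p q \<longrightarrow> (\<exists>c. coequalizer C p q c)) \<and>
     (\<forall>f g p q. pullback C f g p q \<and> surjection C f \<longrightarrow> surjection C q)"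


section \<open>Subobjects and the Moebius function\<close>

text \<open>A subobject is an equivalence class of injections with a common target.\<close>

definition factors_through :: "('o, 'm) category \<Rightarrow> 'm \<Rightarrow> 'm \<Rightarrow> bool" where
  "factors_through C m n \<longleftrightarrow> (\<exists>h \<in> homset C (Dom C m) (Dom C n). n \<odot>\<^bsub>C\<^esub> h = m)"

definition subobject_class :: "('o, 'm) category \<Rightarrow> 'm \<Rightarrow> 'm set" where
  "subobject_class C m =
     {n. injection C n \<and> Cod C n = Cod C m \<and> factors_through C m n \<and> factors_through C n m}"

definition Sub :: "('o, 'm) category \<Rightarrow> 'o \<Rightarrow> 'm set set" where
  "Sub C X = {subobject_class C m | m. injection C m \<and> Cod C m = X}"

definition Sub_order :: "('o, 'm) category \<Rightarrow> 'o \<Rightarrow> ('m set \<times> 'm set) set" where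
  "Sub_order C X =
     {(Z, W). Z \<in> Sub C X \<and> W \<in> Sub C X \<and> (\<exists>m\<in>Z. \<exists>n\<in>W. factors_through C m n)}"

definition finitely_powered :: "('o, 'm) category \<Rightarrow> bool" where
  "finitely_powered C \<longleftrightarrow> (\<forall>X\<in>Obj C. finite (Sub C X))"

definition whole :: "('o, 'm) category \<Rightarrow> 'o \<Rightarrow> 'm set" where
  "whole C X = subobject_class C (Ide C X)"

text \<open>The image \<open>f(Z)\<close>: all injections \<open>m\<close> occurring in a factorization of \<open>f|\<^sub>Z\<close> as a
  surjection followed by \<open>m\<close>.\<close>

definition image_sub :: "('o, 'm) category \<Rightarrow> 'm \<Rightarrow> 'm set \<Rightarrow> 'm set" where
  "image_sub C f Z =
     {m. injection C m \<and> (\<exists>n\<in>Z. \<exists>e. surjection C e \<and> Cod C e = Dom C m \<and> m \<odot>\<^bsub>C\<^esub> e = f \<odot>\<^bsub>C\<^esub> n)}"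

definition restrict_sub :: "('o, 'm) category \<Rightarrow> 'm \<Rightarrow> 'm set \<Rightarrow> 'm" where
  "restrict_sub C f Z = f \<odot>\<^bsub>C\<^esub> (SOME n. n \<in> Z)"

text \<open>The Moebius function of a finite partially ordered set \<open>(P, r)\<close>, with its integer values
  taken in a commutative ring. The sort \<open>{comm_ring, comm_monoid_mult}\<close> is that of
  commutative rings with unit in which, unlike in \<open>comm_ring_1\<close>, \<open>0 = 1\<close> is allowed.\<close>

function moebius ::
  "'a set \<Rightarrow> ('a \<times> 'a) set \<Rightarrow> 'a \<Rightarrow> 'a \<Rightarrow> 'k :: {comm_ring, comm_monoid_mult}" where
  "moebius P r x y =
     (if \<not> (finite P \<and> partial_order_on P r) \<or> (x, y) \<notin> r then 0
      else if x = y then 1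
      else - (\<Sum>z | z \<in> P \<and> (x, z) \<in> r \<and> (z, y) \<in> r \<and> z \<noteq> y. moebius P r x z))"
  by pat_completeness auto

termination
proof (relation "measure (\<lambda>(P, r, x, y). card {z \<in> P. (z, y) \<in> r})", simp, clarsimp)
  fix P :: "'a set" and r x y z
  assume P: "finite P" "partial_order_on P r" and z: "z \<in> P" "(z, y) \<in> r" "z \<noteq> y"
    and xy: "(x, y) \<in> r"
  have refl: "refl_on P r" and r: "r \<subseteq> P \<times> P" and "trans r" "antisym r"
    using P(2) by (auto simp: partial_order_on_def preorder_on_def)
  then have "{w \<in> P. (w, z) \<in> r} \<subseteq> {w \<in> P. (w, y) \<in> r}"
    using z by (auto dest: transD)
  moreover have "y \<in> {w \<in> P. (w, y) \<in> r}" "y \<notin> {w \<in> P. (w, z) \<in> r}"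
    using xy r refl \<open>antisym r\<close> z by (auto dest: refl_onD antisymD)
  ultimately show "card {w \<in> P. (w, z) \<in> r} < card {w \<in> P. (w, y) \<in> r}"
    using P(1) by (intro psubset_card_mono) auto
qed

declare moebius.simps [simp del]


section \<open>Principal objects and degree functions\<close>

definition principal_object :: "('o, 'm) category \<Rightarrow> 'o \<Rightarrow> bool" where
  "principal_object C X \<longleftrightarrow> (\<exists>T f. is_terminal C T \<and> f \<in> homset C X T \<and> surjection C f)"

text \<open>The category \<open>\<E>\<^sup>s\<^sub>1\<close> of principal objects and surjections between them.\<close>

definition principal_cat :: "('o, 'm) category \<Rightarrow> ('o, 'm) category" where
  "principal_cat C =
     C\<lparr>Obj := {X \<in> Obj C. principal_object C X},
       Arr := {f \<in> Arr C. principal_object C (Dom C f) \<and> principal_object C (Cod C f) \<and> surjection C f}\<rparr>"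

definition degree_function ::
  "('o, 'm) category \<Rightarrow> ('m \<Rightarrow> 'k :: {comm_ring, comm_monoid_mult}) \<Rightarrow> bool" where
  "degree_function C \<nu> \<longleftrightarrow>
     (\<forall>f\<in>Arr (principal_cat C). is_iso C f \<longrightarrow> \<nu> f = 1) \<and>
     (\<forall>f\<in>Arr (principal_cat C). \<forall>g\<in>Arr (principal_cat C). Cod C f = Dom C g
        \<longrightarrow> \<nu> (g \<odot>\<^bsub>C\<^esub> f) = \<nu> g * \<nu> f) \<and>
     (\<forall>f\<in>Arr (principal_cat C). \<forall>g p f'. principal_object C (Dom C g) \<and> pullback C f g p f'
        \<longrightarrow> \<nu> f' = \<nu> f)"


section \<open>Pro-objects\<close>

record ('i, 'o, 'm) pro_object =
  Idx :: "'i set"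
  Le :: "'i \<Rightarrow> 'i \<Rightarrow> bool"
  Ob :: "'i \<Rightarrow> 'o"
  Tr :: "'i \<Rightarrow> 'i \<Rightarrow> 'm"

text \<open>The transition map \<open>Tr \<Omega> i j\<close> goes from \<open>\<Omega>\<^sub>j\<close> to \<open>\<Omega>\<^sub>i\<close>, for \<open>i \<le> j\<close>.\<close>

definition is_pro_object :: "('o, 'm) category \<Rightarrow> ('i, 'o, 'm) pro_object \<Rightarrow> bool" where
  "is_pro_object C \<Omega> \<longleftrightarrow>
     Idx \<Omega> \<noteq> {} \<and>
     (\<forall>i\<in>Idx \<Omega>. Le \<Omega> i i) \<and>
     (\<forall>i\<in>Idx \<Omega>. \<forall>j\<in>Idx \<Omega>. \<forall>k\<in>Idx \<Omega>. Le \<Omega> i j \<and> Le \<Omega> j k \<longrightarrow> Le \<Omega> i k) \<and>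
     (\<forall>i\<in>Idx \<Omega>. \<forall>j\<in>Idx \<Omega>. \<exists>k\<in>Idx \<Omega>. Le \<Omega> i k \<and> Le \<Omega> j k) \<and>
     (\<forall>i\<in>Idx \<Omega>. Ob \<Omega> i \<in> Obj C \<and> Tr \<Omega> i i = Ide C (Ob \<Omega> i)) \<and>
     (\<forall>i\<in>Idx \<Omega>. \<forall>j\<in>Idx \<Omega>. Le \<Omega> i j \<longrightarrow> Tr \<Omega> i j \<in> homset C (Ob \<Omega> j) (Ob \<Omega> i)) \<and>
     (\<forall>i\<in>Idx \<Omega>. \<forall>j\<in>Idx \<Omega>. \<forall>k\<in>Idx \<Omega>. Le \<Omega> i j \<and> Le \<Omega> j k
        \<longrightarrow> Tr \<Omega> i j \<odot>\<^bsub>C\<^esub> Tr \<Omega> j k = Tr \<Omega> i k)"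

text \<open>\<open>pro_hom C \<Omega> X\<close> is \<open>Hom(\<Omega>, X)\<close> in the category of pro-objects of \<open>C\<close>, i.e.\ the
  filtered colimit of the sets \<open>homset C \<Omega>\<^sub>i X\<close>; its elements are the classes \<open>germ C \<Omega> i f\<close>.\<close>

definition germ ::
  "('o, 'm) category \<Rightarrow> ('i, 'o, 'm) pro_object \<Rightarrow> 'i \<Rightarrow> 'm \<Rightarrow> ('i \<times> 'm) set" where
  "germ C \<Omega> i f = {(j, g). j \<in> Idx \<Omega> \<and> g \<in> homset C (Ob \<Omega> j) (Cod C f) \<and>
     (\<exists>k\<in>Idx \<Omega>. Le \<Omega> i k \<and> Le \<Omega> j k \<and> f \<odot>\<^bsub>C\<^esub> Tr \<Omega> i k = g \<odot>\<^bsub>C\<^esub> Tr \<Omega> j k)}"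

definition pro_hom ::
  "('o, 'm) category \<Rightarrow> ('i, 'o, 'm) pro_object \<Rightarrow> 'o \<Rightarrow> ('i \<times> 'm) set set" where
  "pro_hom C \<Omega> X = {germ C \<Omega> i f | i f. i \<in> Idx \<Omega> \<and> f \<in> homset C (Ob \<Omega> i) X}"

text \<open>Composition of \<open>c \<in> Hom(\<Omega>, X)\<close> with \<open>f : X \<rightarrow> Y\<close>, and of an endomorphism \<open>a\<close> of \<open>\<Omega>\<close>
  with \<open>c\<close>. The classes occurring in the unions are all equal.\<close>

definition postcomp ::
  "('o, 'm) category \<Rightarrow> ('i, 'o, 'm) pro_object \<Rightarrow> 'm \<Rightarrow> ('i \<times> 'm) set \<Rightarrow> ('i \<times> 'm) set" where
  "postcomp C \<Omega> f c = (\<Union>(i, h)\<in>c. germ C \<Omega> i (f \<odot>\<^bsub>C\<^esub> h))"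

definition precomp ::
  "('o, 'm) category \<Rightarrow> ('i, 'o, 'm) pro_object \<Rightarrow> ('i \<times> 'm) set \<Rightarrow> ('i \<Rightarrow> ('i \<times> 'm) set)
     \<Rightarrow> ('i \<times> 'm) set" where
  "precomp C \<Omega> c a = (\<Union>(i, f)\<in>c. postcomp C \<Omega> f (a i))"

text \<open>Endomorphisms of \<open>\<Omega>\<close> as a pro-object of \<open>C\<close>, i.e.\ elements of
  \<open>lim\<^sub>j Hom(\<Omega>, \<Omega>\<^sub>j)\<close>.\<close>

definition pro_End ::
  "('o, 'm) category \<Rightarrow> ('i, 'o, 'm) pro_object \<Rightarrow> ('i \<Rightarrow> ('i \<times> 'm) set) monoid" where
  "pro_End C \<Omega> =
     \<lparr>carrier = {a \<in> (\<Pi>\<^sub>E j\<in>Idx \<Omega>. pro_hom C \<Omega> (Ob \<Omega> j)).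
        \<forall>i\<in>Idx \<Omega>. \<forall>j\<in>Idx \<Omega>. Le \<Omega> i j \<longrightarrow> postcomp C \<Omega> (Tr \<Omega> i j) (a j) = a i},
      mult = (\<lambda>a b. \<lambda>j\<in>Idx \<Omega>. precomp C \<Omega> (a j) b),
      one = (\<lambda>j\<in>Idx \<Omega>. germ C \<Omega> j (Ide C (Ob \<Omega> j)))\<rparr>"


section \<open>The group and its actions\<close>

definition Aut_pro ::
  "('o, 'm) category \<Rightarrow> ('i, 'o, 'm) pro_object \<Rightarrow> ('i \<Rightarrow> ('i \<times> 'm) set) monoid" where
  "Aut_pro E \<Omega> = units_of (pro_End (principal_cat E) \<Omega>)"

record ('g, 'x) gset =
  pts :: "'x set"
  act :: "'g \<Rightarrow> 'x \<Rightarrow> 'x"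

type_synonym ('i, 'm) pro_gset = "('i \<Rightarrow> ('i \<times> 'm) set, ('i \<times> 'm) set) gset"

definition hom_gset ::
  "('o, 'm) category \<Rightarrow> ('o, 'm) category \<Rightarrow> ('i, 'o, 'm) pro_object \<Rightarrow> 'o \<Rightarrow> ('i, 'm) pro_gset"
  where
  "hom_gset E C \<Omega> X =
     \<lparr>pts = pro_hom C \<Omega> X,
      act = (\<lambda>g. \<lambda>c\<in>pro_hom C \<Omega> X. precomp C \<Omega> c (inv\<^bsub>Aut_pro E \<Omega>\<^esub> g))\<rparr>"

definition B_set ::
  "('o, 'm) category \<Rightarrow> ('i, 'o, 'm) pro_object \<Rightarrow> 'o \<Rightarrow> ('i, 'm) pro_gset" where
  "B_set E \<Omega> X = hom_gset E (principal_cat E) \<Omega> X"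

definition B_map ::
  "('o, 'm) category \<Rightarrow> ('i, 'o, 'm) pro_object \<Rightarrow> 'm \<Rightarrow> ('i \<times> 'm) set \<Rightarrow> ('i \<times> 'm) set" where
  "B_map E \<Omega> f =
     restrict (postcomp (principal_cat E) \<Omega> f) (pts (B_set E \<Omega> (Dom E f)))"

text \<open>\<open>\<AA>\<^sub>1(X)\<close> as \<open>Hom(\<Omega>, X)\<close> in the category of pro-objects of \<open>\<E>\<close>.\<close>

definition A1_set ::
  "('o, 'm) category \<Rightarrow> ('i, 'o, 'm) pro_object \<Rightarrow> 'o \<Rightarrow> ('i, 'm) pro_gset" where
  "A1_set E \<Omega> X = hom_gset E E \<Omega> X"

definition A1_map ::
  "('o, 'm) category \<Rightarrow> ('i, 'o, 'm) pro_object \<Rightarrow> 'm \<Rightarrow> ('i \<times> 'm) set \<Rightarrow> ('i \<times> 'm) set" where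
  "A1_map E \<Omega> f = restrict (postcomp E \<Omega> f) (pts (A1_set E \<Omega> (Dom E f)))"

definition universal_pro :: "('o, 'm) category \<Rightarrow> ('i, 'o, 'm) pro_object \<Rightarrow> bool" where
  "universal_pro E \<Omega> \<longleftrightarrow> (\<forall>X\<in>Obj (principal_cat E). pts (B_set E \<Omega> X) \<noteq> {})"

definition homogeneous_pro :: "('o, 'm) category \<Rightarrow> ('i, 'o, 'm) pro_object \<Rightarrow> bool" where
  "homogeneous_pro E \<Omega> \<longleftrightarrow>
     (\<forall>X\<in>Obj (principal_cat E). \<forall>x\<in>pts (B_set E \<Omega> X). \<forall>y\<in>pts (B_set E \<Omega> X).
        \<exists>g\<in>carrier (Aut_pro E \<Omega>). act (B_set E \<Omega> X) g x = y)"

text \<open>The group topology in which finite intersections of stabilizers form a neighbourhood basis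
  of the identity: it is generated by the cosets of the stabilizers.\<close>

definition Aut_topology ::
  "('o, 'm) category \<Rightarrow> ('i, 'o, 'm) pro_object \<Rightarrow> ('i \<Rightarrow> ('i \<times> 'm) set) topology" where
  "Aut_topology E \<Omega> = topology_generated_by
     {g <#\<^bsub>Aut_pro E \<Omega>\<^esub> stabilizer (Aut_pro E \<Omega>) (act (B_set E \<Omega> X)) x | g X x.
        g \<in> carrier (Aut_pro E \<Omega>) \<and> X \<in> Obj (principal_cat E) \<and> x \<in> pts (B_set E \<Omega> X)}"


section \<open>The category of \<open>G\<close>-sets\<close>

definition gset_maps ::
  "('g, 'a) monoid_scheme \<Rightarrow> ('g, 'x) gset \<Rightarrow> ('g, 'x) gset \<Rightarrow> ('x \<Rightarrow> 'x) set" where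
  "gset_maps G A B = {f \<in> pts A \<rightarrow>\<^sub>E pts B. \<forall>g\<in>carrier G. \<forall>x\<in>pts A. f (act A g x) = act B g (f x)}"

definition gset_isomorphic ::
  "('g, 'a) monoid_scheme \<Rightarrow> ('g, 'x) gset \<Rightarrow> ('g, 'x) gset \<Rightarrow> bool" where
  "gset_isomorphic G A B \<longleftrightarrow> (\<exists>f\<in>gset_maps G A B. bij_betw f (pts A) (pts B))"

definition sub_gset :: "('g, 'x) gset \<Rightarrow> 'x set \<Rightarrow> ('g, 'x) gset" where
  "sub_gset A S = \<lparr>pts = S, act = (\<lambda>g. restrict (act A g) S)\<rparr>"

abbreviation gset_orbits :: "('g, 'a) monoid_scheme \<Rightarrow> ('g, 'x) gset \<Rightarrow> 'x set set" where
  "gset_orbits G A \<equiv> orbits G (pts A) (act A)"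

text \<open>Objects of \<open>\<C>\<close>, with underlying sets taken in the type that contains all
  \<open>\<BB>(X)\<close> and \<open>\<AA>\<^sub>1(X)\<close>; up to isomorphism, this includes all transitive objects.\<close>

definition C_object ::
  "('o, 'm) category \<Rightarrow> ('i, 'o, 'm) pro_object \<Rightarrow> ('i, 'm) pro_gset \<Rightarrow> bool" where
  "C_object E \<Omega> A \<longleftrightarrow>
     group_action (Aut_pro E \<Omega>) (pts A) (act A) \<and>
     (\<forall>x\<in>pts A. openin (Aut_topology E \<Omega>) (stabilizer (Aut_pro E \<Omega>) (act A) x)) \<and>
     finite (gset_orbits (Aut_pro E \<Omega>) A) \<and>
     (\<forall>S\<in>gset_orbits (Aut_pro E \<Omega>) A. \<exists>X\<in>Obj (principal_cat E).
        gset_isomorphic (Aut_pro E \<Omega>) (sub_gset A S) (B_set E \<Omega> X))"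

definition C_atom ::
  "('o, 'm) category \<Rightarrow> ('i, 'o, 'm) pro_object \<Rightarrow> ('i, 'm) pro_gset \<Rightarrow> bool" where
  "C_atom E \<Omega> A \<longleftrightarrow> C_object E \<Omega> A \<and> pts A \<noteq> {} \<and>
     transitive_action (Aut_pro E \<Omega>) (pts A) (act A)"

text \<open>The value of \<open>\<mu>\<close> at a map \<open>f : A \<rightarrow> B\<close> of atoms is \<open>\<mu> A B f\<close>. In the last condition, the
  bijection exhibits the fibre product \<open>Y \<times>\<^sub>X X'\<close> as the disjoint union of
  the atoms \<open>Y'\<^sub>i\<close>.\<close>

definition is_C_measure ::
  "('o, 'm) category \<Rightarrow> ('i, 'o, 'm) pro_object \<Rightarrow>
   (('i, 'm) pro_gset \<Rightarrow> ('i, 'm) pro_gset \<Rightarrow> (('i \<times> 'm) set \<Rightarrow> ('i \<times> 'm) set)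
      \<Rightarrow> 'k :: {comm_ring, comm_monoid_mult}) \<Rightarrow> bool" where
  "is_C_measure E \<Omega> \<mu> \<longleftrightarrow>
     (\<forall>A B f. C_atom E \<Omega> A \<and> C_atom E \<Omega> B \<and> f \<in> gset_maps (Aut_pro E \<Omega>) A B \<and>
        bij_betw f (pts A) (pts B) \<longrightarrow> \<mu> A B f = 1) \<and>
     (\<forall>A B C f g. C_atom E \<Omega> A \<and> C_atom E \<Omega> B \<and> C_atom E \<Omega> C \<and>
        f \<in> gset_maps (Aut_pro E \<Omega>) A B \<and> g \<in> gset_maps (Aut_pro E \<Omega>) B C
        \<longrightarrow> \<mu> A C (compose (pts A) g f) = \<mu> B C g * \<mu> A B f) \<and>
     (\<forall>Y X X' f h (I :: nat set) Y' p f'.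
        C_atom E \<Omega> Y \<and> C_atom E \<Omega> X \<and> C_atom E \<Omega> X' \<and>
        f \<in> gset_maps (Aut_pro E \<Omega>) Y X \<and> h \<in> gset_maps (Aut_pro E \<Omega>) X' X \<and>
        finite I \<and>
        (\<forall>i\<in>I. C_atom E \<Omega> (Y' i) \<and> p i \<in> gset_maps (Aut_pro E \<Omega>) (Y' i) Y \<and>
           f' i \<in> gset_maps (Aut_pro E \<Omega>) (Y' i) X') \<and>
        bij_betw (\<lambda>(i, z). (p i z, f' i z)) (SIGMA i:I. pts (Y' i))
          {(y, x') \<in> pts Y \<times> pts X'. f y = h x'}
        \<longrightarrow> \<mu> Y X f = (\<Sum>i\<in>I. \<mu> (Y' i) X' (f' i)))"

text \<open>The extension of \<open>\<mu>\<close> to maps \<open>f : A \<rightarrow> B\<close> with only \<open>B\<close> an atom.\<close>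

definition measure_ext ::
  "('g, 'a) monoid_scheme \<Rightarrow> (('g, 'x) gset \<Rightarrow> ('g, 'x) gset \<Rightarrow> ('x \<Rightarrow> 'x) \<Rightarrow> 'k :: comm_monoid_add)
     \<Rightarrow> ('g, 'x) gset \<Rightarrow> ('g, 'x) gset \<Rightarrow> ('x \<Rightarrow> 'x) \<Rightarrow> 'k" where
  "measure_ext G \<mu> A B f = (\<Sum>S\<in>gset_orbits G A. \<mu> (sub_gset A S) B (restrict f S))"

definition measure_constant ::
  "('g, 'a) monoid_scheme \<Rightarrow> (('g, 'x) gset \<Rightarrow> ('g, 'x) gset \<Rightarrow> ('x \<Rightarrow> 'x) \<Rightarrow> 'k :: comm_monoid_add)
     \<Rightarrow> ('g, 'x) gset \<Rightarrow> ('g, 'x) gset \<Rightarrow> ('x \<Rightarrow> 'x) \<Rightarrow> bool" where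
  "measure_constant G \<mu> A B f \<longleftrightarrow>
     (\<exists>v. \<forall>S\<in>gset_orbits G B.
        measure_ext G \<mu> (sub_gset A {x \<in> pts A. f x \<in> S}) (sub_gset B S)
          (restrict f {x \<in> pts A. f x \<in> S}) = v)"

end

theory Submission
  imports Defs
begin

text \<open>
  Since the transition maps of \<open>\<Omega>\<close> are surjections, \<open>\<BB>(X)\<close> sits inside \<open>\<AA>\<^sub>1(X)\<close> as a single
  orbit, and the orbits of \<open>\<AA>\<^sub>1(X)\<close> are the images of the \<open>\<BB>(V)\<close> for the principal subobjects
  \<open>V\<close> of \<open>X\<close>. For \<open>f : Y \<rightarrow> X\<close> and an orbit \<open>T\<close> of \<open>\<AA>\<^sub>1(X)\<close>, let \<open>M(f, T)\<close> be the measure of the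
  part of \<open>\<AA>\<^sub>1(Y)\<close> over \<open>T\<close>, and put \<open>deg f = M(f, \<BB>(X))\<close>. As \<open>\<AA>\<^sub>1\<close> preserves fibre products,
  \<open>M\<close> is invariant under base change along an arbitrary map \<open>X' \<rightarrow> X\<close>; and by Moebius inversion
  the formula in (a) holds, for any \<open>\<mu>\<close>, with \<open>\<nu> = deg\<close>, and determines \<open>\<nu>\<close>.

  If (a) holds, then \<open>\<nu> = deg\<close>, and base change along \<open>V \<rightarrow> X\<close> identifies \<open>M(f, T)\<close>, for the orbit
  \<open>T\<close> of \<open>V\<close>, with \<open>\<nu>\<close> of a base change of \<open>f\<close>, i.e.\ with \<open>\<nu> f\<close>. Conversely, if \<open>M(f, T)\<close> does
  not depend on \<open>T\<close>, then \<open>deg\<close> is multiplicative (sum over the orbits in the middle) and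
  invariant under base change.
\<close>

section \<open>Regular categories\<close>

text \<open>A_1 is needed although the formula in (a) mentions only B: the functor B does not
  respect fibre products, since two surjections with a common source need not induce a surjection to
  the fibre product. Passing to A_1 has a price. A map g : X' -> X of principal objects sends B(X')
  onto some orbit of A_1(X), which is B(X) only if g is surjective. Base change therefore equates
  the degree of a base change of f with M(f, T), where T can be any orbit of A_1(X). So invariance
  of deg under base change along all maps of principal objects says exactly that M(f, T) does not
  depend on T.

  Moebius inversion applies because the degree of f restricted to Z is a partial sum of the one
  defining deg f, over the orbits inside A_1(Z). It uses the whole lattice Sub(Y) although only
  principal subobjects carry orbits; this is harmless, because f(Z) = X with X principal forces Z to
  be principal. The formula determines nu because the coefficient at Z = Y is 1 and a proper
  subobject of Y has fewer orbits than Y.\<close>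

lemma homset_iff: "f \<in> homset C X Y \<longleftrightarrow> f \<in> Arr C \<and> Dom C f = X \<and> Cod C f = Y"
  by (auto simp: homset_def)

lemma homsetD:
  assumes "f \<in> homset C X Y"
  shows "f \<in> Arr C" "Dom C f = X" "Cod C f = Y"
  using assms by (auto simp: homset_def)

lemma injection_cancel:
  "\<lbrakk>injection C m; m \<in> homset C X Y; a \<in> homset C W X; b \<in> homset C W X;
    m \<odot>\<^bsub>C\<^esub> a = m \<odot>\<^bsub>C\<^esub> b\<rbrakk> \<Longrightarrow> a = b"
  unfolding injection_def by (metis homsetD(2))

lemma surjection_Arr: "surjection C e \<Longrightarrow> e \<in> Arr C"
  by (auto simp: surjection_def coequalizer_def)

lemma injection_Arr: "injection C m \<Longrightarrow> m \<in> Arr C"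
  by (auto simp: injection_def)

lemma coequalizer_factor:
  assumes "coequalizer C u v e" and e: "e \<in> homset C X Y"
    and "k \<in> homset C X W" and "k \<odot>\<^bsub>C\<^esub> u = k \<odot>\<^bsub>C\<^esub> v"
  shows "\<exists>!h. h \<in> homset C Y W \<and> h \<odot>\<^bsub>C\<^esub> e = k"
  using assms(1,3,4) unfolding coequalizer_def homsetD(2,3)[OF e] by blast

lemma coequalizerD:
  assumes "coequalizer C u v e" and e: "e \<in> homset C X Y"
  shows "u \<in> homset C (Dom C u) X" "v \<in> homset C (Dom C u) X" "e \<odot>\<^bsub>C\<^esub> u = e \<odot>\<^bsub>C\<^esub> v"
  using assms(1) homsetD[OF e] by (auto simp: coequalizer_def homset_iff)

lemma pullbackD:
  assumes "pullback C f g p q" "f \<in> homset C Y X" "g \<in> homset C X' X"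
  shows "p \<in> homset C (Dom C p) Y" "q \<in> homset C (Dom C p) X'"
    and "f \<odot>\<^bsub>C\<^esub> p = g \<odot>\<^bsub>C\<^esub> q"
    and "\<lbrakk>a \<in> homset C W Y; b \<in> homset C W X'; f \<odot>\<^bsub>C\<^esub> a = g \<odot>\<^bsub>C\<^esub> b\<rbrakk>
      \<Longrightarrow> \<exists>h\<in>homset C W (Dom C p). p \<odot>\<^bsub>C\<^esub> h = a \<and> q \<odot>\<^bsub>C\<^esub> h = b"
    and "\<lbrakk>h \<in> homset C W (Dom C p); h' \<in> homset C W (Dom C p);
      p \<odot>\<^bsub>C\<^esub> h = p \<odot>\<^bsub>C\<^esub> h'; q \<odot>\<^bsub>C\<^esub> h = q \<odot>\<^bsub>C\<^esub> h'; category C\<rbrakk> \<Longrightarrow> h = h'"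
proof -
  have p: "p \<in> homset C (Dom C p) Y" and q: "q \<in> homset C (Dom C p) X'"
    and sq: "f \<odot>\<^bsub>C\<^esub> p = g \<odot>\<^bsub>C\<^esub> q"
    using assms by (auto simp: pullback_def homset_iff)
  have un: "\<And>W a b. \<lbrakk>a \<in> homset C W Y; b \<in> homset C W X'; f \<odot>\<^bsub>C\<^esub> a = g \<odot>\<^bsub>C\<^esub> b\<rbrakk>
        \<Longrightarrow> \<exists>!h. h \<in> homset C W (Dom C p) \<and> p \<odot>\<^bsub>C\<^esub> h = a \<and> q \<odot>\<^bsub>C\<^esub> h = b"
    using assms(1) unfolding pullback_def homsetD(2)[OF assms(2)] homsetD(2)[OF assms(3)] by blast
  show "p \<in> homset C (Dom C p) Y" "q \<in> homset C (Dom C p) X'" "f \<odot>\<^bsub>C\<^esub> p = g \<odot>\<^bsub>C\<^esub> q"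
    by fact+
  show "\<exists>h\<in>homset C W (Dom C p). p \<odot>\<^bsub>C\<^esub> h = a \<and> q \<odot>\<^bsub>C\<^esub> h = b"
    if "a \<in> homset C W Y" "b \<in> homset C W X'" "f \<odot>\<^bsub>C\<^esub> a = g \<odot>\<^bsub>C\<^esub> b"
    using un[OF that] by blast
  show "h = h'"
    if h: "h \<in> homset C W (Dom C p)" and h': "h' \<in> homset C W (Dom C p)"
      and eq: "p \<odot>\<^bsub>C\<^esub> h = p \<odot>\<^bsub>C\<^esub> h'" "q \<odot>\<^bsub>C\<^esub> h = q \<odot>\<^bsub>C\<^esub> h'" and C: "category C"
  proof -
    interpret category C by (rule C)
    have "p \<odot>\<^bsub>C\<^esub> h \<in> homset C W Y" "q \<odot>\<^bsub>C\<^esub> h \<in> homset C W X'"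
      using h p q by (auto intro: Cmp_in)
    moreover have "f \<odot>\<^bsub>C\<^esub> (p \<odot>\<^bsub>C\<^esub> h) = g \<odot>\<^bsub>C\<^esub> (q \<odot>\<^bsub>C\<^esub> h)"
      using Cmp_assoc[OF h p assms(2)] Cmp_assoc[OF h q assms(3)] sq by simp
    ultimately show ?thesis using un[of "p \<odot>\<^bsub>C\<^esub> h" W "q \<odot>\<^bsub>C\<^esub> h"] h h' eq by auto
  qed
qed

context category
begin

lemma Obj_homset: "f \<in> homset C X Y \<Longrightarrow> X \<in> Obj C" "f \<in> homset C X Y \<Longrightarrow> Y \<in> Obj C"
  using Dom_in Cod_in by (auto simp: homset_iff)

text \<open>Both arrows solve the same factorization problem through the coequalizer
  \<open>e\<close>, whose solution is unique.\<close>

lemma surjection_cancel: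
  assumes "surjection C e" and e: "e \<in> homset C X Y"
    and a: "a \<in> homset C Y W" and b: "b \<in> homset C Y W" and eq: "a \<odot> e = b \<odot> e"
  shows "a = b"
proof -
  obtain u v where co: "coequalizer C u v e"
    using assms(1) by (auto simp: surjection_def)
  note u = coequalizerD(1)[OF co e] and v = coequalizerD(2)[OF co e] and eu = coequalizerD(3)[OF co e]
  have "(a \<odot> e) \<odot> u = (a \<odot> e) \<odot> v"
    using Cmp_assoc[OF u e a] Cmp_assoc[OF v e a] eu by simp
  then have "\<exists>!h. h \<in> homset C Y W \<and> h \<odot> e = a \<odot> e"
    by (rule coequalizer_factor[OF co e Cmp_in[OF e a]])
  then show ?thesis using a b eq by auto
qed

text \<open>Orthogonality of regular epimorphisms and monomorphisms. As \<open>m\<close> is monic,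
  \<open>k\<close> identifies the pair that \<open>e\<close> coequalizes, so \<open>k\<close>
  descends along \<open>e\<close>.\<close>

lemma diagonal_fill:
  assumes "surjection C e" and e: "e \<in> homset C X Y"
    and "injection C m" and m: "m \<in> homset C V W"
    and k: "k \<in> homset C X V" and g: "g \<in> homset C Y W" and eq: "m \<odot> k = g \<odot> e"
  shows "\<exists>l\<in>homset C Y V. l \<odot> e = k \<and> m \<odot> l = g"
proof -
  obtain u v where co: "coequalizer C u v e"
    using assms(1) by (auto simp: surjection_def)
  note u = coequalizerD(1)[OF co e] and v = coequalizerD(2)[OF co e] and eu = coequalizerD(3)[OF co e]
  have "m \<odot> (k \<odot> u) = m \<odot> (k \<odot> v)"
    using Cmp_assoc[OF u k m] Cmp_assoc[OF v k m] Cmp_assoc[OF u e g] Cmp_assoc[OF v e g] eq eu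
    by simp
  then have "k \<odot> u = k \<odot> v"
    by (rule injection_cancel[OF assms(3) m Cmp_in[OF u k] Cmp_in[OF v k]])
  then have "\<exists>!h. h \<in> homset C Y V \<and> h \<odot> e = k"
    by (rule coequalizer_factor[OF co e k])
  then obtain l where l: "l \<in> homset C Y V" "l \<odot> e = k" by blast
  have "(m \<odot> l) \<odot> e = g \<odot> e" using Cmp_assoc[OF e l(1) m] l(2) eq by simp
  then have "m \<odot> l = g" by (rule surjection_cancel[OF assms(1) e Cmp_in[OF l(1) m] g])
  with l show ?thesis by blast
qed

lemma is_isoI:
  "\<lbrakk>f \<in> homset C X Y; g \<in> homset C Y X; g \<odot> f = Ide C X; f \<odot> g = Ide C Y\<rbrakk> \<Longrightarrow> is_iso C f"
  by (auto simp: is_iso_def homset_iff)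

lemma is_isoE:
  assumes "is_iso C f" "f \<in> homset C X Y"
  obtains g where "g \<in> homset C Y X" "g \<odot> f = Ide C X" "f \<odot> g = Ide C Y"
  using assms by (auto simp: is_iso_def homset_iff)

lemma is_iso_Ide: "X \<in> Obj C \<Longrightarrow> is_iso C (Ide C X)"
  using Ide_in[of X] Cmp_Ide[OF Ide_in] by (intro is_isoI) auto

lemma split_injection_is_iso:
  assumes "injection C m" and m: "m \<in> homset C V X" and l: "l \<in> homset C X V"
    and eq: "m \<odot> l = Ide C X"
  shows "is_iso C m"
proof -
  have V: "Ide C V \<in> homset C V V" using Obj_homset[OF m] Ide_in by auto
  have "m \<odot> (l \<odot> m) = m \<odot> Ide C V"
    using Cmp_assoc[OF m l m] eq Ide_Cmp[OF m] Cmp_Ide[OF m] by simp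
  then have "l \<odot> m = Ide C V"
    by (rule injection_cancel[OF assms(1) m Cmp_in[OF m l] V])
  then show ?thesis using m l eq by (intro is_isoI)
qed

text \<open>Diagonal filling against the identity of \<open>Y\<close> gives a section of
  \<open>m\<close>, and a monomorphism with a section is invertible.\<close>

lemma surjection_injection_is_iso:
  assumes "surjection C e" and e: "e \<in> homset C X Y" and m: "m \<in> homset C V Y" "injection C m"
    and k: "k \<in> homset C X V" and eq: "m \<odot> k = e"
  shows "is_iso C m"
proof -
  have Y: "Ide C Y \<in> homset C Y Y" using Obj_homset[OF e] Ide_in by auto
  have "m \<odot> k = Ide C Y \<odot> e" using eq Ide_Cmp[OF e] by simp
  from diagonal_fill[OF assms(1) e m(2,1) k Y this] obtain l
    where "l \<in> homset C Y V" "m \<odot> l = Ide C Y" by blast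
  then show ?thesis using split_injection_is_iso m by blast
qed

lemma is_iso_injection:
  assumes "is_iso C f" shows "injection C f"
proof -
  have f: "f \<in> homset C (Dom C f) (Cod C f)" using assms by (auto simp: is_iso_def homset_iff)
  obtain g where g: "g \<in> homset C (Cod C f) (Dom C f)" "g \<odot> f = Ide C (Dom C f)"
    using is_isoE[OF assms f] by blast
  have "a = b" if "a \<in> homset C W (Dom C f)" "b \<in> homset C W (Dom C f)" "f \<odot> a = f \<odot> b" for W a b
    using Cmp_assoc[OF that(1) f g(1)] Cmp_assoc[OF that(2) f g(1)] that g(2) Ide_Cmp by metis
  then show ?thesis using f by (auto simp: injection_def homset_iff)
qed

text \<open>An isomorphism coequalizes the identity of its source, taken twice.\<close>

lemma is_iso_surjection:
  assumes "is_iso C f" shows "surjection C f"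
proof -
  have f: "f \<in> homset C (Dom C f) (Cod C f)" using assms by (auto simp: is_iso_def homset_iff)
  obtain g where g: "g \<in> homset C (Cod C f) (Dom C f)" "g \<odot> f = Ide C (Dom C f)"
      "f \<odot> g = Ide C (Cod C f)"
    using is_isoE[OF assms f] by blast
  let ?i = "Ide C (Dom C f)"
  have i: "?i \<in> homset C (Dom C f) (Dom C f)" using Obj_homset[OF f] Ide_in by auto
  have "\<exists>!h. h \<in> homset C (Cod C f) W \<and> h \<odot> f = r" if r: "r \<in> homset C (Dom C f) W" for W r
  proof (rule ex1I[of _ "r \<odot> g"])
    show "r \<odot> g \<in> homset C (Cod C f) W \<and> (r \<odot> g) \<odot> f = r"
      using Cmp_in[OF g(1) r] Cmp_assoc[OF f g(1) r] g(2) Cmp_Ide[OF r] by simp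
  next
    fix h assume h: "h \<in> homset C (Cod C f) W \<and> h \<odot> f = r"
    then have "(h \<odot> f) \<odot> g = h" using Cmp_assoc[OF g(1) f, of h W] g(3) Cmp_Ide[of h] by auto
    then show "h = r \<odot> g" using h by simp
  qed
  then have "coequalizer C ?i ?i f" using f i by (auto simp: coequalizer_def homset_iff)
  then show ?thesis by (auto simp: surjection_def)
qed

text \<open>This case of closure under composition has to come first: the general case shows that
  the injective part of an image factorization is invertible and then concludes by this
  lemma.\<close>

lemma iso_Cmp_surjection:
  assumes "surjection C e" and e: "e \<in> homset C X Y" and "is_iso C u" and u: "u \<in> homset C Y Z"
  shows "surjection C (u \<odot> e)"
proof -
  obtain a b where co: "coequalizer C a b e"
    using assms(1) by (auto simp: surjection_def)
  note a = coequalizerD(1)[OF co e] and b = coequalizerD(2)[OF co e] and ea = coequalizerD(3)[OF co e]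
  obtain v where v: "v \<in> homset C Z Y" "v \<odot> u = Ide C Y" "u \<odot> v = Ide C Z"
    using is_isoE[OF assms(3) u] by blast
  have ue: "u \<odot> e \<in> homset C X Z" using e u by (rule Cmp_in)
  have "\<exists>!h. h \<in> homset C Z W \<and> h \<odot> (u \<odot> e) = r"
    if r: "r \<in> homset C X W" "r \<odot> a = r \<odot> b" for W r
  proof -
    have "\<exists>!h. h \<in> homset C Y W \<and> h \<odot> e = r"
      by (rule coequalizer_factor[OF co e r])
    then obtain h where h: "h \<in> homset C Y W" "h \<odot> e = r" by blast
    show ?thesis
    proof (rule ex1I[of _ "h \<odot> v"])
      have "(h \<odot> v) \<odot> (u \<odot> e) = ((h \<odot> v) \<odot> u) \<odot> e"
        using Cmp_assoc[OF e u Cmp_in[OF v(1) h(1)]] by simp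
      also have "\<dots> = r" using Cmp_assoc[OF u v(1) h(1)] v(2) Cmp_Ide[OF h(1)] h(2) by simp
      finally show "h \<odot> v \<in> homset C Z W \<and> (h \<odot> v) \<odot> (u \<odot> e) = r"
        using Cmp_in[OF v(1) h(1)] by simp
    next
      fix h' assume h': "h' \<in> homset C Z W \<and> h' \<odot> (u \<odot> e) = r"
      then have "(h' \<odot> u) \<odot> e = h \<odot> e" using Cmp_assoc[OF e u, of h' W] h h' by simp
      then have "h' \<odot> u = h"
        using surjection_cancel[OF assms(1) e] Cmp_in[OF u] h' h(1) by blast
      then show "h' = h \<odot> v" using Cmp_assoc[OF v(1) u] h' v(3) Cmp_Ide by metis
    qed
  qed
  moreover have "(u \<odot> e) \<odot> a = (u \<odot> e) \<odot> b"
    using Cmp_assoc[OF a e u] Cmp_assoc[OF b e u] ea by simp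
  ultimately have "coequalizer C a b (u \<odot> e)" using a b ue by (auto simp: coequalizer_def homset_iff)
  then show ?thesis by (auto simp: surjection_def)
qed

end

text \<open>The shape 0 -> 2 <- 1, where arrows 0, 1, 2 are the identities and 3, 4 the legs. In a
  composable pair at most one arrow is a leg, and the composite is that leg.\<close>

definition cospan :: "(nat, nat) category" where
  "cospan = \<lparr>Obj = {0, 1, 2}, Arr = {0, 1, 2, 3, 4},
     Dom = (\<lambda>a. if a = 3 then 0 else if a = 4 then 1 else a),
     Cod = (\<lambda>a. if a = 3 \<or> a = 4 then 2 else a), Ide = (\<lambda>a. a),
     Cmp = (\<lambda>b a. if b = 3 \<or> b = 4 then b else a)\<rparr>"

lemma category_cospan: "category cospan"
  by unfold_locales (auto simp: cospan_def homset_def split: if_splits)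

text \<open>A cone over a cospan is determined by its two outer components, so a limit of this shape
  is a pullback.\<close>

lemma (in category) pullback_exists:
  assumes fc: "finitely_complete C" and f: "f \<in> homset C Y X" and g: "g \<in> homset C Z X"
  shows "\<exists>p q. pullback C f g p q"
proof -
  define Fo where "Fo j = (if j = 0 then Y else if j = 1 then Z else X)" for j :: nat
  define Fa where "Fa a = (if a = 0 then Ide C Y else if a = 1 then Ide C Z
    else if a = 2 then Ide C X else if a = 3 then f else g)" for a :: nat
  have Obj: "X \<in> Obj C" "Y \<in> Obj C" "Z \<in> Obj C" using f g by (auto dest: Obj_homset)
  note Ids = this[THEN Ide_in]
  have "diagram cospan C Fo Fa"
    using Obj Ids f g Cmp_Ide[OF f] Cmp_Ide[OF g] Ide_Cmp[OF f] Ide_Cmp[OF g]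
      Ids[THEN Cmp_Ide]
    by (auto simp: diagram_def cospan_def Fo_def Fa_def)
  then obtain L p where lim: "limit_cone cospan C Fo Fa L p"
    using fc category_cospan unfolding finitely_complete_def by (force simp: cospan_def)
  then have cone: "is_cone cospan C Fo Fa L p" by (simp add: limit_cone_def)
  have p0: "p 0 \<in> homset C L Y" and p1: "p 1 \<in> homset C L Z"
    and sq: "f \<odot> p 0 = p 2" "g \<odot> p 1 = p 2"
    using cone by (auto simp: is_cone_def cospan_def Fo_def Fa_def)
  have "\<exists>!h. h \<in> homset C W L \<and> p 0 \<odot> h = a \<and> p 1 \<odot> h = b"
    if a: "a \<in> homset C W Y" and b: "b \<in> homset C W Z" and eq: "f \<odot> a = g \<odot> b" for W a b
  proof -
    \<comment> \<open>The component at vertex 2 is forced to be the common composite.\<close>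
    define p' where "p' j = (if j = 0 then a else if j = 1 then b else f \<odot> a)" for j :: nat
    have "is_cone cospan C Fo Fa W p'"
      using a b eq Cmp_in[OF a f] Obj_homset[OF a] Ide_Cmp[OF a] Ide_Cmp[OF b] Ide_Cmp[OF Cmp_in[OF a f]]
      by (auto simp: is_cone_def cospan_def Fo_def Fa_def p'_def)
    then have "\<exists>!h. h \<in> homset C W L \<and> (\<forall>j\<in>Obj cospan. p j \<odot> h = p' j)"
      using lim by (auto simp: limit_cone_def)
    moreover have "(\<forall>j\<in>Obj cospan. p j \<odot> h = p' j) \<longleftrightarrow> p 0 \<odot> h = a \<and> p 1 \<odot> h = b"
      if "h \<in> homset C W L" for h
      using Cmp_assoc[OF that p0 f] sq by (auto simp: cospan_def p'_def)
    ultimately show ?thesis by (simp cong: conj_cong)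
  qed
  then have "pullback C f g (p 0) (p 1)"
    using f g p0 p1 sq by (auto simp: pullback_def homset_iff)
  then show ?thesis by blast
qed

section \<open>Image factorizations and principal objects\<close>

locale regular = category C for C :: "('o, 'm) category" (structure) +
  assumes complete: "finitely_complete C"
    and kernel_pair_coequalizer: "pullback C f f p q \<Longrightarrow> \<exists>c. coequalizer C p q c"
    and surjection_pullback: "\<lbrakk>pullback C f g p q; surjection C f\<rbrakk> \<Longrightarrow> surjection C q"

lemma regular_category_iff: "regular_category C \<longleftrightarrow> regular C"
  unfolding regular_category_def regular_def regular_axioms_def by blast

context regular
begin

text \<open>The substitute for choosing preimages: a generalized element of \<open>Y\<close> lifts
  along \<open>e\<close> after a surjective change of its domain, namely the base change of
  \<open>e\<close>.\<close>

lemma surjection_cover: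
  assumes "surjection C e" and e: "e \<in> homset C X Y" and a: "a \<in> homset C W Y"
  obtains V s b where "surjection C s" "s \<in> homset C V W" "b \<in> homset C V X" "e \<odot> b = a \<odot> s"
proof -
  obtain p q where pb: "pullback C e a p q" using pullback_exists[OF complete e a] by blast
  show thesis
    using that[OF surjection_pullback[OF pb assms(1)] pullbackD(2,1,3)[OF pb e a]] .
qed

text \<open>The image is the quotient by the kernel pair, and the point is that the induced
  \<open>m\<close> is monic. That composites of surjections are surjections is only derived from
  this lemma, so the two covers are cancelled one at a time.\<close>

lemma factorization:
  assumes f: "f \<in> homset C X Y"
  obtains I e m where "surjection C e" "e \<in> homset C X I" "injection C m" "m \<in> homset C I Y"
    "m \<odot> e = f"
proof -
  obtain p q where pb: "pullback C f f p q" using pullback_exists[OF complete f f] by blast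
  obtain e where co: "coequalizer C p q e" using kernel_pair_coequalizer[OF pb] by blast
  define I where "I = Cod C e"
  have sur: "surjection C e" using co by (auto simp: surjection_def)
  note pbD = pullbackD[OF pb f f]
  have e: "e \<in> homset C X I"
    using co pbD(1) by (auto simp: coequalizer_def homset_iff I_def)
  have epq: "e \<odot> p = e \<odot> q" using co by (simp add: coequalizer_def)
  have "\<exists>!h. h \<in> homset C I Y \<and> h \<odot> e = f"
    by (rule coequalizer_factor[OF co e f pbD(3)])
  then obtain m where m: "m \<in> homset C I Y" "m \<odot> e = f" by blast
  \<comment> \<open>\<open>a\<close> and \<open>b\<close> lift along \<open>e\<close> to \<open>X\<close> after a surjective change of the source \<open>W\<close>; the lifts
    define a map to the kernel pair.\<close>
  have "a = b" if a: "a \<in> homset C W I" and b: "b \<in> homset C W I" and eq: "m \<odot> a = m \<odot> b" for W a b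
  proof -
    obtain V s a1 where s: "surjection C s" "s \<in> homset C V W" "a1 \<in> homset C V X" "e \<odot> a1 = a \<odot> s"
      using surjection_cover[OF sur e a] by blast
    obtain U t b2 where t: "surjection C t" "t \<in> homset C U V" "b2 \<in> homset C U X"
        "e \<odot> b2 = (b \<odot> s) \<odot> t"
      using surjection_cover[OF sur e Cmp_in[OF s(2) b]] by blast
    note st = Cmp_in[OF t(2) s(2)] and at = Cmp_in[OF t(2) s(3)]
    have 1: "e \<odot> (a1 \<odot> t) = a \<odot> (s \<odot> t)"
      using Cmp_assoc[OF t(2) s(3) e] Cmp_assoc[OF t(2) s(2) a] s(4) by simp
    have 2: "e \<odot> b2 = b \<odot> (s \<odot> t)" using Cmp_assoc[OF t(2) s(2) b] t(4) by simp
    have "f \<odot> (a1 \<odot> t) = m \<odot> (a \<odot> (s \<odot> t))" using Cmp_assoc[OF at e m(1)] m(2) 1 by simp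
    also have "\<dots> = m \<odot> (b \<odot> (s \<odot> t))" using Cmp_assoc[OF st a m(1)] Cmp_assoc[OF st b m(1)] eq by simp
    also have "\<dots> = f \<odot> b2" using Cmp_assoc[OF t(3) e m(1)] m(2) 2 by simp
    finally obtain h where h: "h \<in> homset C U (Dom C p)" "p \<odot> h = a1 \<odot> t" "q \<odot> h = b2"
      using pbD(4)[OF at t(3)] by blast
    have "e \<odot> (a1 \<odot> t) = e \<odot> b2"
      using Cmp_assoc[OF h(1) pbD(1) e] Cmp_assoc[OF h(1) pbD(2) e] epq h by simp
    then have "(a \<odot> s) \<odot> t = (b \<odot> s) \<odot> t"
      using 1 2 Cmp_assoc[OF t(2) s(2) a] Cmp_assoc[OF t(2) s(2) b] by simp
    then have "a \<odot> s = b \<odot> s"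
      by (rule surjection_cancel[OF t(1,2) Cmp_in[OF s(2) a] Cmp_in[OF s(2) b]])
    then show "a = b" by (rule surjection_cancel[OF s(1,2) a b])
  qed
  then have "injection C m" using m by (auto simp: injection_def homset_iff)
  then show thesis using that[OF sur e _ m] by simp
qed

text \<open>The injective part of \<open>g\<close> is a monomorphism through which a surjection
  factors, hence an isomorphism.\<close>

lemma surjection_left:
  assumes "surjection C (g \<odot> f)" and f: "f \<in> homset C X Y" and g: "g \<in> homset C Y Z"
  shows "surjection C g"
proof -
  obtain I e m where F: "surjection C e" "e \<in> homset C Y I" "injection C m" "m \<in> homset C I Z"
    "m \<odot> e = g"
    using factorization[OF g] by blast
  have "m \<odot> (e \<odot> f) = g \<odot> f" using Cmp_assoc[OF f F(2,4)] F(5) by simp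
  then have "is_iso C m"
    using surjection_injection_is_iso[OF assms(1) Cmp_in[OF f g] F(4,3) Cmp_in[OF f F(2)]] by simp
  then show ?thesis using iso_Cmp_surjection[OF F(1,2)] F(4,5) by blast
qed

text \<open>Diagonal filling along \<open>f\<close> makes \<open>g\<close> factor through the image
  of the composite. As \<open>g\<close> is surjective, that image is everything.\<close>

lemma surjection_Cmp:
  assumes "surjection C f" "surjection C g" and f: "f \<in> homset C X Y" and g: "g \<in> homset C Y Z"
  shows "surjection C (g \<odot> f)"
proof -
  obtain I e m where F: "surjection C e" "e \<in> homset C X I" "injection C m" "m \<in> homset C I Z"
    "m \<odot> e = g \<odot> f"
    using factorization[OF Cmp_in[OF f g]] by blast
  obtain l where "l \<in> homset C Y I" "m \<odot> l = g"
    using diagonal_fill[OF assms(1) f F(3,4,2) g F(5)] by blast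
  then have "is_iso C m"
    using surjection_injection_is_iso[OF assms(2) g F(4,3)] by blast
  then show ?thesis using iso_Cmp_surjection[OF F(1,2)] F(4,5) by metis
qed

lemma principal_object_Obj: "principal_object C X \<Longrightarrow> X \<in> Obj C"
  by (auto simp: principal_object_def dest: Obj_homset)

text \<open>The map from \<open>X\<close> to the terminal object factors through \<open>Y\<close>.
  In particular every image of an object of the pro-object is principal.\<close>

lemma principal_object_Cod:
  assumes "principal_object C X" and f: "f \<in> homset C X Y"
  shows "principal_object C Y"
proof -
  obtain T t where T: "is_terminal C T" and t: "t \<in> homset C X T" "surjection C t"
    using assms(1) by (auto simp: principal_object_def)
  obtain t' where t': "t' \<in> homset C Y T"
    using T Obj_homset[OF f] by (auto simp: is_terminal_def)
  have "t' \<odot> f = t" using T t Cmp_in[OF f t'] Obj_homset[OF f] by (auto simp: is_terminal_def)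
  then have "surjection C t'" using surjection_left[OF _ f t'] t(2) by simp
  with T t' show ?thesis by (auto simp: principal_object_def)
qed

lemma principal_object_Dom:
  assumes "principal_object C Y" and f: "f \<in> homset C X Y" "surjection C f"
  shows "principal_object C X"
proof -
  obtain T t where T: "is_terminal C T" and t: "t \<in> homset C Y T" "surjection C t"
    using assms(1) by (auto simp: principal_object_def)
  have "surjection C (t \<odot> f)" "t \<odot> f \<in> homset C X T"
    using surjection_Cmp[OF f(2) t(2) f(1) t(1)] Cmp_in[OF f(1) t(1)] by auto
  with T show ?thesis by (auto simp: principal_object_def)
qed

end

section \<open>Pro-objects with epimorphic transition maps\<close>

text \<open>Interpreted twice for the same pro-object: in \<open>principal_cat E\<close>, which
  yields B(X) and the group, and in \<open>E\<close>, which yields A_1(X).\<close>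

locale epi_pro_object = category C for C :: "('o, 'm) category" (structure) +
  fixes \<Omega> :: "('i, 'o, 'm) pro_object"
  assumes pro: "is_pro_object C \<Omega>"
    and Tr_epi: "\<lbrakk>i \<in> Idx \<Omega>; j \<in> Idx \<Omega>; Le \<Omega> i j; a \<in> homset C (Ob \<Omega> i) X; b \<in> homset C (Ob \<Omega> i) X;
      a \<odot> Tr \<Omega> i j = b \<odot> Tr \<Omega> i j\<rbrakk> \<Longrightarrow> a = b"
begin

lemma Le_refl: "i \<in> Idx \<Omega> \<Longrightarrow> Le \<Omega> i i"
  using pro unfolding is_pro_object_def by blast

lemma Le_trans:
  "\<lbrakk>i \<in> Idx \<Omega>; j \<in> Idx \<Omega>; k \<in> Idx \<Omega>; Le \<Omega> i j; Le \<Omega> j k\<rbrakk> \<Longrightarrow> Le \<Omega> i k"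
  using pro unfolding is_pro_object_def by blast

lemma upper_bound: "\<lbrakk>i \<in> Idx \<Omega>; j \<in> Idx \<Omega>\<rbrakk> \<Longrightarrow> \<exists>k\<in>Idx \<Omega>. Le \<Omega> i k \<and> Le \<Omega> j k"
  using pro unfolding is_pro_object_def by blast

lemma Ob_in: "i \<in> Idx \<Omega> \<Longrightarrow> Ob \<Omega> i \<in> Obj C"
  using pro unfolding is_pro_object_def by blast

lemma Tr_refl: "i \<in> Idx \<Omega> \<Longrightarrow> Tr \<Omega> i i = Ide C (Ob \<Omega> i)"
  using pro unfolding is_pro_object_def by blast

lemma Tr_in: "\<lbrakk>i \<in> Idx \<Omega>; j \<in> Idx \<Omega>; Le \<Omega> i j\<rbrakk> \<Longrightarrow> Tr \<Omega> i j \<in> homset C (Ob \<Omega> j) (Ob \<Omega> i)"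
  using pro unfolding is_pro_object_def by blast

lemma Tr_Cmp: "\<lbrakk>i \<in> Idx \<Omega>; j \<in> Idx \<Omega>; k \<in> Idx \<Omega>; Le \<Omega> i j; Le \<Omega> j k\<rbrakk>
    \<Longrightarrow> Tr \<Omega> i j \<odot> Tr \<Omega> j k = Tr \<Omega> i k"
  using pro unfolding is_pro_object_def by blast

lemma Cmp_Tr_Tr:
  assumes "i \<in> Idx \<Omega>" "j \<in> Idx \<Omega>" "k \<in> Idx \<Omega>" "Le \<Omega> i j" "Le \<Omega> j k" "f \<in> homset C (Ob \<Omega> i) X"
  shows "(f \<odot> Tr \<Omega> i j) \<odot> Tr \<Omega> j k = f \<odot> Tr \<Omega> i k"
  using assms Cmp_assoc[OF Tr_in Tr_in, of j k i f X] Tr_Cmp by simp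

lemma mem_germ:
  assumes "f \<in> homset C (Ob \<Omega> i) X"
  shows "(j, g) \<in> germ C \<Omega> i f \<longleftrightarrow> j \<in> Idx \<Omega> \<and> g \<in> homset C (Ob \<Omega> j) X \<and>
    (\<exists>k\<in>Idx \<Omega>. Le \<Omega> i k \<and> Le \<Omega> j k \<and> f \<odot> Tr \<Omega> i k = g \<odot> Tr \<Omega> j k)"
  using homsetD(3)[OF assms] by (simp add: germ_def)

lemma germ_self:
  assumes "i \<in> Idx \<Omega>" "f \<in> homset C (Ob \<Omega> i) X"
  shows "(i, f) \<in> germ C \<Omega> i f"
  using assms Le_refl by (auto simp: mem_germ)

lemma germ_subset:
  assumes i: "i \<in> Idx \<Omega>" and j: "j \<in> Idx \<Omega>" and k: "k \<in> Idx \<Omega>" "Le \<Omega> i k" "Le \<Omega> j k"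
    and f: "f \<in> homset C (Ob \<Omega> i) X" and g: "g \<in> homset C (Ob \<Omega> j) X"
    and eq: "f \<odot> Tr \<Omega> i k = g \<odot> Tr \<Omega> j k"
  shows "germ C \<Omega> i f \<subseteq> germ C \<Omega> j g"
proof (clarsimp simp: mem_germ[OF f] mem_germ[OF g])
  fix l h n
  assume l: "l \<in> Idx \<Omega>" and h: "h \<in> homset C (Ob \<Omega> l) X" and n: "n \<in> Idx \<Omega>" "Le \<Omega> i n" "Le \<Omega> l n"
    and fh: "f \<odot> Tr \<Omega> i n = h \<odot> Tr \<Omega> l n"
  obtain t where t: "t \<in> Idx \<Omega>" "Le \<Omega> k t" "Le \<Omega> n t" using upper_bound k n by blast
  have "g \<odot> Tr \<Omega> j t = h \<odot> Tr \<Omega> l t"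
    using Cmp_Tr_Tr[OF j k(1) t(1) k(3) t(2) g] Cmp_Tr_Tr[OF i k(1) t(1) k(2) t(2) f]
      Cmp_Tr_Tr[OF i n(1) t(1) n(2) t(3) f] Cmp_Tr_Tr[OF l n(1) t(1) n(3) t(3) h] eq fh by simp
  moreover have "Le \<Omega> j t" "Le \<Omega> l t" using Le_trans i j k l n t by blast+
  ultimately show "\<exists>k\<in>Idx \<Omega>. Le \<Omega> j k \<and> Le \<Omega> l k \<and> g \<odot> Tr \<Omega> j k = h \<odot> Tr \<Omega> l k"
    using t by blast
qed

lemma germ_eqI:
  assumes "i \<in> Idx \<Omega>" "j \<in> Idx \<Omega>" "k \<in> Idx \<Omega>" "Le \<Omega> i k" "Le \<Omega> j k"
    and "f \<in> homset C (Ob \<Omega> i) X" "g \<in> homset C (Ob \<Omega> j) X"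
    and "f \<odot> Tr \<Omega> i k = g \<odot> Tr \<Omega> j k"
  shows "germ C \<Omega> i f = germ C \<Omega> j g"
  using germ_subset[OF assms] germ_subset[OF assms(2,1,3,5,4,7,6) assms(8)[symmetric]] by simp

lemma germ_Tr:
  assumes i: "i \<in> Idx \<Omega>" and k: "k \<in> Idx \<Omega>" "Le \<Omega> i k" and f: "f \<in> homset C (Ob \<Omega> i) X"
  shows "germ C \<Omega> k (f \<odot> Tr \<Omega> i k) = germ C \<Omega> i f"
proof -
  have "f \<odot> Tr \<Omega> i k \<in> homset C (Ob \<Omega> k) X" using Tr_in[OF i k] f by (rule Cmp_in)
  then show ?thesis
    using germ_eqI[OF k(1) i k(1) Le_refl[OF k(1)] k(2)] f Tr_refl k(1) Cmp_Ide by simp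
qed

text \<open>Equal germs agree after some transition map, which can be cancelled. Equations in
  Hom(Omega, X) thus become equations of arrows at a common index, without enlarging it.\<close>

lemma germ_inject:
  assumes i: "i \<in> Idx \<Omega>" and f: "f \<in> homset C (Ob \<Omega> i) X" and g: "g \<in> homset C (Ob \<Omega> i) X"
    and eq: "germ C \<Omega> i f = germ C \<Omega> i g"
  shows "f = g"
proof -
  have "(i, g) \<in> germ C \<Omega> i f" using germ_self[OF i g] eq by simp
  then show ?thesis using Tr_epi[OF i _ _ f g] by (auto simp: mem_germ[OF f])
qed

lemma germ_in: "\<lbrakk>i \<in> Idx \<Omega>; f \<in> homset C (Ob \<Omega> i) X\<rbrakk> \<Longrightarrow> germ C \<Omega> i f \<in> pro_hom C \<Omega> X"
  by (auto simp: pro_hom_def)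

lemma pro_hom_cases:
  assumes "c \<in> pro_hom C \<Omega> X"
  obtains i f where "i \<in> Idx \<Omega>" "f \<in> homset C (Ob \<Omega> i) X" "c = germ C \<Omega> i f"
  using assms by (auto simp: pro_hom_def)

lemma common_index:
  assumes "c \<in> pro_hom C \<Omega> X" "d \<in> pro_hom C \<Omega> Y"
  obtains k f g where "k \<in> Idx \<Omega>" "f \<in> homset C (Ob \<Omega> k) X" "g \<in> homset C (Ob \<Omega> k) Y"
    "c = germ C \<Omega> k f" "d = germ C \<Omega> k g"
proof -
  obtain i f where f: "i \<in> Idx \<Omega>" "f \<in> homset C (Ob \<Omega> i) X" "c = germ C \<Omega> i f"
    using pro_hom_cases[OF assms(1)] by blast
  obtain j g where g: "j \<in> Idx \<Omega>" "g \<in> homset C (Ob \<Omega> j) Y" "d = germ C \<Omega> j g"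
    using pro_hom_cases[OF assms(2)] by blast
  obtain k where k: "k \<in> Idx \<Omega>" "Le \<Omega> i k" "Le \<Omega> j k" using upper_bound f g by blast
  show thesis
    using that[OF k(1) Cmp_in[OF Tr_in[OF f(1) k(1,2)] f(2)] Cmp_in[OF Tr_in[OF g(1) k(1,3)] g(2)]]
      germ_Tr[OF f(1) k(1,2) f(2)] germ_Tr[OF g(1) k(1,3) g(2)] f(3) g(3) by simp
qed

text \<open>Representatives of one class agree after transition maps, so they all contribute the
  same germ; the union in \<open>postcomp\<close> runs over a nonempty class and is that
  germ.\<close>

lemma postcomp_germ:
  assumes i: "i \<in> Idx \<Omega>" and h: "h \<in> homset C (Ob \<Omega> i) X" and f: "f \<in> homset C X Y"
  shows "postcomp C \<Omega> f (germ C \<Omega> i h) = germ C \<Omega> i (f \<odot> h)"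
proof -
  have "germ C \<Omega> j (f \<odot> g) = germ C \<Omega> i (f \<odot> h)" if jg: "(j, g) \<in> germ C \<Omega> i h" for j g
  proof -
    obtain k where j: "j \<in> Idx \<Omega>" and g: "g \<in> homset C (Ob \<Omega> j) X"
      and k: "k \<in> Idx \<Omega>" "Le \<Omega> i k" "Le \<Omega> j k" and eq: "h \<odot> Tr \<Omega> i k = g \<odot> Tr \<Omega> j k"
      using jg by (auto simp: mem_germ[OF h])
    show ?thesis
      using germ_eqI[OF j i k(1,3,2) Cmp_in[OF g f] Cmp_in[OF h f]] eq
        Cmp_assoc[OF Tr_in[OF i k(1,2)] h f] Cmp_assoc[OF Tr_in[OF j k(1,3)] g f] by simp
  qed
  then have "postcomp C \<Omega> f (germ C \<Omega> i h) = (\<Union>x\<in>germ C \<Omega> i h. germ C \<Omega> i (f \<odot> h))"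
    unfolding postcomp_def by (intro SUP_cong) auto
  then show ?thesis using germ_self[OF i h] by auto
qed

lemma postcomp_in:
  assumes "c \<in> pro_hom C \<Omega> X" and f: "f \<in> homset C X Y"
  shows "postcomp C \<Omega> f c \<in> pro_hom C \<Omega> Y"
proof -
  obtain i h where h: "i \<in> Idx \<Omega>" "h \<in> homset C (Ob \<Omega> i) X" "c = germ C \<Omega> i h"
    using pro_hom_cases[OF assms(1)] by blast
  show ?thesis
    using postcomp_germ[OF h(1,2) f] germ_in[OF h(1) Cmp_in[OF h(2) f]] h(3) by simp
qed

lemma postcomp_Cmp:
  assumes "c \<in> pro_hom C \<Omega> X" and f: "f \<in> homset C X Y" and g: "g \<in> homset C Y Z"
  shows "postcomp C \<Omega> (g \<odot> f) c = postcomp C \<Omega> g (postcomp C \<Omega> f c)"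
proof -
  obtain i h where h: "i \<in> Idx \<Omega>" "h \<in> homset C (Ob \<Omega> i) X" "c = germ C \<Omega> i h"
    using pro_hom_cases[OF assms(1)] by blast
  show ?thesis
    using postcomp_germ[OF h(1,2)] postcomp_germ[OF h(1) Cmp_in[OF h(2) f] g] f Cmp_in[OF f g]
      Cmp_assoc[OF h(2) f g] h(3) by simp
qed

lemma postcomp_Ide:
  assumes "c \<in> pro_hom C \<Omega> X"
  shows "postcomp C \<Omega> (Ide C X) c = c"
proof -
  obtain i h where h: "i \<in> Idx \<Omega>" "h \<in> homset C (Ob \<Omega> i) X" "c = germ C \<Omega> i h"
    using pro_hom_cases[OF assms(1)] by blast
  then show ?thesis
    using postcomp_germ[OF h(1,2) Ide_in[OF Obj_homset(2)[OF h(2)]]] Ide_Cmp[OF h(2)] by simp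
qed

text \<open>For a subobject V of X this lets B(V) be identified with its image in A_1(X).\<close>

lemma inj_on_postcomp:
  assumes "injection C m" and m: "m \<in> homset C X Y"
  shows "inj_on (postcomp C \<Omega> m) (pro_hom C \<Omega> X)"
proof (rule inj_onI)
  fix c d assume cd: "c \<in> pro_hom C \<Omega> X" "d \<in> pro_hom C \<Omega> X"
    and eq: "postcomp C \<Omega> m c = postcomp C \<Omega> m d"
  obtain k f g where k: "k \<in> Idx \<Omega>" and f: "f \<in> homset C (Ob \<Omega> k) X" and g: "g \<in> homset C (Ob \<Omega> k) X"
    and c: "c = germ C \<Omega> k f" and d: "d = germ C \<Omega> k g"
    using common_index[OF cd] by blast
  have "m \<odot> f = m \<odot> g"
    using eq germ_inject[OF k Cmp_in[OF f m] Cmp_in[OF g m]]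
    by (simp add: c d postcomp_germ[OF k f m] postcomp_germ[OF k g m])
  then show "c = d" using injection_cancel[OF assms(1) m f g] c d by simp
qed

text \<open>Hom(Omega, -) preserves fibre products, as a filtered colimit of hom-sets does. The
  lemma is meant for \<open>E\<close>: in \<open>principal_cat E\<close> the same square is in
  general no pullback, because the mediating arrow \<open>h\<close> need not be a
  surjection.\<close>

lemma postcomp_pullback:
  assumes pb: "pullback C f g p q" and f: "f \<in> homset C Y X" and g: "g \<in> homset C X' X"
    and y: "y \<in> pro_hom C \<Omega> Y" and x: "x \<in> pro_hom C \<Omega> X'"
    and eq: "postcomp C \<Omega> f y = postcomp C \<Omega> g x"
  shows "\<exists>!z. z \<in> pro_hom C \<Omega> (Dom C p) \<and> postcomp C \<Omega> p z = y \<and> postcomp C \<Omega> q z = x"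
proof -
  note pbD = pullbackD[OF pb f g]
  obtain k a b where k: "k \<in> Idx \<Omega>" and a: "a \<in> homset C (Ob \<Omega> k) Y" and b: "b \<in> homset C (Ob \<Omega> k) X'"
    and ya: "y = germ C \<Omega> k a" and xb: "x = germ C \<Omega> k b"
    using common_index[OF y x] by blast
  have "f \<odot> a = g \<odot> b"
    using eq germ_inject[OF k Cmp_in[OF a f] Cmp_in[OF b g]]
    by (simp add: ya xb postcomp_germ[OF k a f] postcomp_germ[OF k b g])
  then obtain h where h: "h \<in> homset C (Ob \<Omega> k) (Dom C p)" "p \<odot> h = a" "q \<odot> h = b"
    using pbD(4)[OF a b] by blast
  show ?thesis
  proof (rule ex1I[of _ "germ C \<Omega> k h"])
    show "germ C \<Omega> k h \<in> pro_hom C \<Omega> (Dom C p) \<and> postcomp C \<Omega> p (germ C \<Omega> k h) = y \<and>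
        postcomp C \<Omega> q (germ C \<Omega> k h) = x"
      using germ_in[OF k h(1)] postcomp_germ[OF k h(1) pbD(1)] postcomp_germ[OF k h(1) pbD(2)]
        h ya xb by simp
  next
    fix z assume z: "z \<in> pro_hom C \<Omega> (Dom C p) \<and> postcomp C \<Omega> p z = y \<and> postcomp C \<Omega> q z = x"
    then have "z \<in> pro_hom C \<Omega> (Dom C p)" by simp
    then obtain l u v where l: "l \<in> Idx \<Omega>" and u: "u \<in> homset C (Ob \<Omega> l) (Dom C p)"
      and v: "v \<in> homset C (Ob \<Omega> l) (Dom C p)"
      and zu: "z = germ C \<Omega> l u" and hv: "germ C \<Omega> k h = germ C \<Omega> l v"
      by (rule common_index[OF _ germ_in[OF k h(1)]])
    have "postcomp C \<Omega> p (germ C \<Omega> l u) = postcomp C \<Omega> p (germ C \<Omega> l v)"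
      "postcomp C \<Omega> q (germ C \<Omega> l u) = postcomp C \<Omega> q (germ C \<Omega> l v)"
      using z zu hv[symmetric] postcomp_germ[OF k h(1) pbD(1)] postcomp_germ[OF k h(1) pbD(2)]
        h ya xb by simp_all
    then have "p \<odot> u = p \<odot> v" "q \<odot> u = q \<odot> v"
      using germ_inject[OF l Cmp_in[OF u pbD(1)] Cmp_in[OF v pbD(1)]]
        germ_inject[OF l Cmp_in[OF u pbD(2)] Cmp_in[OF v pbD(2)]]
      by (simp_all add: postcomp_germ[OF l u pbD(1)] postcomp_germ[OF l v pbD(1)]
        postcomp_germ[OF l u pbD(2)] postcomp_germ[OF l v pbD(2)])
    then have "u = v" using pbD(5)[OF u v] category_axioms by blast
    then show "z = germ C \<Omega> k h" using zu hv by simp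
  qed
qed

section \<open>The monoid of endomorphisms of a pro-object\<close>

lemma pro_End_component:
  "\<lbrakk>a \<in> carrier (pro_End C \<Omega>); i \<in> Idx \<Omega>\<rbrakk> \<Longrightarrow> a i \<in> pro_hom C \<Omega> (Ob \<Omega> i)"
  by (auto simp: pro_End_def)

lemma pro_End_compatible:
  "\<lbrakk>a \<in> carrier (pro_End C \<Omega>); i \<in> Idx \<Omega>; j \<in> Idx \<Omega>; Le \<Omega> i j\<rbrakk>
    \<Longrightarrow> postcomp C \<Omega> (Tr \<Omega> i j) (a j) = a i"
  by (auto simp: pro_End_def)

text \<open>Two representatives agree at a later index \<open>k\<close>, and \<open>a\<close> is
  compatible with the transition maps from \<open>k\<close>; so the choice of representative is
  immaterial.\<close>

lemma precomp_germ:
  assumes a: "a \<in> carrier (pro_End C \<Omega>)" and i: "i \<in> Idx \<Omega>" and f: "f \<in> homset C (Ob \<Omega> i) X"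
  shows "precomp C \<Omega> (germ C \<Omega> i f) a = postcomp C \<Omega> f (a i)"
proof -
  have "postcomp C \<Omega> g (a j) = postcomp C \<Omega> f (a i)" if jg: "(j, g) \<in> germ C \<Omega> i f" for j g
  proof -
    obtain k where j: "j \<in> Idx \<Omega>" and g: "g \<in> homset C (Ob \<Omega> j) X"
      and k: "k \<in> Idx \<Omega>" "Le \<Omega> i k" "Le \<Omega> j k" and eq: "f \<odot> Tr \<Omega> i k = g \<odot> Tr \<Omega> j k"
      using jg by (auto simp: mem_germ[OF f])
    have ak: "a k \<in> pro_hom C \<Omega> (Ob \<Omega> k)" using a k(1) by (rule pro_End_component)
    show ?thesis
      using postcomp_Cmp[OF ak Tr_in[OF i k(1,2)] f] postcomp_Cmp[OF ak Tr_in[OF j k(1,3)] g] eq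
        pro_End_compatible[OF a i k(1,2)] pro_End_compatible[OF a j k(1,3)] by simp
  qed
  then have "precomp C \<Omega> (germ C \<Omega> i f) a = (\<Union>x\<in>germ C \<Omega> i f. postcomp C \<Omega> f (a i))"
    unfolding precomp_def by (intro SUP_cong) auto
  then show ?thesis using germ_self[OF i f] by auto
qed

lemma precomp_in:
  assumes "c \<in> pro_hom C \<Omega> X" and a: "a \<in> carrier (pro_End C \<Omega>)"
  shows "precomp C \<Omega> c a \<in> pro_hom C \<Omega> X"
proof -
  obtain i h where h: "i \<in> Idx \<Omega>" "h \<in> homset C (Ob \<Omega> i) X" "c = germ C \<Omega> i h"
    using pro_hom_cases[OF assms(1)] by blast
  show ?thesis
    using precomp_germ[OF a h(1,2)] postcomp_in[OF pro_End_component[OF a h(1)] h(2)] h(3) by simp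
qed

lemma precomp_postcomp:
  assumes "c \<in> pro_hom C \<Omega> X" and f: "f \<in> homset C X Y" and a: "a \<in> carrier (pro_End C \<Omega>)"
  shows "precomp C \<Omega> (postcomp C \<Omega> f c) a = postcomp C \<Omega> f (precomp C \<Omega> c a)"
proof -
  obtain i h where h: "i \<in> Idx \<Omega>" "h \<in> homset C (Ob \<Omega> i) X" "c = germ C \<Omega> i h"
    using pro_hom_cases[OF assms(1)] by blast
  then show ?thesis
    using postcomp_germ[OF h(1,2) f] precomp_germ[OF a h(1,2)] precomp_germ[OF a h(1) Cmp_in[OF h(2) f]]
      postcomp_Cmp[OF pro_End_component[OF a h(1)] h(2) f] by simp
qed

lemma precomp_mult:
  assumes "c \<in> pro_hom C \<Omega> X" and a: "a \<in> carrier (pro_End C \<Omega>)" and b: "b \<in> carrier (pro_End C \<Omega>)"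
    and ab: "a \<otimes>\<^bsub>pro_End C \<Omega>\<^esub> b \<in> carrier (pro_End C \<Omega>)"
  shows "precomp C \<Omega> c (a \<otimes>\<^bsub>pro_End C \<Omega>\<^esub> b) = precomp C \<Omega> (precomp C \<Omega> c a) b"
proof -
  obtain i h where h: "i \<in> Idx \<Omega>" "h \<in> homset C (Ob \<Omega> i) X" "c = germ C \<Omega> i h"
    using pro_hom_cases[OF assms(1)] by blast
  have "(a \<otimes>\<^bsub>pro_End C \<Omega>\<^esub> b) i = precomp C \<Omega> (a i) b" using h(1) by (simp add: pro_End_def)
  then show ?thesis
    using h precomp_germ[OF a h(1,2)] precomp_germ[OF ab h(1,2)]
      precomp_postcomp[OF pro_End_component[OF a h(1)] h(2) b] by simp
qed

lemma one_in: "\<one>\<^bsub>pro_End C \<Omega>\<^esub> \<in> carrier (pro_End C \<Omega>)"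
proof -
  have "postcomp C \<Omega> (Tr \<Omega> i j) (germ C \<Omega> j (Ide C (Ob \<Omega> j))) = germ C \<Omega> i (Ide C (Ob \<Omega> i))"
    if "i \<in> Idx \<Omega>" "j \<in> Idx \<Omega>" "Le \<Omega> i j" for i j
    using postcomp_germ[OF that(2) Ide_in Tr_in[OF that]] Ob_in that Cmp_Ide[OF Tr_in[OF that]]
      germ_Tr[OF that Ide_in] Ide_Cmp[OF Tr_in[OF that]] by simp
  then show ?thesis
    using germ_in Ide_in Ob_in by (auto simp: pro_End_def)
qed

lemma precomp_one:
  assumes "c \<in> pro_hom C \<Omega> X"
  shows "precomp C \<Omega> c \<one>\<^bsub>pro_End C \<Omega>\<^esub> = c"
proof -
  obtain i h where h: "i \<in> Idx \<Omega>" "h \<in> homset C (Ob \<Omega> i) X" "c = germ C \<Omega> i h"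
    using pro_hom_cases[OF assms(1)] by blast
  have "\<one>\<^bsub>pro_End C \<Omega>\<^esub> i = germ C \<Omega> i (Ide C (Ob \<Omega> i))" using h(1) by (simp add: pro_End_def)
  then show ?thesis
    using h precomp_germ[OF one_in h(1,2)] postcomp_germ[OF h(1) Ide_in h(2)] Ob_in Cmp_Ide by simp
qed

lemma mult_in:
  assumes a: "a \<in> carrier (pro_End C \<Omega>)" and b: "b \<in> carrier (pro_End C \<Omega>)"
  shows "a \<otimes>\<^bsub>pro_End C \<Omega>\<^esub> b \<in> carrier (pro_End C \<Omega>)"
proof -
  have "postcomp C \<Omega> (Tr \<Omega> i j) (precomp C \<Omega> (a j) b) = precomp C \<Omega> (a i) b"
    if "i \<in> Idx \<Omega>" "j \<in> Idx \<Omega>" "Le \<Omega> i j" for i j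
    using precomp_postcomp[OF pro_End_component[OF a that(2)] Tr_in[OF that] b]
      pro_End_compatible[OF a that] by simp
  moreover have "precomp C \<Omega> (a i) b \<in> pro_hom C \<Omega> (Ob \<Omega> i)" if "i \<in> Idx \<Omega>" for i
    using pro_End_component[OF a that] b by (rule precomp_in)
  ultimately show ?thesis by (auto simp: pro_End_def)
qed

lemma pro_End_eqI:
  assumes "a \<in> carrier (pro_End C \<Omega>)" "b \<in> carrier (pro_End C \<Omega>)" "\<And>i. i \<in> Idx \<Omega> \<Longrightarrow> a i = b i"
  shows "a = b"
  using assms by (auto simp: pro_End_def intro: PiE_ext)

lemma mult_component: "i \<in> Idx \<Omega> \<Longrightarrow> (a \<otimes>\<^bsub>pro_End C \<Omega>\<^esub> b) i = precomp C \<Omega> (a i) b"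
  by (simp add: pro_End_def)

lemma monoid_pro_End: "monoid (pro_End C \<Omega>)"
proof (rule monoidI)
  fix a b c assume a: "a \<in> carrier (pro_End C \<Omega>)" and b: "b \<in> carrier (pro_End C \<Omega>)"
    and c: "c \<in> carrier (pro_End C \<Omega>)"
  show "a \<otimes>\<^bsub>pro_End C \<Omega>\<^esub> b \<otimes>\<^bsub>pro_End C \<Omega>\<^esub> c = a \<otimes>\<^bsub>pro_End C \<Omega>\<^esub> (b \<otimes>\<^bsub>pro_End C \<Omega>\<^esub> c)"
    using precomp_mult[OF pro_End_component[OF a] b c mult_in[OF b c]] a b c mult_in
    by (intro pro_End_eqI) (auto simp: mult_component)
next
  fix a assume a: "a \<in> carrier (pro_End C \<Omega>)"
  show "\<one>\<^bsub>pro_End C \<Omega>\<^esub> \<otimes>\<^bsub>pro_End C \<Omega>\<^esub> a = a"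
  proof (intro pro_End_eqI mult_in one_in a)
    fix i assume i: "i \<in> Idx \<Omega>"
    have "\<one>\<^bsub>pro_End C \<Omega>\<^esub> i = germ C \<Omega> i (Ide C (Ob \<Omega> i))" using i by (simp add: pro_End_def)
    then show "(\<one>\<^bsub>pro_End C \<Omega>\<^esub> \<otimes>\<^bsub>pro_End C \<Omega>\<^esub> a) i = a i"
      using i precomp_germ[OF a i Ide_in[OF Ob_in[OF i]]] postcomp_Ide[OF pro_End_component[OF a i]]
      by (simp add: mult_component)
  qed
  show "a \<otimes>\<^bsub>pro_End C \<Omega>\<^esub> \<one>\<^bsub>pro_End C \<Omega>\<^esub> = a"
    using precomp_one pro_End_component[OF a]
    by (intro pro_End_eqI mult_in one_in a) (auto simp: mult_component)
qed (simp_all add: mult_in one_in)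

end

section \<open>Principal objects and surjections\<close>

lemma principal_cat_simps [simp]:
  "Obj (principal_cat C) = {X \<in> Obj C. principal_object C X}"
  "Dom (principal_cat C) = Dom C" "Cod (principal_cat C) = Cod C"
  "Ide (principal_cat C) = Ide C" "Cmp (principal_cat C) = Cmp C"
  by (simp_all add: principal_cat_def)

lemma homset_principal_cat:
  "f \<in> homset (principal_cat C) X Y \<longleftrightarrow>
     f \<in> homset C X Y \<and> principal_object C X \<and> principal_object C Y \<and> surjection C f"
  by (auto simp: homset_def principal_cat_def)

lemma (in regular) category_principal_cat: "category (principal_cat C)"
proof
  fix f assume "f \<in> Arr (principal_cat C)"
  then show "Dom (principal_cat C) f \<in> Obj (principal_cat C)"
      "Cod (principal_cat C) f \<in> Obj (principal_cat C)"
    by (auto simp: principal_cat_def intro: Dom_in Cod_in)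
next
  fix X assume "X \<in> Obj (principal_cat C)"
  then show "Ide (principal_cat C) X \<in> homset (principal_cat C) X X"
    using Ide_in is_iso_surjection is_iso_Ide by (simp add: homset_principal_cat)
next
  fix f g X Y Z
  assume "f \<in> homset (principal_cat C) X Y" "g \<in> homset (principal_cat C) Y Z"
  then show "g \<odot>\<^bsub>principal_cat C\<^esub> f \<in> homset (principal_cat C) X Z"
    by (auto simp: homset_principal_cat intro: Cmp_in surjection_Cmp)
qed (auto simp: homset_principal_cat Cmp_Ide Ide_Cmp Cmp_assoc)

locale principal_pro_object = regular E for E :: "('o, 'm) category" (structure) +
  fixes \<Omega> :: "('i, 'o, 'm) pro_object"
  assumes pro_principal: "is_pro_object (principal_cat E) \<Omega>"
begin

lemma epi_pro_object_principal: "epi_pro_object (principal_cat E) \<Omega>"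
proof -
  interpret P: category "principal_cat E" by (rule category_principal_cat)
  show ?thesis
  proof
    fix i j a b X
    assume ij: "i \<in> Idx \<Omega>" "j \<in> Idx \<Omega>" "Le \<Omega> i j"
      and a: "a \<in> homset (principal_cat E) (Ob \<Omega> i) X" and b: "b \<in> homset (principal_cat E) (Ob \<Omega> i) X"
      and eq: "a \<odot>\<^bsub>principal_cat E\<^esub> Tr \<Omega> i j = b \<odot>\<^bsub>principal_cat E\<^esub> Tr \<Omega> i j"
    have "Tr \<Omega> i j \<in> homset (principal_cat E) (Ob \<Omega> j) (Ob \<Omega> i)"
      using pro_principal ij unfolding is_pro_object_def by blast
    then show "a = b"
      using surjection_cancel[of "Tr \<Omega> i j" "Ob \<Omega> j" "Ob \<Omega> i" a X b] a b eq
      by (simp add: homset_principal_cat)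
  qed (rule pro_principal)
qed

sublocale P: epi_pro_object "principal_cat E" \<Omega>
  by (rule epi_pro_object_principal)

lemma Tr_surjection:
  assumes "i \<in> Idx \<Omega>" "j \<in> Idx \<Omega>" "Le \<Omega> i j"
  shows "surjection E (Tr \<Omega> i j)" "Tr \<Omega> i j \<in> homset E (Ob \<Omega> j) (Ob \<Omega> i)"
  using P.Tr_in[OF assms] by (auto simp: homset_principal_cat)

text \<open>The transition maps are regular epimorphisms of \<open>E\<close>, so they can be
  cancelled against all arrows of \<open>E\<close> and not only against surjections.\<close>

sublocale epi_pro_object E \<Omega>
proof
  have "Idx \<Omega> \<noteq> {}" using pro_principal by (simp add: is_pro_object_def)
  moreover have "Ob \<Omega> i \<in> Obj E" if "i \<in> Idx \<Omega>" for i using P.Ob_in[OF that] by simp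
  ultimately show "is_pro_object E \<Omega>"
    unfolding is_pro_object_def
    using P.Tr_refl
    by (intro conjI ballI impI; (elim conjE)?)
      (simp_all add: P.Le_refl Tr_surjection,
        (rule P.Le_trans P.upper_bound P.Tr_Cmp[simplified]; assumption)+)
next
  fix i j a b X
  assume ij: "i \<in> Idx \<Omega>" "j \<in> Idx \<Omega>" "Le \<Omega> i j"
    and "a \<in> homset E (Ob \<Omega> i) X" "b \<in> homset E (Ob \<Omega> i) X" "a \<odot> Tr \<Omega> i j = b \<odot> Tr \<Omega> i j"
  then show "a = b" using surjection_cancel[OF Tr_surjection[OF ij]] by blast
qed

text \<open>\<open>H X\<close> is the set A_1(X) of all maps from Omega to X; \<open>B X\<close>
  below is the set B(X) of surjections.\<close>

abbreviation H :: "'o \<Rightarrow> ('i \<times> 'm) set set" where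
  "H X \<equiv> pro_hom E \<Omega> X"

abbreviation B :: "'o \<Rightarrow> ('i \<times> 'm) set set" where
  "B X \<equiv> pro_hom (principal_cat E) \<Omega> X"

abbreviation post :: "'m \<Rightarrow> ('i \<times> 'm) set \<Rightarrow> ('i \<times> 'm) set" where
  "post f \<equiv> postcomp E \<Omega> f"

lemma Ob_principal: "i \<in> Idx \<Omega> \<Longrightarrow> principal_object E (Ob \<Omega> i)"
  using P.Ob_in by simp

text \<open>Surjectivity belongs to the germ: it passes from \<open>f\<close> to its composite with
  a surjective transition map, and from there to the left factor \<open>g\<close>.\<close>

lemma surjection_germ:
  assumes i: "i \<in> Idx \<Omega>" and f: "f \<in> homset E (Ob \<Omega> i) X" and "surjection E f"
    and jg: "(j, g) \<in> germ E \<Omega> i f"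
  shows "surjection E g"
proof -
  obtain k where j: "j \<in> Idx \<Omega>" and g: "g \<in> homset E (Ob \<Omega> j) X"
    and k: "k \<in> Idx \<Omega>" "Le \<Omega> i k" "Le \<Omega> j k" and eq: "f \<odot> Tr \<Omega> i k = g \<odot> Tr \<Omega> j k"
    using jg by (auto simp: mem_germ[OF f])
  have "surjection E (g \<odot> Tr \<Omega> j k)"
    using surjection_Cmp[OF Tr_surjection(1)[OF i k(1,2)] assms(3) Tr_surjection(2)[OF i k(1,2)] f] eq
    by simp
  then show ?thesis using surjection_left[OF _ Tr_surjection(2)[OF j k(1,3)] g] by blast
qed

text \<open>A germ of a surjection has only surjective representatives, so the two colimits yield
  literally the same class. This makes B(X) a subset of A_1(X), with no comparison map.\<close>

lemma germ_principal_cat: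
  assumes i: "i \<in> Idx \<Omega>" and f: "f \<in> homset E (Ob \<Omega> i) X" and "surjection E f"
  shows "germ (principal_cat E) \<Omega> i f = germ E \<Omega> i f"
proof -
  have X: "principal_object E X" by (rule principal_object_Cod[OF Ob_principal[OF i] f])
  then have f': "f \<in> homset (principal_cat E) (Ob \<Omega> i) X"
    using f assms(3) Ob_principal[OF i] by (simp add: homset_principal_cat)
  have "(j, g) \<in> germ (principal_cat E) \<Omega> i f \<longleftrightarrow> (j, g) \<in> germ E \<Omega> i f" for j g
    using surjection_germ[OF assms] Ob_principal X
    by (auto simp: P.mem_germ[OF f'] mem_germ[OF f] homset_principal_cat)
  then show ?thesis by auto
qed

lemma B_cases:
  assumes "c \<in> B X"
  obtains i f where "i \<in> Idx \<Omega>" "f \<in> homset E (Ob \<Omega> i) X" "surjection E f" "c = germ E \<Omega> i f"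
    "f \<in> homset (principal_cat E) (Ob \<Omega> i) X" "c = germ (principal_cat E) \<Omega> i f"
proof -
  obtain i f where f: "i \<in> Idx \<Omega>" "f \<in> homset (principal_cat E) (Ob \<Omega> i) X"
      "c = germ (principal_cat E) \<Omega> i f"
    using P.pro_hom_cases[OF assms] by blast
  then have "f \<in> homset E (Ob \<Omega> i) X" "surjection E f" by (simp_all add: homset_principal_cat)
  with f show thesis using that germ_principal_cat[OF f(1)] by simp
qed

lemma B_subset: "B X \<subseteq> H X"
  by (auto elim!: B_cases intro: germ_in)

lemma B_principal: "c \<in> B X \<Longrightarrow> principal_object E X"
  by (auto elim!: B_cases simp: homset_principal_cat)

lemma germ_in_B_iff:
  assumes i: "i \<in> Idx \<Omega>" and f: "f \<in> homset E (Ob \<Omega> i) X"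
  shows "germ E \<Omega> i f \<in> B X \<longleftrightarrow> surjection E f"
proof
  assume "surjection E f"
  then have "f \<in> homset (principal_cat E) (Ob \<Omega> i) X"
    using f Ob_principal[OF i] principal_object_Cod[OF _ f] by (simp add: homset_principal_cat)
  then show "germ E \<Omega> i f \<in> B X"
    using P.germ_in[OF i, of f X] germ_principal_cat[OF i f \<open>surjection E f\<close>] by simp
next
  assume "germ E \<Omega> i f \<in> B X"
  then obtain j g where g: "j \<in> Idx \<Omega>" "g \<in> homset E (Ob \<Omega> j) X" "surjection E g"
    and eq: "germ E \<Omega> i f = germ E \<Omega> j g"
    by (rule B_cases)
  have "(i, f) \<in> germ E \<Omega> j g" using germ_self[OF i f] eq by simp
  then show "surjection E f" by (rule surjection_germ[OF g])
qed

lemma post_principal_cat: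
  assumes "c \<in> B X" and f: "f \<in> homset E X Y" and "surjection E f"
  shows "postcomp (principal_cat E) \<Omega> f c = post f c"
proof -
  obtain i h where h: "i \<in> Idx \<Omega>" "h \<in> homset E (Ob \<Omega> i) X" "surjection E h" "c = germ E \<Omega> i h"
      "h \<in> homset (principal_cat E) (Ob \<Omega> i) X" "c = germ (principal_cat E) \<Omega> i h"
    using B_cases[OF assms(1)] by blast
  have X: "principal_object E X" using assms(1) by (rule B_principal)
  then have f': "f \<in> homset (principal_cat E) X Y"
    using f assms(3) principal_object_Cod[OF X f] by (simp add: homset_principal_cat)
  show ?thesis
    using P.postcomp_germ[OF h(1,5) f'] postcomp_germ[OF h(1,2) f] h(4,6)
      germ_principal_cat[OF h(1) Cmp_in[OF h(2) f] surjection_Cmp[OF h(3) assms(3) h(2) f]] by simp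
qed

lemma post_in_B:
  assumes "c \<in> B X" and f: "f \<in> homset E X Y" and "surjection E f"
  shows "post f c \<in> B Y"
proof -
  obtain i h where h: "i \<in> Idx \<Omega>" "h \<in> homset E (Ob \<Omega> i) X" "surjection E h" "c = germ E \<Omega> i h"
    using B_cases[OF assms(1)] by blast
  then show ?thesis
    using germ_in_B_iff[OF h(1) Cmp_in[OF h(2) f]] surjection_Cmp[OF h(3) assms(3) h(2) f]
      postcomp_germ[OF h(1,2) f] by simp
qed

lemma post_in_B_surjection:
  assumes "c \<in> H X" and f: "f \<in> homset E X Y" and "post f c \<in> B Y"
  shows "surjection E f"
proof -
  obtain i h where h: "i \<in> Idx \<Omega>" "h \<in> homset E (Ob \<Omega> i) X" "c = germ E \<Omega> i h"
    using pro_hom_cases[OF assms(1)] by blast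
  have "surjection E (f \<odot> h)"
    using assms(3) germ_in_B_iff[OF h(1) Cmp_in[OF h(2) f]] postcomp_germ[OF h(1,2) f] h(3) by simp
  then show ?thesis using surjection_left[OF _ h(2) f] by blast
qed

text \<open>Factor a representative through its image. This is the decomposition of A_1(X) into
  pieces B(V) over the principal subobjects V.\<close>

lemma H_factorization:
  assumes "c \<in> H X"
  obtains V m b where "injection E m" "m \<in> homset E V X" "b \<in> B V" "c = post m b"
proof -
  obtain i f where f: "i \<in> Idx \<Omega>" "f \<in> homset E (Ob \<Omega> i) X" "c = germ E \<Omega> i f"
    using pro_hom_cases[OF assms(1)] by blast
  obtain V e m where F: "surjection E e" "e \<in> homset E (Ob \<Omega> i) V" "injection E m"
    "m \<in> homset E V X" "m \<odot> e = f"
    using factorization[OF f(2)] by blast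
  show thesis
    using that[OF F(3,4)] germ_in_B_iff[OF f(1) F(2)] postcomp_germ[OF f(1) F(2,4)] F(1,5) f(3) by simp
qed

section \<open>The automorphism group\<close>

text \<open>It lets the group, which is built from surjections only, act on A_1(X) as well.\<close>

lemma pro_End_principal_cat:
  assumes a: "a \<in> carrier (pro_End (principal_cat E) \<Omega>)"
  shows "a \<in> carrier (pro_End E \<Omega>)"
proof -
  have "post (Tr \<Omega> i j) (a j) = a i" if "i \<in> Idx \<Omega>" "j \<in> Idx \<Omega>" "Le \<Omega> i j" for i j
    using post_principal_cat[OF P.pro_End_component[OF a that(2)] Tr_surjection(2,1)[OF that]]
      P.pro_End_compatible[OF a that] by simp
  moreover have "a i \<in> H (Ob \<Omega> i)" if "i \<in> Idx \<Omega>" for i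
    using P.pro_End_component[OF a that] B_subset by blast
  ultimately show ?thesis using a by (auto simp: pro_End_def)
qed

lemma precomp_principal_cat:
  assumes "c \<in> B X" and a: "a \<in> carrier (pro_End (principal_cat E) \<Omega>)"
  shows "precomp (principal_cat E) \<Omega> c a = precomp E \<Omega> c a"
proof -
  obtain i h where h: "i \<in> Idx \<Omega>" "h \<in> homset E (Ob \<Omega> i) X" "surjection E h" "c = germ E \<Omega> i h"
      "h \<in> homset (principal_cat E) (Ob \<Omega> i) X" "c = germ (principal_cat E) \<Omega> i h"
    using B_cases[OF assms(1)] by blast
  show ?thesis
    using P.precomp_germ[OF a h(1,5)] precomp_germ[OF pro_End_principal_cat[OF a] h(1,2)] h(4,6)
      post_principal_cat[OF P.pro_End_component[OF a h(1)] h(2,3)] by simp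
qed

lemma mult_principal_cat:
  assumes a: "a \<in> carrier (pro_End (principal_cat E) \<Omega>)" and b: "b \<in> carrier (pro_End (principal_cat E) \<Omega>)"
  shows "a \<otimes>\<^bsub>pro_End (principal_cat E) \<Omega>\<^esub> b = a \<otimes>\<^bsub>pro_End E \<Omega>\<^esub> b"
  using precomp_principal_cat[OF P.pro_End_component[OF a] b]
  by (simp add: pro_End_def cong: restrict_cong)

lemma one_principal_cat: "\<one>\<^bsub>pro_End (principal_cat E) \<Omega>\<^esub> = \<one>\<^bsub>pro_End E \<Omega>\<^esub>"
  using germ_principal_cat[OF _ Ide_in[OF Ob_in] is_iso_surjection[OF is_iso_Ide[OF Ob_in]]]
  by (simp add: pro_End_def cong: restrict_cong)

abbreviation G :: "('i \<Rightarrow> ('i \<times> 'm) set) monoid" where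
  "G \<equiv> Aut_pro E \<Omega>"

sublocale G: group G
  unfolding Aut_pro_def using P.monoid_pro_End by (rule monoid.units_group)

lemma carrier_G: "g \<in> carrier G \<Longrightarrow> g \<in> carrier (pro_End (principal_cat E) \<Omega>)"
  by (simp add: Aut_pro_def units_of_carrier Units_def)

text \<open>One formula for the actions on all B(X) and A_1(X), before restriction to the underlying
  set. The inverse turns composition on the right into a left action.\<close>

definition gact :: "('i \<Rightarrow> ('i \<times> 'm) set) \<Rightarrow> ('i \<times> 'm) set \<Rightarrow> ('i \<times> 'm) set" where
  "gact g c = precomp E \<Omega> c (inv\<^bsub>G\<^esub> g)"

lemma inv_G:
  assumes "g \<in> carrier G"
  shows "inv\<^bsub>G\<^esub> g \<in> carrier (pro_End (principal_cat E) \<Omega>)" "inv\<^bsub>G\<^esub> g \<in> carrier (pro_End E \<Omega>)"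
  using carrier_G[OF G.inv_closed[OF assms]] pro_End_principal_cat by auto

lemma gact_in_B:
  assumes "c \<in> B X" "g \<in> carrier G" shows "gact g c \<in> B X"
  using P.precomp_in[OF assms(1) inv_G(1)[OF assms(2)]]
    precomp_principal_cat[OF assms(1) inv_G(1)[OF assms(2)]] by (simp add: gact_def)

lemma gact_post: "\<lbrakk>c \<in> H X; f \<in> homset E X Y; g \<in> carrier G\<rbrakk> \<Longrightarrow> gact g (post f c) = post f (gact g c)"
  unfolding gact_def by (rule precomp_postcomp[OF _ _ inv_G(2)])

lemma gact_one: "c \<in> H X \<Longrightarrow> gact \<one>\<^bsub>G\<^esub> c = c"
  using precomp_one one_principal_cat G.inv_one
  by (simp add: gact_def Aut_pro_def units_of_one)

lemma gact_mult:
  assumes c: "c \<in> H X" and g: "g \<in> carrier G" and h: "h \<in> carrier G"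
  shows "gact (g \<otimes>\<^bsub>G\<^esub> h) c = gact g (gact h c)"
proof -
  have eq: "inv\<^bsub>G\<^esub> (g \<otimes>\<^bsub>G\<^esub> h) = inv\<^bsub>G\<^esub> h \<otimes>\<^bsub>pro_End E \<Omega>\<^esub> inv\<^bsub>G\<^esub> g"
    using G.inv_mult_group[OF g h] mult_principal_cat[OF inv_G(1)[OF h] inv_G(1)[OF g]]
    by (simp add: Aut_pro_def units_of_mult)
  show ?thesis
    unfolding gact_def eq
    by (rule precomp_mult[OF c inv_G(2)[OF h] inv_G(2)[OF g] mult_in[OF inv_G(2)[OF h] inv_G(2)[OF g]]])
qed

lemma pts_A1 [simp]: "pts (A1_set E \<Omega> X) = H X"
  by (simp add: A1_set_def hom_gset_def)

lemma pts_B [simp]: "pts (B_set E \<Omega> X) = B X"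
  by (simp add: B_set_def hom_gset_def)

lemma act_A1: "act (A1_set E \<Omega> X) g = restrict (gact g) (H X)"
  by (simp add: A1_set_def hom_gset_def gact_def[abs_def])

lemma act_B: "g \<in> carrier G \<Longrightarrow> act (B_set E \<Omega> X) g = restrict (gact g) (B X)"
  using precomp_principal_cat[OF _ inv_G(1)]
  by (auto simp: B_set_def hom_gset_def gact_def intro!: restrict_ext)

end

section \<open>Orbits and atoms\<close>

lemma group_actionI:
  assumes "group G"
    and ext: "\<And>g. g \<in> carrier G \<Longrightarrow> \<phi> g \<in> extensional S"
    and closed: "\<And>g x. \<lbrakk>g \<in> carrier G; x \<in> S\<rbrakk> \<Longrightarrow> \<phi> g x \<in> S"
    and one: "\<And>x. x \<in> S \<Longrightarrow> \<phi> \<one>\<^bsub>G\<^esub> x = x"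
    and mult: "\<And>g h x. \<lbrakk>g \<in> carrier G; h \<in> carrier G; x \<in> S\<rbrakk> \<Longrightarrow> \<phi> (g \<otimes>\<^bsub>G\<^esub> h) x = \<phi> g (\<phi> h x)"
  shows "group_action G S \<phi>"
proof -
  interpret group G by fact
  have Bij: "\<phi> g \<in> Bij S" if g: "g \<in> carrier G" for g
  proof -
    have "bij_betw (\<phi> g) S S"
      by (rule bij_betw_byWitness[where f' = "\<phi> (inv\<^bsub>G\<^esub> g)"])
        (use g closed one mult[symmetric] in auto)
    then show ?thesis using ext[OF g] by (simp add: Bij_def)
  qed
  have "\<phi> (g \<otimes>\<^bsub>G\<^esub> h) = compose S (\<phi> g) (\<phi> h)" if "g \<in> carrier G" "h \<in> carrier G" for g h
    by (rule extensionalityI[of _ S]) (use that ext mult in \<open>auto simp: compose_def\<close>)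
  then have "\<phi> \<in> hom G (BijGroup S)"
    using Bij by (auto simp: hom_def BijGroup_def)
  then show ?thesis
    unfolding group_action_def group_hom_def group_hom_axioms_def
    using assms(1) group_BijGroup by blast
qed

locale homogeneous_pro_object = principal_pro_object E \<Omega>
  for E :: "('o, 'm) category" (structure) and \<Omega> :: "('i, 'o, 'm) pro_object" +
  assumes powered: "finitely_powered E"
    and universal: "universal_pro E \<Omega>"
    and homogeneous: "homogeneous_pro E \<Omega>"
begin

lemma B_nonempty: "principal_object E X \<Longrightarrow> B X \<noteq> {}"
  using universal principal_object_Obj by (auto simp: universal_pro_def)

lemma B_transitive:
  assumes x: "x \<in> B X" and y: "y \<in> B X"
  obtains g where "g \<in> carrier G" "gact g x = y"
proof -
  have "X \<in> Obj (principal_cat E)" using B_principal[OF x] principal_object_Obj by simp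
  then have "\<exists>g\<in>carrier G. act (B_set E \<Omega> X) g x = y"
    using homogeneous x y unfolding homogeneous_pro_def by (metis pts_B)
  then show thesis using that x by (auto simp: act_B)
qed

text \<open>The orbits on A_1(X), described through principal subobjects;
  \<open>gset_orbits_A1\<close> identifies them with the orbits of the action.\<close>

definition Orb :: "'o \<Rightarrow> ('i \<times> 'm) set set set" where
  "Orb X = {post m ` B V | m V. injection E m \<and> m \<in> homset E V X \<and> principal_object E V}"

lemma OrbI: "\<lbrakk>injection E m; m \<in> homset E V X; principal_object E V\<rbrakk> \<Longrightarrow> post m ` B V \<in> Orb X"
  by (auto simp: Orb_def)

lemma OrbE:
  assumes "S \<in> Orb X"
  obtains m V where "injection E m" "m \<in> homset E V X" "principal_object E V" "S = post m ` B V"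
  using assms by (auto simp: Orb_def)

text \<open>By homogeneity the group is transitive on B(V), and the action commutes with
  \<open>post m\<close>.\<close>

lemma orbit_post:
  assumes m: "m \<in> homset E V X" and b: "b \<in> B V"
  shows "{gact g (post m b) | g. g \<in> carrier G} = post m ` B V"
proof -
  have bH: "b \<in> H V" using b B_subset by blast
  have "gact g (post m b) \<in> post m ` B V" if "g \<in> carrier G" for g
    using gact_post[OF bH m that] gact_in_B[OF b that] by simp
  moreover have "\<exists>g\<in>carrier G. post m c = gact g (post m b)" if c: "c \<in> B V" for c
  proof -
    obtain g where "g \<in> carrier G" "gact g b = c" using B_transitive[OF b c] by blast
    then show ?thesis using gact_post[OF bH m] by (intro bexI[of _ g]) simp_all
  qed
  ultimately show ?thesis by blast
qed

lemma Orb_orbit: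
  assumes "S \<in> Orb X" "x \<in> S"
  shows "S = {gact g x | g. g \<in> carrier G}"
proof -
  obtain m V where m: "m \<in> homset E V X" "S = post m ` B V" using OrbE[OF assms(1)] by blast
  then obtain b where "b \<in> B V" "x = post m b" using assms(2) by blast
  then show ?thesis using orbit_post[OF m(1)] m(2) by simp
qed

lemma Orb_eq:
  assumes "S \<in> Orb X" "T \<in> Orb X" "x \<in> S" "x \<in> T"
  shows "S = T"
  by (rule trans[OF Orb_orbit[OF assms(1,3)] Orb_orbit[OF assms(2,4), symmetric]])

lemma Orb_subset:
  assumes "S \<in> Orb X" shows "S \<subseteq> H X"
proof -
  obtain m V where m: "m \<in> homset E V X" "S = post m ` B V" using OrbE[OF assms] by blast
  have "post m b \<in> H X" if "b \<in> B V" for b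
    using subsetD[OF B_subset that] m(1) by (rule postcomp_in)
  then show ?thesis using m(2) by blast
qed

lemma Orb_nonempty: "S \<in> Orb X \<Longrightarrow> S \<noteq> {}"
  by (erule OrbE) (simp add: B_nonempty)

lemma gact_in_Orb: "\<lbrakk>S \<in> Orb X; x \<in> S; g \<in> carrier G\<rbrakk> \<Longrightarrow> gact g x \<in> S"
  using Orb_orbit[of S X x] by blast

lemma Orb_transitive:
  assumes "S \<in> Orb X" "x \<in> S" "y \<in> S"
  obtains g where "g \<in> carrier G" "gact g x = y"
  using Orb_orbit[OF assms(1,2)] assms(3) by blast

lemma Orb_cover:
  assumes "x \<in> H X"
  obtains S where "S \<in> Orb X" "x \<in> S"
proof -
  obtain V m b where m: "injection E m" "m \<in> homset E V X" "b \<in> B V" "x = post m b"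
    using H_factorization[OF assms] by blast
  then show thesis using that[OF OrbI[OF m(1,2) B_principal[OF m(3)]]] by blast
qed

lemma orbit_in_Orb:
  assumes "x \<in> H X" shows "{gact g x | g. g \<in> carrier G} \<in> Orb X"
proof -
  obtain S where S: "S \<in> Orb X" "x \<in> S" using Orb_cover[OF assms] by blast
  then show ?thesis by (simp only: Orb_orbit[OF S, symmetric])
qed

lemma B_in_Orb:
  assumes "principal_object E X" shows "B X \<in> Orb X"
proof -
  have X: "X \<in> Obj E" using assms by (rule principal_object_Obj)
  have "post (Ide E X) ` B X = B X"
    using postcomp_Ide[OF subsetD[OF B_subset]] by simp
  then show ?thesis
    using OrbI[OF is_iso_injection[OF is_iso_Ide[OF X]] Ide_in[OF X] assms] by simp
qed

lemma Orb_image: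
  assumes "S \<in> Orb Y" and f: "f \<in> homset E Y X"
  shows "post f ` S \<in> Orb X"
proof -
  obtain x where x: "x \<in> S" using Orb_nonempty assms(1) by blast
  have xH: "x \<in> H Y" using subsetD[OF Orb_subset[OF assms(1)] x] .
  have "post f ` {gact g x | g. g \<in> carrier G} = {gact g (post f x) | g. g \<in> carrier G}"
    using gact_post[OF xH f] by (auto simp: image_iff)
  then have "post f ` S = {gact g (post f x) | g. g \<in> carrier G}"
    by (simp only: Orb_orbit[OF assms(1) x, symmetric])
  then show ?thesis using orbit_in_Orb[OF postcomp_in[OF xH f]] by simp
qed

lemma Orb_image_eq:
  assumes "S \<in> Orb Y" "f \<in> homset E Y X" "T \<in> Orb X" "x \<in> S" "post f x \<in> T"
  shows "post f ` S = T"
  using Orb_eq[OF Orb_image[OF assms(1,2)] assms(3) _ assms(5)] assms(4) by blast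

lemma sub_gset_sel [simp]: "pts (sub_gset A S) = S" "act (sub_gset A S) g = restrict (act A g) S"
  by (simp_all add: sub_gset_def)

lemma gset_orbits_A1: "gset_orbits G (A1_set E \<Omega> X) = Orb X"
proof -
  have "orbit G (act (A1_set E \<Omega> X)) x = {gact g x | g. g \<in> carrier G}" if "x \<in> H X" for x
    using that by (auto simp: orbit_def act_A1)
  then have "gset_orbits G (A1_set E \<Omega> X) = (\<lambda>x. {gact g x | g. g \<in> carrier G}) ` H X"
    by (auto simp: orbits_def image_iff)
  also have "\<dots> = Orb X"
  proof (intro equalityI subsetI)
    fix S assume S: "S \<in> Orb X"
    obtain x where "x \<in> S" using Orb_nonempty[OF S] by blast
    then show "S \<in> (\<lambda>x. {gact g x | g. g \<in> carrier G}) ` H X"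
      using Orb_orbit[OF S] Orb_subset[OF S] by blast
  qed (use orbit_in_Orb in blast)
  finally show ?thesis .
qed

lemma stabilizer_open:
  assumes b: "b \<in> B V"
  shows "openin (Aut_topology E \<Omega>) {g \<in> carrier G. gact g b = b}"
proof -
  have "stabilizer G (act (B_set E \<Omega> V)) b = {g \<in> carrier G. gact g b = b}"
    unfolding stabilizer_def by (intro Collect_cong conj_cong refl) (simp add: act_B b)
  moreover have "\<one>\<^bsub>G\<^esub> <#\<^bsub>G\<^esub> {g \<in> carrier G. gact g b = b} = {g \<in> carrier G. gact g b = b}"
    by (rule G.lcos_mult_one) blast
  ultimately show ?thesis
    unfolding Aut_topology_def using b B_principal[OF b] principal_object_Obj[OF B_principal[OF b]]
    by (intro topology_generated_by_Basis CollectI exI[of _ "\<one>\<^bsub>G\<^esub>"] exI[of _ V] exI[of _ b]) simp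
qed

text \<open>Stated for any record with the right action, since two records occur for the orbit B(X):
  \<open>orb_gset X (B X)\<close> and \<open>B_set E \<Omega> X\<close>. Their actions are only
  known to agree on group elements.\<close>

lemma C_atomI:
  assumes S: "S \<in> Orb X" and pts: "pts A = S"
    and act: "\<And>g. g \<in> carrier G \<Longrightarrow> act A g = restrict (gact g) S"
  shows "C_atom E \<Omega> A"
proof -
  obtain m V where m: "injection E m" "m \<in> homset E V X" and V: "principal_object E V"
    and Sm: "S = post m ` B V"
    using OrbE[OF S] by blast
  note SH = subsetD[OF Orb_subset[OF S]] and BH = subsetD[OF B_subset]
  have inj: "inj_on (post m) (B V)" using inj_on_postcomp[OF m] B_subset by (rule inj_on_subset)
  have action: "group_action G (pts A) (act A)"
    using pts act gact_in_Orb[OF S] gact_one[OF SH] gact_mult[OF SH] G.group_axioms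
    by (intro group_actionI) auto
  have trans: "\<exists>g\<in>carrier G. act A g x = y" if xy: "x \<in> S" "y \<in> S" for x y
  proof -
    obtain g where "g \<in> carrier G" "gact g x = y" using Orb_transitive[OF S xy] by blast
    then show ?thesis using act xy by (intro bexI[of _ g]) simp_all
  qed
  have orbits: "gset_orbits G A = {S}"
  proof -
    have "orbit G (act A) x = S" if x: "x \<in> S" for x
    proof -
      have "act A g x = gact g x" if "g \<in> carrier G" for g using act[OF that] x by simp
      then have "orbit G (act A) x = {gact g x | g. g \<in> carrier G}" by (auto simp: orbit_def)
      then show ?thesis by (simp only: Orb_orbit[OF S x, symmetric])
    qed
    then show ?thesis using Orb_nonempty[OF S] by (auto simp: orbits_def pts)
  qed
  have stab: "openin (Aut_topology E \<Omega>) (stabilizer G (act A) x)" if x: "x \<in> pts A" for x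
  proof -
    obtain b where b: "b \<in> B V" "x = post m b" using x pts Sm by blast
    \<comment> \<open>As \<open>post m\<close> is injective, \<open>post m b\<close> has the same
      stabilizer as \<open>b\<close>, and the latter is open by the choice of the topology.\<close>
    have "act A g x = x \<longleftrightarrow> gact g b = b" if g: "g \<in> carrier G" for g
      using act[OF g] x pts inj_on_eq_iff[OF inj gact_in_B[OF b(1) g] b(1)] gact_post[OF BH[OF b(1)] m(2) g] b(2) by simp
    then have "stabilizer G (act A) x = {g \<in> carrier G. gact g b = b}"
      unfolding stabilizer_def by (intro Collect_cong conj_cong refl)
    then show ?thesis using stabilizer_open[OF b(1)] by simp
  qed
  have iso: "gset_isomorphic G (sub_gset A S) (B_set E \<Omega> V)"
  proof -
    \<comment> \<open>The inverse of \<open>post m\<close>, cut down to \<open>S\<close> because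
      maps of G-sets are extensional.\<close>
    define u where "u = restrict (inv_into (B V) (post m)) S"
    have up: "u (post m b) = b" if "b \<in> B V" for b
      using that inj by (auto simp: u_def Sm)
    have "bij_betw u S (B V)"
      by (rule bij_betw_byWitness[where f' = "post m"]) (auto simp: Sm up)
    moreover have "u (gact g x) = gact g (u x)" if g: "g \<in> carrier G" and x: "x \<in> S" for g x
    proof -
      obtain b where b: "b \<in> B V" "x = post m b" using x Sm by blast
      show ?thesis using gact_post[OF BH[OF b(1)] m(2) g] up gact_in_B[OF b(1) g] b by simp
    qed
    ultimately have "u \<in> gset_maps G (sub_gset A S) (B_set E \<Omega> V)"
      using act by (auto simp: gset_maps_def act_B u_def bij_betw_def)
    then show ?thesis
      unfolding gset_isomorphic_def using \<open>bij_betw u S (B V)\<close> by (intro bexI[of _ u]) simp_all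
  qed
  have "V \<in> Obj (principal_cat E)" using V principal_object_Obj by simp
  then have "C_object E \<Omega> A"
    unfolding C_object_def orbits using action stab iso by blast
  moreover have "transitive_action G (pts A) (act A)"
    using action trans pts by (simp add: transitive_action_def transitive_action_axioms_def)
  ultimately show ?thesis
    using Orb_nonempty[OF S] by (simp add: C_atom_def pts)
qed

abbreviation orb_gset :: "'o \<Rightarrow> ('i \<times> 'm) set set \<Rightarrow> ('i, 'm) pro_gset" where
  "orb_gset X S \<equiv> sub_gset (A1_set E \<Omega> X) S"

lemma act_orb_gset:
  assumes "S \<in> Orb X"
  shows "act (orb_gset X S) g = restrict (gact g) S"
  using Orb_subset[OF assms] by (auto simp: act_A1 restrict_restrict Int_absorb1)

lemma C_atom_orb_gset: "S \<in> Orb X \<Longrightarrow> C_atom E \<Omega> (orb_gset X S)"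
  using act_orb_gset by (intro C_atomI) auto

lemma C_atom_B_set: "principal_object E X \<Longrightarrow> C_atom E \<Omega> (B_set E \<Omega> X)"
  using B_in_Orb act_B by (intro C_atomI) auto

lemma restrict_post_gset_maps:
  assumes S: "S \<in> Orb Y" and f: "f \<in> homset E Y X" and T: "T \<in> Orb X" and "post f ` S = T"
  shows "restrict (post f) S \<in> gset_maps G (orb_gset Y S) (orb_gset X T)"
  using assms gact_post[OF subsetD[OF Orb_subset[OF S]] f] gact_in_Orb[OF S]
  unfolding gset_maps_def sub_gset_sel(1) act_orb_gset[OF S] act_orb_gset[OF T] by auto

end

section \<open>The Moebius function\<close>

text \<open>The defining recursion, with the term at \<open>y\<close> moved to the other
  side.\<close>

lemma moebius_sum_upper:
  assumes fin: "finite P" and po: "partial_order_on P r" and xy: "(x, y) \<in> r"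
  shows "(\<Sum>z | (x, z) \<in> r \<and> (z, y) \<in> r. moebius P r x z) =
    (if x = y then 1 else 0 :: 'k :: {comm_ring, comm_monoid_mult})"
proof -
  have sub: "r \<subseteq> P \<times> P" and rfl: "refl_on P r" and anti: "antisym r"
    using po by (auto simp: partial_order_on_def preorder_on_def)
  have yy: "(y, y) \<in> r" using rfl sub xy by (auto dest: refl_onD)
  show ?thesis
  proof (cases "x = y")
    case True
    then have "{z. (x, z) \<in> r \<and> (z, y) \<in> r} = {y}" using anti yy by (auto dest: antisymD)
    then show ?thesis using True fin po yy by (simp add: moebius.simps[of P r y y])
  next
    case False
    have "{z. (x, z) \<in> r \<and> (z, y) \<in> r} = insert y {z \<in> P. (x, z) \<in> r \<and> (z, y) \<in> r \<and> z \<noteq> y}"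
      using xy yy sub by auto
    then show ?thesis using False fin po xy by (simp add: moebius.simps[of P r x y])
  qed
qed

text \<open>A left inverse of the zeta function in the incidence algebra is also a right inverse.\<close>

lemma moebius_converse:
  assumes fin: "finite P" and po: "partial_order_on P r" and xy: "(x, y) \<in> r"
  shows "moebius P r x y = (moebius P (r\<inverse>) y x :: 'k :: {comm_ring, comm_monoid_mult})"
proof -
  let ?I = "{z. (x, z) \<in> r \<and> (z, y) \<in> r}"
  have sub: "r \<subseteq> P \<times> P" and rfl: "refl_on P r" and tr: "trans r"
    using po by (auto simp: partial_order_on_def preorder_on_def)
  have finI: "finite ?I" using sub by (intro finite_subset[OF _ fin]) auto
  have xx: "(x, x) \<in> r" and yy: "(y, y) \<in> r" using rfl sub xy by (auto dest: refl_onD)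
  have po': "partial_order_on P (r\<inverse>)" using po by simp
  have low: "(\<Sum>w\<in>{w \<in> ?I. (z, w) \<in> r}. moebius P (r\<inverse>) y w) = (if z = y then 1 else 0 :: 'k)"
    if z: "z \<in> ?I" for z
  proof -
    have "{w \<in> ?I. (z, w) \<in> r} = {w. (y, w) \<in> r\<inverse> \<and> (w, z) \<in> r\<inverse>}"
      using z tr by (auto dest: transD)
    then show ?thesis using moebius_sum_upper[OF fin po', of y z] z by auto
  qed
  have up: "(\<Sum>z\<in>{z \<in> ?I. (z, w) \<in> r}. moebius P r x z) = (if x = w then 1 else 0 :: 'k)"
    if w: "w \<in> ?I" for w
  proof -
    have "{z \<in> ?I. (z, w) \<in> r} = {z. (x, z) \<in> r \<and> (z, w) \<in> r}"
      using w tr by (auto dest: transD)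
    then show ?thesis using moebius_sum_upper[OF fin po, of x w] w by simp
  qed
  \<comment> \<open>The double sum over x \<le> z \<le> w \<le> y of the products of both functions
    is evaluated in two ways: summing over \<open>w\<close> first leaves only z = y, summing over
    \<open>z\<close> first leaves only w = x.\<close>
  have "moebius P r x y = (\<Sum>z\<in>?I. moebius P r x z * (if z = y then 1 else 0 :: 'k))"
    using finI xy yy by (simp add: if_distrib[of "(*) _"] sum.delta cong: if_cong)
  also have "\<dots> = (\<Sum>z\<in>?I. moebius P r x z * (\<Sum>w\<in>{w \<in> ?I. (z, w) \<in> r}. moebius P (r\<inverse>) y w))"
    by (rule sum.cong[OF refl]) (simp only: low)
  also have "\<dots> = (\<Sum>z\<in>?I. \<Sum>w\<in>{w \<in> ?I. (z, w) \<in> r}. moebius P r x z * moebius P (r\<inverse>) y w)"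
    by (simp add: sum_distrib_left)
  also have "\<dots> = (\<Sum>w\<in>?I. \<Sum>z\<in>{z \<in> ?I. (z, w) \<in> r}. moebius P r x z * moebius P (r\<inverse>) y w)"
    by (rule sum.swap_restrict[OF finI finI])
  also have "\<dots> = (\<Sum>w\<in>?I. (\<Sum>z\<in>{z \<in> ?I. (z, w) \<in> r}. moebius P r x z) * moebius P (r\<inverse>) y w)"
    by (simp add: sum_distrib_right)
  also have "\<dots> = (\<Sum>w\<in>?I. (if x = w then 1 else 0) * moebius P (r\<inverse>) y w)"
    by (rule sum.cong[OF refl]) (simp only: up)
  also have "\<dots> = moebius P (r\<inverse>) y x"
    using finI xy xx by (simp add: if_distrib[of "\<lambda>a. a * _"] sum.delta' cong: if_cong)
  finally show ?thesis .
qed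

text \<open>The recursion moves the upper argument, whereas inversion towards the top element of
  Sub(Y) sums over the lower one. Passing to the opposite order exchanges them.\<close>

lemma moebius_sum_lower:
  assumes fin: "finite P" and po: "partial_order_on P r" and xy: "(x, y) \<in> r"
  shows "(\<Sum>z | (x, z) \<in> r \<and> (z, y) \<in> r. moebius P r z y) =
    (if x = y then 1 else 0 :: 'k :: {comm_ring, comm_monoid_mult})"
proof -
  have "(\<Sum>z | (x, z) \<in> r \<and> (z, y) \<in> r. moebius P r z y :: 'k) =
      (\<Sum>z | (y, z) \<in> r\<inverse> \<and> (z, x) \<in> r\<inverse>. moebius P (r\<inverse>) y z)"
    by (rule sum.cong) (auto simp: moebius_converse[OF fin po])
  also have "\<dots> = (if x = y then 1 else 0)"
    using moebius_sum_upper[OF fin, of "r\<inverse>" y x] po xy by auto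
  finally show ?thesis .
qed

section \<open>Subobjects\<close>

text \<open>The representative that \<open>restrict_sub\<close> chooses.\<close>

abbreviation sub_rep :: "'m set \<Rightarrow> 'm" where
  "sub_rep Z \<equiv> SOME n. n \<in> Z"

context category
begin

lemma factors_throughI: "\<lbrakk>h \<in> homset C V W; m \<in> homset C V X; n \<in> homset C W X; n \<odot> h = m\<rbrakk>
    \<Longrightarrow> factors_through C m n"
  by (auto simp: factors_through_def homset_iff)

lemma factors_throughE:
  assumes "factors_through C m n" "m \<in> homset C V X" "n \<in> homset C W Y"
  obtains h where "h \<in> homset C V W" "n \<odot> h = m"
  using assms(1) homsetD(2)[OF assms(2)] homsetD(2)[OF assms(3)] by (auto simp: factors_through_def)

lemma factors_through_refl:
  assumes m: "m \<in> homset C V X" shows "factors_through C m m"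
  using factors_throughI[OF Ide_in[OF Obj_homset(1)[OF m]] m m Cmp_Ide[OF m]] .

lemma factors_through_trans:
  assumes "factors_through C m n" "factors_through C n k"
    and m: "m \<in> homset C U X" and n: "n \<in> homset C V X" and k: "k \<in> homset C W X"
  shows "factors_through C m k"
proof -
  obtain h where h: "h \<in> homset C U V" "n \<odot> h = m" using factors_throughE[OF assms(1) m n] by blast
  obtain l where l: "l \<in> homset C V W" "k \<odot> l = n" using factors_throughE[OF assms(2) n k] by blast
  show ?thesis
    using factors_throughI[OF Cmp_in[OF h(1) l(1)] m k] Cmp_assoc[OF h(1) l(1) k] h l by simp
qed

lemma mutual_factors_is_iso:
  assumes "injection C m" and m: "m \<in> homset C V X" and "injection C n" and n: "n \<in> homset C W X"
    and "factors_through C m n" "factors_through C n m"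
  obtains u where "is_iso C u" "u \<in> homset C V W" "n \<odot> u = m"
proof -
  obtain u where u: "u \<in> homset C V W" "n \<odot> u = m" using factors_throughE[OF assms(5) m n] by blast
  obtain v where v: "v \<in> homset C W V" "m \<odot> v = n" using factors_throughE[OF assms(6) n m] by blast
  have "v \<odot> u = Ide C V"
    using injection_cancel[OF assms(1) m Cmp_in[OF u(1) v(1)] Ide_in[OF Obj_homset(1)[OF m]]]
      Cmp_assoc[OF u(1) v(1) m] u(2) v(2) Cmp_Ide[OF m] by simp
  moreover have "u \<odot> v = Ide C W"
    using injection_cancel[OF assms(3) n Cmp_in[OF v(1) u(1)] Ide_in[OF Obj_homset(1)[OF n]]]
      Cmp_assoc[OF v(1) u(1) n] u(2) v(2) Cmp_Ide[OF n] by simp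
  ultimately show thesis using that[OF is_isoI[OF u(1) v(1)] u] by simp
qed

lemma mem_subobject_class:
  assumes "m \<in> homset C V X"
  shows "n \<in> subobject_class C m \<longleftrightarrow> injection C n \<and> n \<in> homset C (Dom C n) X \<and>
    factors_through C m n \<and> factors_through C n m"
  using homsetD(3)[OF assms] by (auto simp: subobject_class_def homset_iff injection_Arr)

lemma subobject_class_in_Sub:
  "\<lbrakk>injection C m; m \<in> homset C V X\<rbrakk> \<Longrightarrow> subobject_class C m \<in> Sub C X"
  unfolding Sub_def using homsetD(3)[of m C V X] by blast

lemma Sub_mem:
  assumes "Z \<in> Sub C X" "n \<in> Z"
  shows "injection C n" "n \<in> homset C (Dom C n) X" "Z = subobject_class C n"
proof -
  obtain m where Z: "Z = subobject_class C m" and m: "m \<in> homset C (Dom C m) X"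
    using assms(1) unfolding Sub_def by (auto simp: homset_iff injection_Arr)
  then have n: "injection C n" "n \<in> homset C (Dom C n) X"
    and mn: "factors_through C m n" "factors_through C n m"
    using assms(2) by (simp_all add: mem_subobject_class[OF m])
  show "injection C n" "n \<in> homset C (Dom C n) X" by fact+
  have "k \<in> subobject_class C m \<longleftrightarrow> k \<in> subobject_class C n" for k
    unfolding mem_subobject_class[OF m] mem_subobject_class[OF n(2)]
    using factors_through_trans[OF mn(1) _ m n(2), of k] factors_through_trans[OF _ mn(2) _ n(2) m, of k]
      factors_through_trans[OF mn(2) _ n(2) m, of k] factors_through_trans[OF _ mn(1) _ m n(2), of k]
    by blast
  then show "Z = subobject_class C n" using Z by blast
qed

lemma sub_rep_in:
  assumes "Z \<in> Sub C X" shows "sub_rep Z \<in> Z"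
proof -
  obtain m where "Z = subobject_class C m" and m: "injection C m" "m \<in> homset C (Dom C m) X"
    using assms unfolding Sub_def by (auto simp: homset_iff injection_Arr)
  then have "m \<in> Z" using factors_through_refl by (simp add: mem_subobject_class[OF m(2)])
  then show ?thesis by (rule someI)
qed

lemmas sub_rep = Sub_mem[OF _ sub_rep_in]

text \<open>\<open>Sub_order\<close> asks for some pair of representatives; those of one class
  factor through each other, so every pair serves.\<close>

lemma Sub_order_iff:
  assumes Z: "Z \<in> Sub C X" and W: "W \<in> Sub C X" and m: "m \<in> Z" and n: "n \<in> W"
  shows "(Z, W) \<in> Sub_order C X \<longleftrightarrow> factors_through C m n"
proof
  assume "factors_through C m n"
  then show "(Z, W) \<in> Sub_order C X" using assms by (auto simp: Sub_order_def)
next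
  assume "(Z, W) \<in> Sub_order C X"
  then obtain m' n' where m': "m' \<in> Z" and n': "n' \<in> W" and f: "factors_through C m' n'"
    by (auto simp: Sub_order_def)
  have "factors_through C m m'"
    using m m' Sub_mem(3)[OF Z m'] mem_subobject_class[OF Sub_mem(2)[OF Z m']] by blast
  moreover have "factors_through C n' n"
    using n n' Sub_mem(3)[OF W n'] mem_subobject_class[OF Sub_mem(2)[OF W n']] by blast
  ultimately show "factors_through C m n"
    using factors_through_trans f Sub_mem(2)[OF Z m] Sub_mem(2)[OF Z m'] Sub_mem(2)[OF W n] Sub_mem(2)[OF W n']
    by blast
qed

lemma partial_order_Sub: "partial_order_on (Sub C X) (Sub_order C X)"
  unfolding partial_order_on_def preorder_on_def
proof (intro conjI)
  show "Sub_order C X \<subseteq> Sub C X \<times> Sub C X" by (auto simp: Sub_order_def)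
  show "refl_on (Sub C X) (Sub_order C X)"
  proof (rule refl_onI)
    fix Z assume Z: "Z \<in> Sub C X"
    show "(Z, Z) \<in> Sub_order C X"
      using Sub_order_iff[OF Z Z sub_rep_in[OF Z] sub_rep_in[OF Z]]
        factors_through_refl[OF sub_rep(2)[OF Z Z]] by simp
  qed
  show "trans (Sub_order C X)"
  proof (rule transI)
    fix U V W assume UV: "(U, V) \<in> Sub_order C X" and VW: "(V, W) \<in> Sub_order C X"
    then have S: "U \<in> Sub C X" "V \<in> Sub C X" "W \<in> Sub C X" by (auto simp: Sub_order_def)
    note R = this[THEN sub_rep_in] and H = sub_rep(2)[OF S(1) S(1)] sub_rep(2)[OF S(2) S(2)]
      sub_rep(2)[OF S(3) S(3)]
    show "(U, W) \<in> Sub_order C X"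
      using UV VW factors_through_trans[OF _ _ H]
      by (simp add: Sub_order_iff[OF S(1,2) R(1,2)] Sub_order_iff[OF S(2,3) R(2,3)]
        Sub_order_iff[OF S(1,3) R(1,3)])
  qed
  show "antisym (Sub_order C X)"
  proof (rule antisymI)
    fix U V assume UV: "(U, V) \<in> Sub_order C X" and VU: "(V, U) \<in> Sub_order C X"
    then have S: "U \<in> Sub C X" "V \<in> Sub C X" by (auto simp: Sub_order_def)
    note R = this[THEN sub_rep_in] and H = sub_rep(2)[OF S(1) S(1)] sub_rep(2)[OF S(2) S(2)]
    have "factors_through C (sub_rep U) (sub_rep V)" "factors_through C (sub_rep V) (sub_rep U)"
      using UV VU by (simp_all add: Sub_order_iff[OF S(1,2) R(1,2)] Sub_order_iff[OF S(2,1) R(2,1)])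
    then have "sub_rep V \<in> subobject_class C (sub_rep U)"
      unfolding mem_subobject_class[OF H(1)] using Sub_mem(1)[OF S(2) R(2)] H(2) by blast
    then have "sub_rep V \<in> U" by (rule subsetD[OF equalityD2[OF Sub_mem(3)[OF S(1) R(1)]]])
    then show "U = V"
      by (rule trans[OF Sub_mem(3)[OF S(1)] Sub_mem(3)[OF S(2) R(2), symmetric]])
  qed
qed

lemma whole_in_Sub: "X \<in> Obj C \<Longrightarrow> whole C X \<in> Sub C X"
  unfolding whole_def by (rule subobject_class_in_Sub[OF is_iso_injection[OF is_iso_Ide] Ide_in])

text \<open>A monomorphism through which the identity factors has a section and is therefore
  invertible.\<close>

lemma mem_whole:
  assumes X: "X \<in> Obj C"
  shows "n \<in> whole C X \<longleftrightarrow> is_iso C n \<and> n \<in> homset C (Dom C n) X"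
proof
  assume "n \<in> whole C X"
  then have n: "injection C n" "n \<in> homset C (Dom C n) X" "factors_through C (Ide C X) n"
    unfolding whole_def by (simp_all add: mem_subobject_class[OF Ide_in[OF X]])
  obtain l where "l \<in> homset C X (Dom C n)" "n \<odot> l = Ide C X"
    using factors_throughE[OF n(3) Ide_in[OF X] n(2)] by blast
  then show "is_iso C n \<and> n \<in> homset C (Dom C n) X"
    using split_injection_is_iso[OF n(1,2)] n(2) by blast
next
  assume n: "is_iso C n \<and> n \<in> homset C (Dom C n) X"
  then obtain l where "l \<in> homset C X (Dom C n)" "n \<odot> l = Ide C X"
    using is_isoE by blast
  then have "factors_through C (Ide C X) n" using factors_throughI Ide_in[OF X] n by blast
  moreover have "factors_through C n (Ide C X)"
    using factors_throughI[OF _ _ Ide_in[OF X] Ide_Cmp] n by blast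
  ultimately show "n \<in> whole C X"
    unfolding whole_def using is_iso_injection n by (simp add: mem_subobject_class[OF Ide_in[OF X]])
qed

lemma Sub_order_whole:
  assumes Z: "Z \<in> Sub C X" and X: "X \<in> Obj C" shows "(Z, whole C X) \<in> Sub_order C X"
proof -
  have "Ide C X \<in> whole C X" using mem_whole[OF X] is_iso_Ide[OF X] Ide_in[OF X] homsetD(2) by metis
  moreover have "factors_through C (sub_rep Z) (Ide C X)"
    using factors_throughI[OF sub_rep(2)[OF Z Z] sub_rep(2)[OF Z Z] Ide_in[OF X] Ide_Cmp[OF sub_rep(2)[OF Z Z]]] .
  ultimately show ?thesis
    using Sub_order_iff[OF Z whole_in_Sub[OF X] sub_rep_in[OF Z]] by blast
qed

end

text \<open>It turns the condition f(Z) = X on classes into one on the chosen representative. The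
  choice does not matter, as two representatives differ by an isomorphism of their sources.\<close>

lemma (in regular) image_sub_eq_whole_iff:
  assumes f: "f \<in> homset C Y X" and Z: "Z \<in> Sub C Y"
  shows "image_sub C f Z = whole C X \<longleftrightarrow> surjection C (f \<odot> sub_rep Z)"
proof -
  let ?n = "sub_rep Z"
  have n: "?n \<in> Z" "?n \<in> homset C (Dom C ?n) Y" using sub_rep_in[OF Z] sub_rep(2)[OF Z Z] by auto
  have fn: "f \<odot> ?n \<in> homset C (Dom C ?n) X" using n(2) f by (rule Cmp_in)
  have X: "X \<in> Obj C" using f by (rule Obj_homset)
  have surj: "surjection C (f \<odot> ?n) \<longleftrightarrow> surjection C (f \<odot> k)" if k: "k \<in> Z" for k
  proof -
    note kD = Sub_mem[OF Z k] and nD = Sub_mem[OF Z n(1)]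
    have "k \<in> subobject_class C ?n" by (rule subsetD[OF equalityD1[OF nD(3)] k])
    then have "factors_through C ?n k" "factors_through C k ?n"
      by (simp_all only: mem_subobject_class[OF nD(2)])
    obtain u where u: "is_iso C u" "u \<in> homset C (Dom C ?n) (Dom C k)" "k \<odot> u = ?n"
      using mutual_factors_is_iso[OF nD(1,2) kD(1,2)] \<open>factors_through C ?n k\<close> \<open>factors_through C k ?n\<close>
      by blast
    have eq: "(f \<odot> k) \<odot> u = f \<odot> ?n" using Cmp_assoc[OF u(2) kD(2) f] u(3) by simp
    show ?thesis
      using surjection_left[OF _ u(2) Cmp_in[OF kD(2) f]]
        surjection_Cmp[OF is_iso_surjection[OF u(1)] _ u(2) Cmp_in[OF kD(2) f]] eq by auto
  qed
  show ?thesis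
  proof
    assume "image_sub C f Z = whole C X"
    moreover have I: "Ide C X \<in> whole C X"
      using mem_whole[OF X] is_iso_Ide[OF X] Ide_in[OF X] homsetD(2) by metis
    ultimately have "Ide C X \<in> image_sub C f Z" by simp
    then obtain k e where k: "k \<in> Z" and e: "surjection C e" "Cod C e = X" "Ide C X \<odot> e = f \<odot> k"
      using homsetD(2)[OF Ide_in[OF X]] by (auto simp: image_sub_def)
    have "e \<in> homset C (Dom C e) X" using e by (simp add: homset_iff surjection_Arr)
    then have "surjection C (f \<odot> k)" using e Ide_Cmp by metis
    then show "surjection C (f \<odot> ?n)" using surj[OF k] by simp
  next
    assume sf: "surjection C (f \<odot> ?n)"
    show "image_sub C f Z = whole C X"
    proof (intro equalityI subsetI)
      fix m assume "m \<in> image_sub C f Z"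
      then obtain k e where m: "injection C m" and k: "k \<in> Z" and e: "surjection C e" "Cod C e = Dom C m"
        and eq: "m \<odot> e = f \<odot> k"
        by (auto simp: image_sub_def)
      note kD = Sub_mem[OF Z k]
      have eh: "e \<in> homset C (Dom C e) (Dom C m)" using e by (simp add: homset_iff surjection_Arr)
      have mh: "m \<in> homset C (Dom C m) (Cod C m)" using m by (simp add: homset_iff injection_Arr)
      have fk: "f \<odot> k \<in> homset C (Dom C k) X" using kD(2) f by (rule Cmp_in)
      have "Cod C m = X" "Dom C e = Dom C k"
        using Cmp_in[OF eh mh] fk unfolding eq by (simp_all add: homset_iff)
      then have "is_iso C m"
        using surjection_injection_is_iso[of "f \<odot> k" "Dom C k" X m "Dom C m" e] sf surj[OF k] fk m mh eh eq
        by simp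
      then show "m \<in> whole C X" using mem_whole[OF X] mh \<open>Cod C m = X\<close> by simp
    next
      \<comment> \<open>Every isomorphism onto \<open>X\<close> occurs as injective part: its
        inverse is absorbed into the surjection.\<close>
      fix m assume "m \<in> whole C X"
      then have m: "is_iso C m" "m \<in> homset C (Dom C m) X" using mem_whole[OF X] by auto
      obtain l where l: "l \<in> homset C X (Dom C m)" "l \<odot> m = Ide C (Dom C m)" "m \<odot> l = Ide C X"
        using is_isoE[OF m] by blast
      have "is_iso C l" using is_isoI[OF l(1) m(2) l(3,2)] .
      then have "surjection C (l \<odot> (f \<odot> ?n))"
        using surjection_Cmp[OF sf is_iso_surjection fn l(1)] by blast
      moreover have "Cod C (l \<odot> (f \<odot> ?n)) = Dom C m" using Cmp_in[OF fn l(1)] by (rule homsetD)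
      moreover have "m \<odot> (l \<odot> (f \<odot> ?n)) = f \<odot> ?n"
        using Cmp_assoc[OF fn l(1) m(2)] l(3) Ide_Cmp[OF fn] by simp
      ultimately show "m \<in> image_sub C f Z"
        using is_iso_injection[OF m(1)] n(1) by (auto simp: image_sub_def)
    qed
  qed
qed

section \<open>Orbits of A_1(X) and subobjects of X\<close>

context homogeneous_pro_object
begin

text \<open>A single point of the orbit decides the order of subobjects: the representative
  \<open>h\<close> of \<open>b\<close> is surjective, so the square against the monomorphism
  \<open>n\<close> has a diagonal, through which \<open>m\<close> factors.\<close>

lemma post_mem_image_iff:
  assumes n: "injection E n" "n \<in> homset E W X" and m: "m \<in> homset E V X" and b: "b \<in> B V"
  shows "post m b \<in> post n ` H W \<longleftrightarrow> factors_through E m n"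
proof
  note bH = subsetD[OF B_subset b]
  assume "post m b \<in> post n ` H W"
  then obtain c where c: "c \<in> H W" "post m b = post n c" by blast
  obtain k h g where k: "k \<in> Idx \<Omega>" and h: "h \<in> homset E (Ob \<Omega> k) V" and g: "g \<in> homset E (Ob \<Omega> k) W"
    and bh: "b = germ E \<Omega> k h" and cg: "c = germ E \<Omega> k g"
    using common_index[OF bH c(1)] by blast
  have "surjection E h" using b bh germ_in_B_iff[OF k h] by simp
  moreover have "n \<odot> g = m \<odot> h"
    using c(2) germ_inject[OF k Cmp_in[OF h m] Cmp_in[OF g n(2)]]
    by (simp add: bh cg postcomp_germ[OF k h m] postcomp_germ[OF k g n(2)])
  ultimately obtain l where "l \<in> homset E V W" "n \<odot> l = m"
    using diagonal_fill[OF _ h n g m] by blast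
  then show "factors_through E m n" using factors_throughI m n(2) by blast
next
  assume "factors_through E m n"
  then obtain l where l: "l \<in> homset E V W" "n \<odot> l = m" using factors_throughE m n(2) by blast
  then show "post m b \<in> post n ` H W"
    using postcomp_Cmp[OF subsetD[OF B_subset b] l(1) n(2)] postcomp_in[OF subsetD[OF B_subset b] l(1)]
    by auto
qed

text \<open>An orbit if the source of the representative is principal, and empty otherwise.\<close>

definition sub_orbit :: "'m set \<Rightarrow> ('i \<times> 'm) set set" where
  "sub_orbit Z = post (sub_rep Z) ` B (Dom E (sub_rep Z))"

lemma Orb_sub_orbit:
  assumes S: "S \<in> Orb X"
  obtains Z where "Z \<in> Sub E X" "S = sub_orbit Z" "principal_object E (Dom E (sub_rep Z))"
proof -
  obtain m V where m: "injection E m" "m \<in> homset E V X" and V: "principal_object E V"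
    and Sm: "S = post m ` B V"
    using OrbE[OF S] by blast
  define Z where "Z = subobject_class E m"
  define n where "n = sub_rep Z"
  have Z: "Z \<in> Sub E X" using subobject_class_in_Sub[OF m] by (simp add: Z_def)
  have n: "injection E n" "n \<in> homset E (Dom E n) X" "n \<in> Z"
    using sub_rep[OF Z Z] sub_rep_in[OF Z] by (simp_all add: n_def)
  then have "factors_through E m n" "factors_through E n m"
    by (simp_all add: Z_def mem_subobject_class[OF m(2)])
  then obtain u where u: "is_iso E u" "u \<in> homset E V (Dom E n)" "n \<odot> u = m"
    using mutual_factors_is_iso[OF m n(1,2)] by blast
  have N: "principal_object E (Dom E n)" by (rule principal_object_Cod[OF V u(2)])
  obtain b where b: "b \<in> B V" using B_nonempty[OF V] by blast
  have ub: "post u b \<in> B (Dom E n)" "post n (post u b) = post m b"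
    using post_in_B[OF b u(2) is_iso_surjection[OF u(1)]]
      postcomp_Cmp[OF subsetD[OF B_subset b] u(2) n(2)] u(3) by simp_all
  have "post m b \<in> post n ` B (Dom E n)" using ub(1) by (simp flip: ub(2))
  then have "S = post n ` B (Dom E n)"
    by (intro Orb_eq[OF S OrbI[OF n(1,2) N], of "post m b"]) (simp_all add: Sm b)
  then show thesis using that[OF Z] N by (simp add: sub_orbit_def n_def)
qed

lemma finite_Orb:
  assumes X: "X \<in> Obj E" shows "finite (Orb X)"
proof (rule finite_subset)
  show "Orb X \<subseteq> sub_orbit ` Sub E X" using Orb_sub_orbit by blast
  show "finite (sub_orbit ` Sub E X)" using powered X by (simp add: finitely_powered_def)
qed

end

section \<open>Measures\<close>

locale measured_pro_object = homogeneous_pro_object E \<Omega>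
  for E :: "('o, 'm) category" (structure) and \<Omega> :: "('i, 'o, 'm) pro_object" +
  fixes \<mu> :: "('i, 'm) pro_gset \<Rightarrow> ('i, 'm) pro_gset \<Rightarrow> (('i \<times> 'm) set \<Rightarrow> ('i \<times> 'm) set)
    \<Rightarrow> 'k :: {comm_ring, comm_monoid_mult}"
  assumes measure: "is_C_measure E \<Omega> \<mu>"
begin

lemma measure_bij:
  "\<lbrakk>C_atom E \<Omega> A; C_atom E \<Omega> A'; f \<in> gset_maps G A A'; bij_betw f (pts A) (pts A')\<rbrakk>
    \<Longrightarrow> \<mu> A A' f = 1"
  using measure unfolding is_C_measure_def by blast

lemma measure_compose:
  "\<lbrakk>C_atom E \<Omega> A; C_atom E \<Omega> A'; C_atom E \<Omega> A''; f \<in> gset_maps G A A'; g \<in> gset_maps G A' A''\<rbrakk>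
    \<Longrightarrow> \<mu> A A'' (compose (pts A) g f) = \<mu> A' A'' g * \<mu> A A' f"
  using measure unfolding is_C_measure_def by blast

lemma measure_base_change:
  fixes I :: "nat set"
  assumes "C_atom E \<Omega> Y" "C_atom E \<Omega> X" "C_atom E \<Omega> X'"
    and "f \<in> gset_maps G Y X" "h \<in> gset_maps G X' X" "finite I"
    and "\<And>i. i \<in> I \<Longrightarrow> C_atom E \<Omega> (Y' i)"
    and "\<And>i. i \<in> I \<Longrightarrow> p i \<in> gset_maps G (Y' i) Y"
    and "\<And>i. i \<in> I \<Longrightarrow> f' i \<in> gset_maps G (Y' i) X'"
    and "bij_betw (\<lambda>(i, z). (p i z, f' i z)) (SIGMA i:I. pts (Y' i))
          {(y, x') \<in> pts Y \<times> pts X'. f y = h x'}"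
  shows "\<mu> Y X f = (\<Sum>i\<in>I. \<mu> (Y' i) X' (f' i))"
proof -
  note third = measure[unfolded is_C_measure_def, THEN conjunct2, THEN conjunct2, rule_format]
  show ?thesis by (rule third[of Y X X' f h I Y' p f']) (use assms in simp)
qed

text \<open>The two ways around the square have the same value, and the bijections in it have value
  1. So isomorphic records may be exchanged.\<close>

lemma measure_iso:
  assumes A: "C_atom E \<Omega> A" and A': "C_atom E \<Omega> A'" and D: "C_atom E \<Omega> D" and D': "C_atom E \<Omega> D'"
    and u: "u \<in> gset_maps G A A'" "bij_betw u (pts A) (pts A')"
    and v: "v \<in> gset_maps G D D'" "bij_betw v (pts D) (pts D')"
    and f: "f \<in> gset_maps G A D" and f': "f' \<in> gset_maps G A' D'"
    and comm: "\<And>x. x \<in> pts A \<Longrightarrow> f' (u x) = v (f x)"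
  shows "\<mu> A D f = \<mu> A' D' f'"
proof -
  have "compose (pts A) f' u = compose (pts A) v f"
    unfolding compose_def using comm by (rule restrict_ext)
  then have "\<mu> A' D' f' * \<mu> A A' u = \<mu> D D' v * \<mu> A D f"
    using measure_compose[OF A A' D' u(1) f'] measure_compose[OF A D D' f v(1)] by simp
  then show ?thesis
    using measure_bij[OF A A' u] measure_bij[OF D D' v] by simp
qed

definition orb_measure :: "'o \<Rightarrow> 'o \<Rightarrow> 'm \<Rightarrow> ('i \<times> 'm) set set \<Rightarrow> ('i \<times> 'm) set set \<Rightarrow> 'k" where
  "orb_measure Y X f S T = \<mu> (orb_gset Y S) (orb_gset X T) (restrict (post f) S)"

text \<open>The M(f, T) of the overview: an orbit of A_1(Y) lies over \<open>T\<close> exactly when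
  its image is \<open>T\<close>.\<close>

definition fibre_measure :: "'o \<Rightarrow> 'o \<Rightarrow> 'm \<Rightarrow> ('i \<times> 'm) set set \<Rightarrow> 'k" where
  "fibre_measure Y X f T = (\<Sum>S | S \<in> Orb Y \<and> post f ` S = T. orb_measure Y X f S T)"

definition deg :: "'m \<Rightarrow> 'k" where
  "deg f = fibre_measure (Dom E f) (Cod E f) f (B (Cod E f))"

lemma deg_eq: "f \<in> homset E Y X \<Longrightarrow> deg f = fibre_measure Y X f (B X)"
  by (simp add: deg_def homsetD)

lemma postcomp_pullback_unique:
  assumes pb: "pullback E f g p q" and f: "f \<in> homset E Y X" and g: "g \<in> homset E X' X"
    and z: "z \<in> H (Dom E p)" "w \<in> H (Dom E p)" and eq: "post p z = post p w" "post q z = post q w"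
  shows "z = w"
proof -
  note pq = pullbackD(1,2)[OF pb f g]
  have "post f (post p z) = post g (post q z)"
    using postcomp_Cmp[OF z(1) pq(1) f] postcomp_Cmp[OF z(1) pq(2) g] pullbackD(3)[OF pb f g] by simp
  note ex1 = postcomp_pullback[OF pb f g postcomp_in[OF z(1) pq(1)] postcomp_in[OF z(1) pq(2)] this]
  show ?thesis
    by (rule trans[OF the1_equality[OF ex1, symmetric] the1_equality[OF ex1]])
      (simp_all add: z eq)
qed

lemma post_image_Cmp:
  assumes S: "S \<in> Orb Y" and f: "f \<in> homset E Y X" and g: "g \<in> homset E X W"
  shows "post (g \<odot> f) ` S = post g ` post f ` S"
proof -
  have "post (g \<odot> f) x = post g (post f x)" if "x \<in> S" for x
    by (rule postcomp_Cmp[OF subsetD[OF Orb_subset[OF S] that] f g])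
  then show ?thesis by (auto simp: image_iff)
qed

lemma orb_measure_Cmp:
  assumes S: "S \<in> Orb Y" and f: "f \<in> homset E Y X" and g: "g \<in> homset E X W"
    and T: "post f ` S = T" and U: "post g ` T = U"
  shows "orb_measure Y W (g \<odot> f) S U = orb_measure X W g T U * orb_measure Y X f S T"
proof -
  have TO: "T \<in> Orb X" using Orb_image[OF S f] T by simp
  have UO: "U \<in> Orb W" using Orb_image[OF TO g] U by simp
  have "post (g \<odot> f) x = post g (post f x)" if "x \<in> S" for x
    by (rule postcomp_Cmp[OF subsetD[OF Orb_subset[OF S] that] f g])
  then have "compose (pts (orb_gset Y S)) (restrict (post g) T) (restrict (post f) S) =
      restrict (post (g \<odot> f)) S"
    unfolding compose_def sub_gset_sel(1) using T by (intro restrict_ext) auto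
  then show ?thesis
    unfolding orb_measure_def
    using measure_compose[OF C_atom_orb_gset[OF S] C_atom_orb_gset[OF TO] C_atom_orb_gset[OF UO]
        restrict_post_gset_maps[OF S f TO T] restrict_post_gset_maps[OF TO g UO U]] by simp
qed

lemma orb_measure_injection:
  assumes S: "S \<in> Orb Y" and f: "f \<in> homset E Y X" "injection E f"
  shows "orb_measure Y X f S (post f ` S) = 1"
  unfolding orb_measure_def
proof (rule measure_bij)
  have "inj_on (post f) S"
    using inj_on_postcomp[OF f(2,1)] Orb_subset[OF S] by (rule inj_on_subset)
  then show "bij_betw (restrict (post f) S) (pts (orb_gset Y S)) (pts (orb_gset X (post f ` S)))"
    by (simp add: bij_betw_def inj_on_def)
qed (rule C_atom_orb_gset restrict_post_gset_maps S Orb_image f refl)+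

lemma post_image_B:
  assumes f: "f \<in> homset E Y X" "surjection E f" and Y: "principal_object E Y"
  shows "post f ` B Y = B X"
proof -
  obtain b where b: "b \<in> B Y" using B_nonempty[OF Y] by blast
  show ?thesis
    using Orb_image_eq[OF B_in_Orb[OF Y] f(1) B_in_Orb[OF principal_object_Cod[OF Y f(1)]] b
        post_in_B[OF b f]] .
qed

text \<open>On the left the actions are computed in \<open>principal_cat E\<close>, on the right in
  \<open>E\<close>. The records need not be equal, but the identity maps are isomorphisms between
  them.\<close>

lemma measure_B_map:
  assumes f: "f \<in> homset E Y X" "surjection E f" and Y: "principal_object E Y"
  shows "\<mu> (B_set E \<Omega> Y) (B_set E \<Omega> X) (B_map E \<Omega> f) = orb_measure Y X f (B Y) (B X)"
proof -
  have X: "principal_object E X" using Y f(1) by (rule principal_object_Cod)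
  have map: "B_map E \<Omega> f = restrict (post f) (B Y)"
    using post_principal_cat[OF _ f] homsetD[OF f(1)] by (auto simp: B_map_def intro!: restrict_ext)
  have id: "restrict id (B Z) \<in> gset_maps G (B_set E \<Omega> Z) (orb_gset Z (B Z))"
    "bij_betw (restrict id (B Z)) (pts (B_set E \<Omega> Z)) (pts (orb_gset Z (B Z)))"
    if Z: "principal_object E Z" for Z
    using gact_in_B
    by (auto simp: gset_maps_def act_B act_orb_gset[OF B_in_Orb[OF Z]] bij_betw_def inj_on_def
      simp del: sub_gset_sel(2))
  have "restrict (post f) (B Y) \<in> gset_maps G (B_set E \<Omega> Y) (B_set E \<Omega> X)"
    using post_in_B[OF _ f] gact_post[OF subsetD[OF B_subset] f(1)] gact_in_B
    by (auto simp: gset_maps_def act_B)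
  then show ?thesis
    unfolding orb_measure_def map
    by (intro measure_iso[OF C_atom_B_set[OF Y] C_atom_orb_gset[OF B_in_Orb[OF Y]] C_atom_B_set[OF X]
          C_atom_orb_gset[OF B_in_Orb[OF X]] id[OF Y] id[OF X]]
        restrict_post_gset_maps[OF B_in_Orb[OF Y] f(1) B_in_Orb[OF X] post_image_B[OF f Y]])
      (use post_in_B[OF _ f] in auto)
qed

text \<open>An orbit that meets the preimage of \<open>T\<close> is mapped onto \<open>T\<close>,
  hence lies in the preimage. So the orbits of the preimage are the index set of
  \<open>fibre_measure\<close>.\<close>

lemma measure_ext_A1:
  assumes f: "f \<in> homset E Y X" and T: "T \<in> Orb X"
  shows "measure_ext G \<mu> (sub_gset (A1_set E \<Omega> Y) {x \<in> pts (A1_set E \<Omega> Y). A1_map E \<Omega> f x \<in> T})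
      (sub_gset (A1_set E \<Omega> X) T) (restrict (A1_map E \<Omega> f) {x \<in> pts (A1_set E \<Omega> Y). A1_map E \<Omega> f x \<in> T})
    = fibre_measure Y X f T"
proof -
  have map: "A1_map E \<Omega> f = restrict (post f) (H Y)"
    using homsetD[OF f] by (simp add: A1_map_def)
  define U where "U = {x \<in> H Y. post f x \<in> T}"
  have U: "{x \<in> pts (A1_set E \<Omega> Y). A1_map E \<Omega> f x \<in> T} = U"
    by (auto simp: U_def map)
  have orb: "orbit G (act (sub_gset (A1_set E \<Omega> Y) U)) x = {gact g x | g. g \<in> carrier G}" if x: "x \<in> U" for x
  proof -
    have "act (sub_gset (A1_set E \<Omega> Y) U) g x = gact g x" for g
      using x by (simp add: act_A1 U_def)
    then show ?thesis by (simp add: orbit_def)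
  qed
  have orbits: "gset_orbits G (sub_gset (A1_set E \<Omega> Y) U) = {S. S \<in> Orb Y \<and> post f ` S = T}"
  proof (intro equalityI subsetI)
    fix S assume "S \<in> gset_orbits G (sub_gset (A1_set E \<Omega> Y) U)"
    then obtain x where x: "x \<in> U" and Sx: "S = {gact g x | g. g \<in> carrier G}"
      using orb by (auto simp: orbits_def)
    have xH: "x \<in> H Y" "post f x \<in> T" using x by (auto simp: U_def)
    obtain S' where S': "S' \<in> Orb Y" "x \<in> S'" using Orb_cover[OF xH(1)] by blast
    have "S = S'" by (rule trans[OF Sx Orb_orbit[OF S', symmetric]])
    then show "S \<in> {S. S \<in> Orb Y \<and> post f ` S = T}"
      using S' Orb_image_eq[OF S'(1) f T S'(2) xH(2)] by simp_all
  next
    fix S assume "S \<in> {S. S \<in> Orb Y \<and> post f ` S = T}"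
    then have S: "S \<in> Orb Y" "post f ` S = T" by auto
    then obtain x where x: "x \<in> S" using Orb_nonempty[OF S(1)] by blast
    then have "x \<in> U" using S(2) Orb_subset[OF S(1)] by (auto simp: U_def)
    moreover have "S = orbit G (act (sub_gset (A1_set E \<Omega> Y) U)) x"
      using Orb_orbit[OF S(1) x] orb[OF \<open>x \<in> U\<close>] by (rule trans[OF _ sym])
    ultimately show "S \<in> gset_orbits G (sub_gset (A1_set E \<Omega> Y) U)"
      by (auto simp: orbits_def)
  qed
  have "\<mu> (sub_gset (sub_gset (A1_set E \<Omega> Y) U) S) (orb_gset X T)
      (restrict (restrict (A1_map E \<Omega> f) U) S) = orb_measure Y X f S T"
    if S: "S \<in> {S. S \<in> Orb Y \<and> post f ` S = T}" for S
  proof -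
    have SH: "S \<subseteq> H Y" using S Orb_subset by blast
    then have SU: "S \<subseteq> U" using S by (auto simp: U_def)
    have "sub_gset (sub_gset (A1_set E \<Omega> Y) U) S = orb_gset Y S"
      using SU by (simp add: sub_gset_def restrict_restrict Int_absorb1)
    moreover have "restrict (restrict (A1_map E \<Omega> f) U) S = restrict (post f) S"
      using SU SH by (simp add: map restrict_restrict Int_absorb1)
    ultimately show ?thesis by (simp add: orb_measure_def)
  qed
  then show ?thesis
    unfolding U measure_ext_def orbits fibre_measure_def by (rule sum.cong[OF refl])
qed

lemma measure_constant_iff:
  assumes f: "f \<in> homset E Y X"
  shows "measure_constant G \<mu> (A1_set E \<Omega> Y) (A1_set E \<Omega> X) (A1_map E \<Omega> f) \<longleftrightarrow>
    (\<exists>v. \<forall>T\<in>Orb X. fibre_measure Y X f T = v)"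
  unfolding measure_constant_def gset_orbits_A1 using measure_ext_A1[OF f] by simp

text \<open>As A_1 preserves pullbacks, the fibre product of the orbits \<open>S\<close> and
  \<open>T'\<close> is the disjoint union of those orbits of A_1 of the fibre product that map onto
  both. The third axiom for measures then applies.\<close>

lemma orb_measure_base_change:
  assumes pb: "pullback E f g p q" and f: "f \<in> homset E Y X" and g: "g \<in> homset E X' X"
    and S: "S \<in> Orb Y" "post f ` S = post g ` T'" and T': "T' \<in> Orb X'"
  shows "orb_measure Y X f S (post g ` T') =
    (\<Sum>S' | S' \<in> Orb (Dom E p) \<and> post p ` S' = S \<and> post q ` S' = T'. orb_measure (Dom E p) X' q S' T')"
proof -
  define D where "D = {S'. S' \<in> Orb (Dom E p) \<and> post p ` S' = S \<and> post q ` S' = T'}"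
  note pq = pullbackD(1,2)[OF pb f g]
  have T: "post g ` T' \<in> Orb X" using Orb_image[OF T' g] .
  have "finite D"
    using finite_Orb[OF Obj_homset(1)[OF pq(1)]] by (rule rev_finite_subset) (auto simp: D_def)
  \<comment> \<open>The axiom indexes the pieces of a fibre product by natural numbers.\<close>
  then obtain e where e: "bij_betw e {0..<card D} D"
    using ex_bij_betw_nat_finite by blast
  then have eD: "e i \<in> D" if "i \<in> {0..<card D}" for i using that by (auto simp: bij_betw_def)
  have DO: "S' \<in> Orb (Dom E p)" "post p ` S' = S" "post q ` S' = T'" if "S' \<in> D" for S'
    using that by (simp_all add: D_def)
  have "orb_measure Y X f S (post g ` T') = (\<Sum>i\<in>{0..<card D}. orb_measure (Dom E p) X' q (e i) T')"
    unfolding orb_measure_def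
  proof (rule measure_base_change)
    show "restrict (post g) T' \<in> gset_maps G (orb_gset X' T') (orb_gset X (post g ` T'))"
      by (rule restrict_post_gset_maps[OF T' g T refl])
    fix i assume i: "i \<in> {0..<card D}"
    show "C_atom E \<Omega> (orb_gset (Dom E p) (e i))" by (rule C_atom_orb_gset[OF DO(1)[OF eD[OF i]]])
    show "restrict (post p) (e i) \<in> gset_maps G (orb_gset (Dom E p) (e i)) (orb_gset Y S)"
      by (rule restrict_post_gset_maps[OF DO(1)[OF eD[OF i]] pq(1) S(1) DO(2)[OF eD[OF i]]])
    show "restrict (post q) (e i) \<in> gset_maps G (orb_gset (Dom E p) (e i)) (orb_gset X' T')"
      by (rule restrict_post_gset_maps[OF DO(1)[OF eD[OF i]] pq(2) T' DO(3)[OF eD[OF i]]])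
  next
    let ?\<psi> = "\<lambda>(i, z). (restrict (post p) (e i) z, restrict (post q) (e i) z)"
    let ?A = "SIGMA i:{0..<card D}. pts (orb_gset (Dom E p) (e i))"
    let ?R = "{(y, x'). (y, x') \<in> pts (orb_gset Y S) \<times> pts (orb_gset X' T') \<and>
      restrict (post f) S y = restrict (post g) T' x'}"
    have \<psi>: "?\<psi> (i, z) = (post p z, post q z)" if "z \<in> e i" for i z using that by simp
    have inj: "inj_on ?\<psi> ?A"
    proof (rule inj_onI, clarsimp)
      fix i j z w
      assume i: "i < card D" "j < card D" and z: "z \<in> e i" "w \<in> e j"
        and eq: "post p z = post p w" "post q z = post q w"
      have O: "e i \<in> Orb (Dom E p)" "e j \<in> Orb (Dom E p)" using DO(1) eD i by simp_all
      have zH: "z \<in> H (Dom E p)" "w \<in> H (Dom E p)"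
        using subsetD[OF Orb_subset[OF O(1)] z(1)] subsetD[OF Orb_subset[OF O(2)] z(2)] .
      have zw: "z = w" by (rule postcomp_pullback_unique[OF pb f g zH eq])
      \<comment> \<open>Orbits with a common point coincide, and the enumeration has no
        repetitions.\<close>
      then have "e i = e j" using Orb_eq[OF O z(1)] z(2) by simp
      then have "i = j" using e i by (auto simp: bij_betw_def dest: inj_onD)
      then show "i = j \<and> z = w" using zw by simp
    qed
    have "?\<psi> ` ?A = ?R"
    proof (intro equalityI subsetI)
      fix r assume "r \<in> ?\<psi> ` ?A"
      then obtain i z where i: "i \<in> {0..<card D}" and z: "z \<in> e i" and r: "r = (post p z, post q z)"
        by auto
      note O = DO[OF eD[OF i]]
      have zH: "z \<in> H (Dom E p)" using Orb_subset[OF O(1)] z by blast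
      have "post f (post p z) = post g (post q z)"
        using postcomp_Cmp[OF zH pq(1) f] postcomp_Cmp[OF zH pq(2) g] pullbackD(3)[OF pb f g] by simp
      moreover have "post p z \<in> S" "post q z \<in> T'" using O(2,3) z by auto
      ultimately show "r \<in> ?R" using r by simp
    next
      fix r assume "r \<in> ?R"
      then obtain y x where r: "r = (y, x)" and yx: "y \<in> S" "x \<in> T'" "post f y = post g x"
        by auto
      have "y \<in> H Y" "x \<in> H X'"
        using subsetD[OF Orb_subset[OF S(1)] yx(1)] subsetD[OF Orb_subset[OF T'] yx(2)] .
      then obtain z where z: "z \<in> H (Dom E p)" "post p z = y" "post q z = x"
        using postcomp_pullback[OF pb f g _ _ yx(3)] by blast
      obtain S' where S': "S' \<in> Orb (Dom E p)" "z \<in> S'" using Orb_cover[OF z(1)] by blast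
      have "S' \<in> D"
        using S' Orb_image_eq[OF S'(1) pq(1) S(1) S'(2)] Orb_image_eq[OF S'(1) pq(2) T' S'(2)] z yx
        by (simp add: D_def)
      then have "S' \<in> e ` {0..<card D}" by (simp only: bij_betw_imp_surj_on[OF e])
      then obtain i where "i \<in> {0..<card D}" "e i = S'" by blast
      then show "r \<in> ?\<psi> ` ?A"
        using S'(2) z r by (intro image_eqI[of _ _ "(i, z)"]) auto
    qed
    with inj show "bij_betw ?\<psi> ?A ?R" by (simp add: bij_betw_def)
  qed (simp_all add: C_atom_orb_gset restrict_post_gset_maps S T T' f)
  also have "\<dots> = (\<Sum>S'\<in>D. orb_measure (Dom E p) X' q S' T')"
    by (rule sum.reindex_bij_betw[OF e])
  finally show ?thesis by (simp add: D_def)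
qed

text \<open>Sort the orbits over \<open>T'\<close> by their image \<open>S\<close> in A_1(Y). Each
  \<open>S\<close> so obtained lies over the image of \<open>T'\<close>, and the orbits above it add
  up to its measure.\<close>

lemma fibre_measure_base_change:
  assumes pb: "pullback E f g p q" and f: "f \<in> homset E Y X" and g: "g \<in> homset E X' X"
    and T': "T' \<in> Orb X'"
  shows "fibre_measure (Dom E p) X' q T' = fibre_measure Y X f (post g ` T')"
proof -
  let ?P = "{S'. S' \<in> Orb (Dom E p) \<and> post q ` S' = T'}"
  let ?S = "{S. S \<in> Orb Y \<and> post f ` S = post g ` T'}"
  note pq = pullbackD(1,2)[OF pb f g]
  have fin: "finite ?P" "finite ?S"
    using finite_Orb[OF Obj_homset(1)[OF pq(1)]] finite_Orb[OF Obj_homset(1)[OF f]] by simp_all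
  have sub: "image (post p) ` ?P \<subseteq> ?S"
  proof (rule image_subsetI)
    fix S' assume "S' \<in> ?P"
    then have S': "S' \<in> Orb (Dom E p)" "post q ` S' = T'" by auto
    have "post f ` post p ` S' = post g ` T'"
      using post_image_Cmp[OF S'(1) pq(1) f] post_image_Cmp[OF S'(1) pq(2) g] S'(2)
        pullbackD(3)[OF pb f g] by simp
    then show "post p ` S' \<in> ?S" using Orb_image[OF S'(1) pq(1)] by simp
  qed
  have "fibre_measure Y X f (post g ` T') = (\<Sum>S\<in>?S. \<Sum>S' | S' \<in> ?P \<and> post p ` S' = S.
      orb_measure (Dom E p) X' q S' T')"
    unfolding fibre_measure_def
  proof (rule sum.cong[OF refl])
    fix S assume "S \<in> ?S"
    moreover have "{S'. S' \<in> Orb (Dom E p) \<and> post p ` S' = S \<and> post q ` S' = T'} =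
        {S' \<in> ?P. post p ` S' = S}" by auto
    ultimately show "orb_measure Y X f S (post g ` T') =
        (\<Sum>S' | S' \<in> ?P \<and> post p ` S' = S. orb_measure (Dom E p) X' q S' T')"
      using orb_measure_base_change[OF pb f g _ _ T', of S] by simp
  qed
  also have "\<dots> = fibre_measure (Dom E p) X' q T'"
    unfolding fibre_measure_def by (rule sum.group[OF fin sub])
  finally show ?thesis by simp
qed

text \<open>The injection matches the orbits of A_1(Z) with the orbits of A_1(Y) inside its image.
  As it has measure 1 on each orbit, no value changes.\<close>

lemma fibre_measure_restrict:
  assumes n: "injection E n" "n \<in> homset E Z Y" and f: "f \<in> homset E Y X"
  shows "fibre_measure Z X (f \<odot> n) T =
    (\<Sum>S | S \<in> Orb Y \<and> post f ` S = T \<and> S \<subseteq> post n ` H Z. orb_measure Y X f S T)"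
proof -
  let ?A = "{S. S \<in> Orb Z \<and> post (f \<odot> n) ` S = T}"
  let ?C = "{S. S \<in> Orb Y \<and> post f ` S = T \<and> S \<subseteq> post n ` H Z}"
  have inj: "inj_on (image (post n)) ?A"
  proof (rule inj_onI)
    fix S S' assume "S \<in> ?A" "S' \<in> ?A" and eq: "post n ` S = post n ` S'"
    then have "S \<subseteq> H Z" "S' \<subseteq> H Z" using Orb_subset by simp_all
    then show "S = S'" using inj_on_image_eq_iff[OF inj_on_postcomp[OF n]] eq by blast
  qed
  have "image (post n) ` ?A = ?C"
  proof (intro equalityI subsetI)
    fix S assume "S \<in> image (post n) ` ?A"
    then obtain S' where S': "S' \<in> Orb Z" "post (f \<odot> n) ` S' = T" "S = post n ` S'" by blast
    then show "S \<in> ?C"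
      using Orb_image[OF S'(1) n(2)] post_image_Cmp[OF S'(1) n(2) f] Orb_subset[OF S'(1)] by blast
  next
    fix S assume "S \<in> ?C"
    then have S: "S \<in> Orb Y" "post f ` S = T" "S \<subseteq> post n ` H Z" by auto
    obtain x where x: "x \<in> S" using Orb_nonempty[OF S(1)] by blast
    then obtain z where z: "z \<in> H Z" "x = post n z" using S(3) by blast
    obtain S' where S': "S' \<in> Orb Z" "z \<in> S'" using Orb_cover[OF z(1)] by blast
    have "post n ` S' = S" using Orb_image_eq[OF S'(1) n(2) S(1) S'(2)] x z(2) by simp
    then show "S \<in> image (post n) ` ?A"
      using S' S(2) post_image_Cmp[OF S'(1) n(2) f] by (intro image_eqI[of _ _ S']) simp_all
  qed
  moreover have "orb_measure Z X (f \<odot> n) S T = orb_measure Y X f (post n ` S) T" if S: "S \<in> ?A" for S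
  proof -
    have SO: "S \<in> Orb Z" using S by simp
    have "post f ` post n ` S = T" using S post_image_Cmp[OF SO n(2) f] by simp
    then show ?thesis
      using orb_measure_Cmp[OF SO n(2) f refl] orb_measure_injection[OF SO n(2,1)] by simp
  qed
  ultimately show ?thesis
    unfolding fibre_measure_def using sum.reindex[OF inj, of "\<lambda>S. orb_measure Y X f S T"] by simp
qed

section \<open>Degrees of isomorphisms and composites\<close>

lemma deg_iso:
  assumes f: "f \<in> homset E Y X" "is_iso E f" and Y: "principal_object E Y"
  shows "deg f = 1"
proof -
  obtain g where g: "g \<in> homset E X Y" "g \<odot> f = Ide E Y" "f \<odot> g = Ide E X"
    using is_isoE[OF f(2,1)] by blast
  have gs: "surjection E g" using is_iso_surjection[OF is_isoI[OF g(1) f(1) g(3,2)]] .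
  note fB = post_image_B[OF f(1) is_iso_surjection[OF f(2)] Y]
  \<comment> \<open>The inverse carries B(X) into B(Y), so no other orbit lies over B(X).\<close>
  have eq: "S = B Y" if S: "S \<in> Orb Y" "post f ` S = B X" for S
  proof -
    obtain x where x: "x \<in> S" using Orb_nonempty[OF S(1)] by blast
    have xH: "x \<in> H Y" using Orb_subset[OF S(1)] x by blast
    have "post g (post f x) \<in> B Y" using S(2) x by (intro post_in_B[OF _ g(1) gs]) blast
    then have "x \<in> B Y" using postcomp_Cmp[OF xH f(1) g(1)] g(2) postcomp_Ide[OF xH] by simp
    then show ?thesis using Orb_eq[OF S(1) B_in_Orb[OF Y] x] by simp
  qed
  have "{S. S \<in> Orb Y \<and> post f ` S = B X} = {B Y}"
  proof (intro equalityI subsetI)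
    fix S assume "S \<in> {S. S \<in> Orb Y \<and> post f ` S = B X}"
    then show "S \<in> {B Y}" using eq[of S] by simp
  next
    fix S assume "S \<in> {B Y}"
    then show "S \<in> {S. S \<in> Orb Y \<and> post f ` S = B X}" using B_in_Orb[OF Y] fB by simp
  qed
  then show ?thesis
    using orb_measure_injection[OF B_in_Orb[OF Y] f(1) is_iso_injection[OF f(2)]] fB
    by (simp add: deg_eq[OF f(1)] fibre_measure_def)
qed

text \<open>Sort the orbits over B(W) by their image \<open>T\<close> in A_1(X). Each
  \<open>T\<close> contributes its own measure times the fibre measure of \<open>f\<close> over
  \<open>T\<close>; as \<open>T\<close> need not be B(X), constancy over all orbits is what makes
  the second factor \<open>deg f\<close>.\<close>

lemma deg_Cmp:
  assumes f: "f \<in> homset E Y X" and g: "g \<in> homset E X W"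
    and const: "\<And>T. T \<in> Orb X \<Longrightarrow> fibre_measure Y X f T = deg f"
  shows "deg (g \<odot> f) = deg g * deg f"
proof -
  let ?S = "{S. S \<in> Orb Y \<and> post (g \<odot> f) ` S = B W}"
  let ?T = "{T. T \<in> Orb X \<and> post g ` T = B W}"
  have fin: "finite ?S" "finite ?T"
    using finite_Orb[OF Obj_homset(1)[OF f]] finite_Orb[OF Obj_homset(1)[OF g]] by simp_all
  have sub: "image (post f) ` ?S \<subseteq> ?T"
  proof (rule image_subsetI)
    fix S assume "S \<in> ?S"
    then have S: "S \<in> Orb Y" "post (g \<odot> f) ` S = B W" by auto
    then show "post f ` S \<in> ?T" using Orb_image[OF S(1) f] post_image_Cmp[OF S(1) f g] by simp
  qed
  have "deg (g \<odot> f) = (\<Sum>S\<in>?S. orb_measure Y W (g \<odot> f) S (B W))"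
    using deg_eq[OF Cmp_in[OF f g]] by (simp add: fibre_measure_def)
  also have "\<dots> = (\<Sum>T\<in>?T. \<Sum>S | S \<in> ?S \<and> post f ` S = T. orb_measure Y W (g \<odot> f) S (B W))"
    by (rule sum.group[OF fin sub, symmetric])
  also have "\<dots> = (\<Sum>T\<in>?T. orb_measure X W g T (B W) * deg f)"
  proof (rule sum.cong[OF refl])
    fix T assume T: "T \<in> ?T"
    have eq: "{S. S \<in> ?S \<and> post f ` S = T} = {S. S \<in> Orb Y \<and> post f ` S = T}"
    proof (intro equalityI subsetI)
      fix S assume "S \<in> {S. S \<in> Orb Y \<and> post f ` S = T}"
      then have S: "S \<in> Orb Y" "post f ` S = T" by auto
      then show "S \<in> {S. S \<in> ?S \<and> post f ` S = T}" using T post_image_Cmp[OF S(1) f g] by simp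
    qed simp
    have "(\<Sum>S | S \<in> ?S \<and> post f ` S = T. orb_measure Y W (g \<odot> f) S (B W)) =
        (\<Sum>S | S \<in> Orb Y \<and> post f ` S = T. orb_measure X W g T (B W) * orb_measure Y X f S T)"
      unfolding eq using T orb_measure_Cmp[OF _ f g] by (intro sum.cong[OF refl]) simp
    also have "\<dots> = orb_measure X W g T (B W) * deg f"
      using const[of T] T by (simp add: fibre_measure_def flip: sum_distrib_left)
    finally show "(\<Sum>S | S \<in> ?S \<and> post f ` S = T. orb_measure Y W (g \<odot> f) S (B W)) =
        orb_measure X W g T (B W) * deg f" .
  qed
  also have "\<dots> = deg g * deg f"
    by (simp add: deg_eq[OF g] fibre_measure_def sum_distrib_right)
  finally show ?thesis .
qed

section \<open>Moebius inversion over the orbits\<close>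

lemma surjection_restrict_iff:
  assumes f: "f \<in> homset E Y X" and m: "m \<in> homset E V Y" and V: "principal_object E V"
  shows "post f ` post m ` B V = B X \<longleftrightarrow> surjection E (f \<odot> m)"
proof -
  have eq: "post f ` post m ` B V = post (f \<odot> m) ` B V"
    using postcomp_Cmp[OF subsetD[OF B_subset] m f] by (simp add: image_image)
  obtain b where b: "b \<in> B V" using B_nonempty[OF V] by blast
  show ?thesis
  proof
    assume "post f ` post m ` B V = B X"
    then have "post (f \<odot> m) ` B V = B X" by (simp only: eq)
    then have "post (f \<odot> m) b \<in> B X" by (rule subsetD[OF equalityD1 imageI[OF b]])
    then show "surjection E (f \<odot> m)"
      by (rule post_in_B_surjection[OF subsetD[OF B_subset b] Cmp_in[OF m f]])
  next
    assume "surjection E (f \<odot> m)"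
    then show "post f ` post m ` B V = B X" using post_image_B[OF Cmp_in[OF m f] _ V] eq by simp
  qed
qed

text \<open>With this, the subobjects whose A_1 contains a given orbit form an upper interval of
  Sub(Y).\<close>

lemma sub_orbit_subset_iff:
  assumes W: "W \<in> Sub E Y" "principal_object E (Dom E (sub_rep W))" and Z: "Z \<in> Sub E Y"
  shows "sub_orbit W \<subseteq> post (sub_rep Z) ` H (Dom E (sub_rep Z)) \<longleftrightarrow> (W, Z) \<in> Sub_order E Y"
proof -
  note iff = post_mem_image_iff[OF sub_rep(1,2)[OF Z Z] sub_rep(2)[OF W(1) W(1)]]
  obtain b where b: "b \<in> B (Dom E (sub_rep W))" using B_nonempty[OF W(2)] by blast
  show ?thesis
    unfolding Sub_order_iff[OF W(1) Z sub_rep_in[OF W(1)] sub_rep_in[OF Z]] sub_orbit_def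
    using iff b by blast
qed

text \<open>An injection whose orbit is B(Y) is also surjective, hence an isomorphism.\<close>

lemma sub_orbit_eq_B_iff:
  assumes W: "W \<in> Sub E Y" "principal_object E (Dom E (sub_rep W))" and Y: "principal_object E Y"
  shows "sub_orbit W = B Y \<longleftrightarrow> W = whole E Y"
proof -
  note n = sub_rep(1,2)[OF W(1) W(1)]
  note YO = principal_object_Obj[OF Y]
  have "sub_orbit W = B Y \<longleftrightarrow> surjection E (sub_rep W)"
    using surjection_restrict_iff[OF Ide_in[OF YO] n(2) W(2)] Ide_Cmp[OF n(2)]
      postcomp_Ide[OF postcomp_in[OF subsetD[OF B_subset] n(2)]]
    by (simp add: sub_orbit_def image_image cong: image_cong)
  also have "\<dots> \<longleftrightarrow> sub_rep W \<in> whole E Y"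
    using mem_whole[OF YO, of "sub_rep W"] n is_iso_surjection
      surjection_injection_is_iso[OF _ n(2,2,1) Ide_in[OF Obj_homset(1)[OF n(2)]] Cmp_Ide[OF n(2)]]
    by blast
  also have "\<dots> \<longleftrightarrow> W = whole E Y"
  proof
    assume "sub_rep W \<in> whole E Y"
    from trans[OF Sub_mem(3)[OF W(1) sub_rep_in[OF W(1)]] Sub_mem(3)[OF whole_in_Sub[OF YO] this, symmetric]]
    show "W = whole E Y" .
  qed (use sub_rep_in[OF W(1)] in simp)
  finally show ?thesis .
qed

text \<open>Write each degree on the right as a sum over the orbits contained in A_1(Z) and exchange
  the sums. An orbit then gets as weight a sum of Moebius values over an interval up to the top of
  Sub(Y), which vanishes unless the orbit is B(Y).\<close>

lemma orb_measure_moebius: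
  assumes f: "f \<in> homset E Y X" "surjection E f" and Y: "principal_object E Y"
  shows "orb_measure Y X f (B Y) (B X) =
    (\<Sum>Z | Z \<in> Sub E Y \<and> image_sub E f Z = whole E X.
       moebius (Sub E Y) (Sub_order E Y) Z (whole E Y) * deg (restrict_sub E f Z))"
proof -
  let ?D = "{Z. Z \<in> Sub E Y \<and> image_sub E f Z = whole E X}"
  let ?O = "{S. S \<in> Orb Y \<and> post f ` S = B X}"
  let ?R = "\<lambda>Z S. S \<subseteq> post (sub_rep Z) ` H (Dom E (sub_rep Z))"
  let ?w = "\<lambda>Z. moebius (Sub E Y) (Sub_order E Y) Z (whole E Y) :: 'k"
  let ?\<phi> = "\<lambda>S. orb_measure Y X f S (B X)"
  note YO = principal_object_Obj[OF Y]
  have finSub: "finite (Sub E Y)" using powered YO by (simp add: finitely_powered_def)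
  have finD: "finite ?D" and finO: "finite ?O" using finSub finite_Orb[OF YO] by simp_all
  have D_iff: "Z \<in> ?D \<longleftrightarrow> surjection E (f \<odot> sub_rep Z)" if "Z \<in> Sub E Y" for Z
    using image_sub_eq_whole_iff[OF f(1) that] that by simp
  have deg: "deg (restrict_sub E f Z) = (\<Sum>S | S \<in> ?O \<and> ?R Z S. ?\<phi> S)" if Z: "Z \<in> ?D" for Z
  proof -
    have ZS: "Z \<in> Sub E Y" using Z by simp
    note n = sub_rep(1,2)[OF ZS ZS]
    show ?thesis
      unfolding restrict_sub_def deg_eq[OF Cmp_in[OF n(2) f(1)]] fibre_measure_restrict[OF n f(1)]
      by (intro sum.cong) auto
  qed
  have weight: "(\<Sum>Z | Z \<in> ?D \<and> ?R Z S. ?w Z) = (if S = B Y then 1 else 0)" if S: "S \<in> ?O" for S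
  proof -
    have SO: "S \<in> Orb Y" "post f ` S = B X" using S by auto
    obtain W where W: "W \<in> Sub E Y" "principal_object E (Dom E (sub_rep W))" and SW: "S = sub_orbit W"
      using Orb_sub_orbit[OF SO(1)] by blast
    note n = sub_rep(1,2)[OF W(1) W(1)]
    have fW: "surjection E (f \<odot> sub_rep W)"
      using surjection_restrict_iff[OF f(1) n(2) W(2)] SO(2) SW by (simp add: sub_orbit_def)
    \<comment> \<open>The condition f(Z) = X does not cut the interval: it holds for
      \<open>W\<close>, hence for every \<open>Z\<close> above \<open>W\<close>.\<close>
    have "Z \<in> ?D \<and> ?R Z S \<longleftrightarrow> (W, Z) \<in> Sub_order E Y \<and> (Z, whole E Y) \<in> Sub_order E Y" for Z
    proof
      assume "Z \<in> ?D \<and> ?R Z S"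
      then show "(W, Z) \<in> Sub_order E Y \<and> (Z, whole E Y) \<in> Sub_order E Y"
        using sub_orbit_subset_iff[OF W, of Z] Sub_order_whole[OF _ YO, of Z] SW by simp
    next
      assume WZ: "(W, Z) \<in> Sub_order E Y \<and> (Z, whole E Y) \<in> Sub_order E Y"
      then have Z: "Z \<in> Sub E Y" by (simp add: Sub_order_def)
      note k = sub_rep(1,2)[OF Z Z]
      have "factors_through E (sub_rep W) (sub_rep Z)"
        using Sub_order_iff[OF W(1) Z sub_rep_in[OF W(1)] sub_rep_in[OF Z]] WZ by simp
      then obtain h where h: "h \<in> homset E (Dom E (sub_rep W)) (Dom E (sub_rep Z))"
          "sub_rep Z \<odot> h = sub_rep W"
        using factors_throughE[OF _ n(2) k(2)] by blast
      have "surjection E (f \<odot> sub_rep Z)"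
        using surjection_left[OF _ h(1) Cmp_in[OF k(2) f(1)]] Cmp_assoc[OF h(1) k(2) f(1)] h(2) fW by simp
      then show "Z \<in> ?D \<and> ?R Z S"
        using D_iff[OF Z] sub_orbit_subset_iff[OF W Z] WZ SW by simp
    qed
    then have "(\<Sum>Z | Z \<in> ?D \<and> ?R Z S. ?w Z) =
        (\<Sum>Z | (W, Z) \<in> Sub_order E Y \<and> (Z, whole E Y) \<in> Sub_order E Y. ?w Z)"
      by (simp only:)
    also have "\<dots> = (if W = whole E Y then 1 else 0)"
      by (rule moebius_sum_lower[OF finSub partial_order_Sub Sub_order_whole[OF W(1) YO]])
    finally show ?thesis using sub_orbit_eq_B_iff[OF W Y] SW by simp
  qed
  have "(\<Sum>Z\<in>?D. ?w Z * deg (restrict_sub E f Z)) = (\<Sum>Z\<in>?D. \<Sum>S\<in>{S \<in> ?O. ?R Z S}. ?w Z * ?\<phi> S)"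
    by (rule sum.cong[OF refl]) (simp only: deg sum_distrib_left)
  also have "\<dots> = (\<Sum>S\<in>?O. \<Sum>Z\<in>{Z \<in> ?D. ?R Z S}. ?w Z * ?\<phi> S)"
    by (rule sum.swap_restrict[OF finD finO])
  also have "\<dots> = (\<Sum>S\<in>?O. (if S = B Y then 1 else 0) * ?\<phi> S)"
    by (rule sum.cong[OF refl]) (simp only: weight flip: sum_distrib_right)
  also have "\<dots> = (\<Sum>S\<in>?O. if S = B Y then ?\<phi> S else 0)"
    by (rule sum.cong[OF refl]) simp
  also have "\<dots> = ?\<phi> (B Y)"
    using finO B_in_Orb[OF Y] post_image_B[OF f Y] by (simp add: sum.delta')
  finally show ?thesis ..
qed

section \<open>The degree function and its uniqueness\<close>

lemma mem_Arr_principal_cat: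
  "f \<in> Arr (principal_cat E) \<longleftrightarrow> f \<in> homset E (Dom E f) (Cod E f) \<and>
    principal_object E (Dom E f) \<and> principal_object E (Cod E f) \<and> surjection E f"
  by (auto simp: principal_cat_def homset_iff)

lemma degree_function_deg:
  assumes const: "\<And>X Y f T. \<lbrakk>principal_object E Y; f \<in> homset E Y X; surjection E f; T \<in> Orb X\<rbrakk>
      \<Longrightarrow> fibre_measure Y X f T = deg f"
  shows "degree_function E deg"
  unfolding degree_function_def
proof (intro conjI ballI impI allI)
  fix f assume "f \<in> Arr (principal_cat E)" "is_iso E f"
  then show "deg f = 1" using deg_iso by (auto simp: mem_Arr_principal_cat)
next
  fix f g assume f: "f \<in> Arr (principal_cat E)" and g: "g \<in> Arr (principal_cat E)"
    and fg: "Cod E f = Dom E g"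
  have "f \<in> homset E (Dom E f) (Dom E g)" "g \<in> homset E (Dom E g) (Cod E g)"
    using f g fg by (auto simp: mem_Arr_principal_cat)
  then show "deg (g \<odot> f) = deg g * deg f"
    by (rule deg_Cmp) (rule const, use f fg in \<open>auto simp: mem_Arr_principal_cat\<close>)
next
  fix f g p f' assume f: "f \<in> Arr (principal_cat E)"
    and "principal_object E (Dom E g) \<and> pullback E f g p f'"
  then have g: "principal_object E (Dom E g)" and pb: "pullback E f g p f'" by auto
  have fh: "f \<in> homset E (Dom E f) (Cod E f)" using f by (simp add: mem_Arr_principal_cat)
  have gh: "g \<in> homset E (Dom E g) (Cod E f)" using pb by (auto simp: pullback_def homset_iff)
  have "deg f' = fibre_measure (Dom E p) (Dom E g) f' (B (Dom E g))"
    by (rule deg_eq[OF pullbackD(2)[OF pb fh gh]])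
  \<comment> \<open>For a non-surjective \<open>g\<close> the image of B(X') is an orbit other than
    B(X); constancy of the fibre measure leads back to \<open>deg f\<close>.\<close>
  also have "\<dots> = fibre_measure (Dom E f) (Cod E f) f (post g ` B (Dom E g))"
    by (rule fibre_measure_base_change[OF pb fh gh B_in_Orb[OF g]])
  also have "\<dots> = deg f"
    using f by (intro const Orb_image[OF B_in_Orb[OF g] gh]) (auto simp: mem_Arr_principal_cat)
  finally show "deg f' = deg f" .
qed

text \<open>The number of orbits is the induction measure for uniqueness. It drops because B(Y) is
  not among the orbits coming from a proper subobject.\<close>

lemma card_Orb_less:
  assumes n: "injection E n" "n \<in> homset E Z Y" "\<not> surjection E n" and Y: "principal_object E Y"
  shows "card (Orb Z) < card (Orb Y)"
proof -
  have fin: "finite (Orb Y)" by (rule finite_Orb[OF principal_object_Obj[OF Y]])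
  have "inj_on (image (post n)) (Orb Z)"
  proof (rule inj_onI)
    fix S S' assume S: "S \<in> Orb Z" "S' \<in> Orb Z" and eq: "post n ` S = post n ` S'"
    show "S = S'"
      using inj_on_image_eq_iff[OF inj_on_postcomp[OF n(1,2)] Orb_subset[OF S(1)] Orb_subset[OF S(2)]] eq
      by simp
  qed
  moreover have "image (post n) ` Orb Z \<subseteq> Orb Y - {B Y}"
  proof (rule image_subsetI)
    fix S assume S: "S \<in> Orb Z"
    have "post n ` S \<noteq> B Y"
    proof
      assume eq: "post n ` S = B Y"
      obtain x where x: "x \<in> S" using Orb_nonempty[OF S] by blast
      then have "post n x \<in> B Y" using eq by blast
      then show False using post_in_B_surjection[OF subsetD[OF Orb_subset[OF S] x] n(2)] n(3) by simp
    qed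
    then show "post n ` S \<in> Orb Y - {B Y}" using Orb_image[OF S n(2)] by simp
  qed
  ultimately have "card (Orb Z) \<le> card (Orb Y - {B Y})"
    using fin by (intro card_inj_on_le) auto
  also have "\<dots> < card (Orb Y)" by (rule card_Diff1_less[OF fin B_in_Orb[OF Y]])
  finally show ?thesis .
qed

text \<open>The formula is a unitriangular system: the term at the whole of \<open>Y\<close> has
  coefficient 1, and all others concern surjections from proper subobjects, where both functions
  agree by induction.\<close>

lemma degree_function_unique:
  assumes \<nu>: "degree_function E \<nu>"
    and formula: "\<And>X Y f. \<lbrakk>principal_object E Y; f \<in> homset E Y X; surjection E f\<rbrakk> \<Longrightarrow>
      orb_measure Y X f (B Y) (B X) =
        (\<Sum>Z | Z \<in> Sub E Y \<and> image_sub E f Z = whole E X.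
           moebius (Sub E Y) (Sub_order E Y) Z (whole E Y) * \<nu> (restrict_sub E f Z))"
    and "principal_object E Y" "f \<in> homset E Y X" "surjection E f"
  shows "\<nu> f = deg f"
  using assms(3-5)
\<comment> \<open>The target \<open>X\<close> stays fixed, since restricting \<open>f\<close> to a
  subobject changes only the source.\<close>
proof (induction "card (Orb Y)" arbitrary: Y f rule: less_induct)
  case less
  note Y = less.prems(1) and f = less.prems(2,3)
  let ?D = "{Z. Z \<in> Sub E Y \<and> image_sub E f Z = whole E X}"
  let ?w = "\<lambda>Z. moebius (Sub E Y) (Sub_order E Y) Z (whole E Y) :: 'k"
  note YO = principal_object_Obj[OF Y]
  have X: "principal_object E X" using Y f(1) by (rule principal_object_Cod)
  have finSub: "finite (Sub E Y)" using powered YO by (simp add: finitely_powered_def)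
  then have finD: "finite ?D" by simp
  \<comment> \<open>The chosen representative of the whole subobject is an isomorphism, not
    necessarily the identity. The top term therefore concerns \<open>f\<close> composed with
    \<open>n\<close>, which is corrected at the end.\<close>
  define n where "n = sub_rep (whole E Y)"
  have n: "is_iso E n" "n \<in> homset E (Dom E n) Y"
    using sub_rep_in[OF whole_in_Sub[OF YO]] mem_whole[OF YO, of n] by (simp_all add: n_def)
  have N: "principal_object E (Dom E n)"
    by (rule principal_object_Dom[OF Y n(2) is_iso_surjection[OF n(1)]])
  have fn: "surjection E (f \<odot> n)" by (rule surjection_Cmp[OF is_iso_surjection[OF n(1)] f(2) n(2) f(1)])
  have whole: "whole E Y \<in> ?D"
    using image_sub_eq_whole_iff[OF f(1) whole_in_Sub[OF YO]] whole_in_Sub[OF YO] fn by (simp add: n_def)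
  have IH: "\<nu> (restrict_sub E f Z) = deg (restrict_sub E f Z)" if Z: "Z \<in> ?D - {whole E Y}" for Z
  proof -
    have ZS: "Z \<in> Sub E Y" using Z by simp
    note k = sub_rep(1,2)[OF ZS ZS]
    have sk: "surjection E (f \<odot> sub_rep Z)" using image_sub_eq_whole_iff[OF f(1) ZS] Z by simp
    have fk: "f \<odot> sub_rep Z \<in> homset E (Dom E (sub_rep Z)) X" using k(2) f(1) by (rule Cmp_in)
    have K: "principal_object E (Dom E (sub_rep Z))" by (rule principal_object_Dom[OF X fk sk])
    have "\<not> surjection E (sub_rep Z)"
    proof
      assume "surjection E (sub_rep Z)"
      then have "post (Ide E Y) ` sub_orbit Z = B Y"
        using surjection_restrict_iff[OF Ide_in[OF YO] k(2) K] Ide_Cmp[OF k(2)] by (simp add: sub_orbit_def)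
      moreover have "post (Ide E Y) x = x" if "x \<in> sub_orbit Z" for x
        using postcomp_Ide[of x Y] subsetD[OF Orb_subset[OF OrbI[OF k K]], of x] that
        by (simp add: sub_orbit_def)
      ultimately have "sub_orbit Z = B Y" by simp
      then show False using sub_orbit_eq_B_iff[OF ZS K Y] Z by simp
    qed
    then have "card (Orb (Dom E (sub_rep Z))) < card (Orb Y)" by (rule card_Orb_less[OF k _ Y])
    then show ?thesis unfolding restrict_sub_def using less.hyps K fk sk by blast
  qed
  have ww: "?w (whole E Y) = 1"
    using moebius_sum_lower[OF finSub partial_order_Sub Sub_order_whole[OF whole_in_Sub[OF YO] YO], where 'k = 'k]
      moebius.simps[of "Sub E Y" "Sub_order E Y" "whole E Y" "whole E Y"] finSub partial_order_Sub
      Sub_order_whole[OF whole_in_Sub[OF YO] YO] by simp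
  have "(\<Sum>Z\<in>?D. ?w Z * \<nu> (restrict_sub E f Z)) = (\<Sum>Z\<in>?D. ?w Z * deg (restrict_sub E f Z))"
    using formula[OF Y f] orb_measure_moebius[OF f Y] by simp
  then have "\<nu> (restrict_sub E f (whole E Y)) + (\<Sum>Z\<in>?D - {whole E Y}. ?w Z * \<nu> (restrict_sub E f Z)) =
      deg (restrict_sub E f (whole E Y)) + (\<Sum>Z\<in>?D - {whole E Y}. ?w Z * deg (restrict_sub E f Z))"
    unfolding sum.remove[OF finD whole] ww by simp
  moreover have "(\<Sum>Z\<in>?D - {whole E Y}. ?w Z * \<nu> (restrict_sub E f Z)) =
      (\<Sum>Z\<in>?D - {whole E Y}. ?w Z * deg (restrict_sub E f Z))"
    by (rule sum.cong[OF refl]) (simp only: IH)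
  ultimately have eq: "\<nu> (f \<odot> n) = deg (f \<odot> n)" by (simp add: restrict_sub_def n_def)
  have fA: "f \<in> Arr (principal_cat E)" and nA: "n \<in> Arr (principal_cat E)" and "Cod E n = Dom E f"
    using f n X Y N is_iso_surjection[OF n(1)] homsetD[OF f(1)] homsetD[OF n(2)]
    by (simp_all add: mem_Arr_principal_cat)
  then have "\<nu> (f \<odot> n) = \<nu> f * \<nu> n" "\<nu> n = 1"
    using \<nu> n(1) unfolding degree_function_def by blast+
  moreover have "deg (f \<odot> n) = deg f"
  proof -
    obtain l where l: "l \<in> homset E Y (Dom E n)" "n \<odot> l = Ide E Y" using is_isoE[OF n] by blast
    have "y \<in> post n ` H (Dom E n)" if "y \<in> H Y" for y
      using postcomp_Cmp[OF that l(1) n(2)] l(2) postcomp_Ide[OF that] postcomp_in[OF that l(1)]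
      by (intro image_eqI[of _ _ "post l y"]) simp_all
    then have "S \<subseteq> post n ` H (Dom E n)" if "S \<in> Orb Y" for S
      using Orb_subset[OF that] by blast
    then have "{S. S \<in> Orb Y \<and> post f ` S = B X \<and> S \<subseteq> post n ` H (Dom E n)} =
        {S. S \<in> Orb Y \<and> post f ` S = B X}" by blast
    then show ?thesis
      using fibre_measure_restrict[OF is_iso_injection[OF n(1)] n(2) f(1)]
      by (simp add: deg_eq[OF f(1)] deg_eq[OF Cmp_in[OF n(2) f(1)]] fibre_measure_def)
  qed
  ultimately show ?case using eq by simp
qed

lemma fibre_measure_eq_deg:
  assumes \<nu>: "degree_function E \<nu>"
    and eq: "\<And>X Y f. \<lbrakk>principal_object E Y; f \<in> homset E Y X; surjection E f\<rbrakk> \<Longrightarrow> \<nu> f = deg f"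
    and Y: "principal_object E Y" and f: "f \<in> homset E Y X" "surjection E f" and T: "T \<in> Orb X"
  shows "fibre_measure Y X f T = deg f"
proof -
  obtain m V where m: "injection E m" "m \<in> homset E V X" and V: "principal_object E V"
    and Tm: "T = post m ` B V"
    using OrbE[OF T] by blast
  obtain p q where pb: "pullback E f m p q" using pullback_exists[OF complete f(1) m(2)] by blast
  note q = pullbackD(2)[OF pb f(1) m(2)] surjection_pullback[OF pb f(2)]
  \<comment> \<open>As a surjection onto a principal object, \<open>q\<close> is itself a surjection
    of principal objects, so \<open>eq\<close> covers it too.\<close>
  have P: "principal_object E (Dom E p)" by (rule principal_object_Dom[OF V q])
  have "f \<in> Arr (principal_cat E)"
    using f Y principal_object_Cod[OF Y f(1)] homsetD[OF f(1)] by (simp add: mem_Arr_principal_cat)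
  moreover have "principal_object E (Dom E m)" using V homsetD(2)[OF m(2)] by simp
  ultimately have "\<nu> q = \<nu> f" using \<nu> pb unfolding degree_function_def by blast
  then have "deg q = deg f" using eq[OF P q] eq[OF Y f] by simp
  then show ?thesis
    using fibre_measure_base_change[OF pb f(1) m(2) B_in_Orb[OF V]] deg_eq[OF q(1)] Tm by simp
qed

end

theorem proposition6p11:
  fixes E :: "('o, 'm) category"
    and \<Omega> :: "('i, 'o, 'm) pro_object"
    and \<mu> :: "('i, 'm) pro_gset \<Rightarrow> ('i, 'm) pro_gset \<Rightarrow> (('i \<times> 'm) set \<Rightarrow> ('i \<times> 'm) set)
                \<Rightarrow> 'k :: {comm_ring, comm_monoid_mult}"
  assumes "regular_category E"
    and "finitely_powered E"
    and "is_pro_object (principal_cat E) \<Omega>"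
    and "universal_pro E \<Omega>"
    and "homogeneous_pro E \<Omega>"
    and "is_C_measure E \<Omega> \<mu>"
  shows
    "(\<exists>\<nu> :: 'm \<Rightarrow> 'k. degree_function E \<nu> \<and>
        (\<forall>X Y f. principal_object E X \<and> principal_object E Y \<and> f \<in> homset E Y X \<and> surjection E f \<longrightarrow>
           \<mu> (B_set E \<Omega> Y) (B_set E \<Omega> X) (B_map E \<Omega> f) =
             (\<Sum>Z | Z \<in> Sub E Y \<and> image_sub E f Z = whole E X.
                moebius (Sub E Y) (Sub_order E Y) Z (whole E Y) * \<nu> (restrict_sub E f Z))))
     \<longleftrightarrow>
     (\<forall>X Y f. principal_object E X \<and> principal_object E Y \<and> f \<in> homset E Y X \<and> surjection E f \<longrightarrow>
        measure_constant (Aut_pro E \<Omega>) \<mu> (A1_set E \<Omega> Y) (A1_set E \<Omega> X) (A1_map E \<Omega> f))"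
proof -
  interpret measured_pro_object E \<Omega> \<mu>
    using assms
    by (simp add: measured_pro_object_def measured_pro_object_axioms_def homogeneous_pro_object_def
      homogeneous_pro_object_axioms_def principal_pro_object_def principal_pro_object_axioms_def
      regular_category_iff)
  show ?thesis (is "?A \<longleftrightarrow> ?B")
  proof
    assume ?A
    then obtain \<nu> :: "'m \<Rightarrow> 'k" where \<nu>: "degree_function E \<nu>"
      and formula: "\<And>X Y f. \<lbrakk>principal_object E X; principal_object E Y; f \<in> homset E Y X; surjection E f\<rbrakk>
        \<Longrightarrow> \<mu> (B_set E \<Omega> Y) (B_set E \<Omega> X) (B_map E \<Omega> f) =
             (\<Sum>Z | Z \<in> Sub E Y \<and> image_sub E f Z = whole E X.
                moebius (Sub E Y) (Sub_order E Y) Z (whole E Y) * \<nu> (restrict_sub E f Z))"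
      by blast
    have \<nu>_eq: "\<nu> f = deg f" if f: "principal_object E Y" "f \<in> homset E Y X" "surjection E f" for X Y f
    proof (rule degree_function_unique[OF \<nu> _ f])
      fix X Y f assume f: "principal_object E Y" "f \<in> homset E Y X" "surjection E f"
      show "orb_measure Y X f (B Y) (B X) = (\<Sum>Z | Z \<in> Sub E Y \<and> image_sub E f Z = whole E X.
                moebius (Sub E Y) (Sub_order E Y) Z (whole E Y) * \<nu> (restrict_sub E f Z))"
        using formula[OF principal_object_Cod[OF f(1,2)] f] measure_B_map[OF f(2,3,1)] by simp
    qed
    show ?B
    proof (intro allI impI)
      fix X Y f
      assume "principal_object E X \<and> principal_object E Y \<and> f \<in> homset E Y X \<and> surjection E f"
      then have f: "principal_object E Y" "f \<in> homset E Y X" "surjection E f" by auto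
      show "measure_constant G \<mu> (A1_set E \<Omega> Y) (A1_set E \<Omega> X) (A1_map E \<Omega> f)"
        unfolding measure_constant_iff[OF f(2)]
        using fibre_measure_eq_deg[OF \<nu> \<nu>_eq f] by (intro exI[of _ "deg f"] ballI)
    qed
  next
    assume ?B
    have const: "fibre_measure Y X f T = deg f"
      if f: "principal_object E Y" "f \<in> homset E Y X" "surjection E f" and T: "T \<in> Orb X" for X Y f T
    proof -
      have X: "principal_object E X" using f(1,2) by (rule principal_object_Cod)
      have "\<exists>v. \<forall>T\<in>Orb X. fibre_measure Y X f T = v"
        unfolding measure_constant_iff[OF f(2), symmetric] using \<open>?B\<close> X f by blast
      \<comment> \<open>The constant is identified by evaluating at the orbit B(X).\<close>
      then show ?thesis using deg_eq[OF f(2)] B_in_Orb[OF X] T by auto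
    qed
    show ?A
      by (intro exI[of _ deg] conjI allI impI degree_function_deg const)
        (auto simp: measure_B_map orb_measure_moebius)
  qed
qed

end
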